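(* Let $\alpha,\beta,k,c>0$, $T_{\mathrm m}\in\mathbb R$. Consider the closed-loop system consisting of the one-phase Stefan problem $$T_t(x,t)=\alpha T_{xx}(x,t)\ (0\le x\le s(t)),\quad -kT_x(0,t)=q_{\mathrm c}(t),\quad T(s(t),t)=T_{\mathrm m},\quad \dot s(t)=-\beta T_x(s(t),t),$$ with $T(x,0)=T_0(x)$, $s(0)=s_0>0$ and measurement $Y(t)=s(t)$, the observer, for $x\in[0,s(t)]$, $$\hat T_t(x,t)=\alpha\hat T_{xx}(x,t)-p_1(x,s(t))\left(\frac{\dot Y(t)}{\beta}+\hat T_x(s(t),t)\right),\quad -k\hat T_x(0,t)=q_{\mathrm c}(t),\quad \hat T(s(t),t)=T_{\mathrm m},$$ $$p_1(x,s(t))=-\lambda s(t)\,\frac{I_1\!\left(\sqrt{\frac{\lambda}{\alpha}(s(t)^2-x^2)}\right)}{\sqrt{\frac{\lambda}{\alpha}(s(t)^2-x^2)}},\qquad \lambda>0,$$ with $\hat T(x,0)=\hat T_0(x)$, and the output feedback control law $$q_{\mathrm c}(t)=-ck\left(\frac1\alpha\int_0^{Y(t)}(\hat T(x,t)-T_{\mathrm m})\,dx+\frac1\beta(Y(t)-s_{\mathrm r})\right).$$ Assume that the initial values $(\hat T_0,s_0)$ are compatible with the control law, and that the initial plant states satisfy, with a known constant $H$, $0\le T_0(x)-T_{\mathrm m}\le H(s_0-x)$ for all $x\in[0,s_0]$. Let $\hat H_u\ge\hat H_l>H$. Then, for any initial temperature estimate $\hat T_0$, any observer gain parameter $\lambda$,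 and any setpoint $s_{\mathrm r}$ satisfying $$T_{\mathrm m}+\hat H_l(s_0-x)\le\hat T_0(x)\le T_{\mathrm m}+\hat H_u(s_0-x)\quad(0\le x\le s_0),$$ $$\lambda<\frac{4\alpha}{s_0^2}\,\frac{\hat H_l-H}{\hat H_u},\qquad s_{\mathrm r}>s_0+\frac{\beta s_0^2}{2\alpha}\hat H_u,$$ the closed-loop system is exponentially stable in the sense of the norm $$\|T-\hat T\|_{\mathcal H_1}^2+\|T-T_{\mathrm m}\|_{\mathcal H_1}^2+(s(t)-s_{\mathrm r})^2 .$$
   Context: $I_1$ is the modified Bessel function of the first kind of order 1; the quotient $I_1(z)/z$ is extended continuously by $1/2$ at $z=0$. $(T,s,\hat T)$ denotes the (classical) solution of the closed-loop system for $t\ge0$, with $s(t)>0$. Norms at time $t$: $\|u\|_{\mathcal L_2}^2=\int_0^{s(t)}u(x,t)^2dx$ and $\|u\|_{\mathcal H_1}^2=\|u\|_{\mathcal L_2}^2+\|u_x\|_{\mathcal L_2}^2$. "Exponentially stable in the sense of the norm $\Phi(t)$" means: there exist constants $D,b>0$, depending only on the system parameters, the gains and the setpoint (not on the particular solution), such that $\Phi(t)\le D\,\Phi(0)e^{-bt}$ for all $t\ge0$. "Compatible with the control law" means that the initial data satisfy the boundary conditions at $t=0$: $\hat T_0(s_0)=T_{\mathrm m}$ and $-k\hat T_0'(0)=q_{\mathrm c}(0)$. *)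

theory Defs
  imports "HOL-Analysis.Analysis"
begin

text \<open>Modified Bessel function of the first kind of integer order \<open>n\<close>, by its power series.\<close>

definition bessel_I :: "nat \<Rightarrow> real \<Rightarrow> real" where
  "bessel_I n z = (\<Sum>m. (z / 2) ^ (2 * m + n) / (fact m * fact (m + n)))"

definition bessel_I1_quot :: "real \<Rightarrow> real" where
  "bessel_I1_quot z = (if z = 0 then 1 / 2 else bessel_I 1 z / z)"

definition observer_gain :: "real \<Rightarrow> real \<Rightarrow> real \<Rightarrow> real \<Rightarrow> real" where
  "observer_gain \<alpha> lam x l = - lam * l * bessel_I1_quot (sqrt (lam / \<alpha> * (l\<^sup>2 - x\<^sup>2)))"

text \<open>Value of the control law for the estimated profile \<open>f\<close> on \<open>[0, y]\<close> and interface
  position \<open>y\<close>.\<close>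

definition control_law ::
  "real \<Rightarrow> real \<Rightarrow> real \<Rightarrow> real \<Rightarrow> real \<Rightarrow> real \<Rightarrow> (real \<Rightarrow> real) \<Rightarrow> real \<Rightarrow> real" where
  "control_law \<alpha> \<beta> k c Tm sr f y =
     - c * k * (1 / \<alpha> * integral {0..y} (\<lambda>x. f x - Tm) + 1 / \<beta> * (y - sr))"

text \<open>Squared norms on \<open>[0, l]\<close>. The two-sided derivative may fail to exist at the endpoints,
  which does not affect the integral.\<close>

definition L2_norm_sq :: "real \<Rightarrow> (real \<Rightarrow> real) \<Rightarrow> real" where
  "L2_norm_sq l f = integral {0..l} (\<lambda>x. (f x)\<^sup>2)"

definition H1_norm_sq :: "real \<Rightarrow> (real \<Rightarrow> real) \<Rightarrow> real" where
  "H1_norm_sq l f = L2_norm_sq l f + L2_norm_sq l (deriv f)"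

definition liquid_region :: "(real \<Rightarrow> real) \<Rightarrow> (real \<times> real) set" where
  "liquid_region s = {(x, t). 0 \<le> t \<and> 0 \<le> x \<and> x \<le> s t}"

text \<open>Regularity of a classical solution \<open>u x t\<close> with partial derivatives \<open>ux\<close>, \<open>uxx\<close>, \<open>ut\<close>:
  the second-order regularity holds for \<open>t > 0\<close> up to both ends of \<open>[0, s t]\<close>, and \<open>u\<close>, \<open>ux\<close>
  extend to \<open>t = 0\<close>. The flux \<open>ux\<close> may jump (but stays bounded) at the corner \<open>(0, 0)\<close>, so that
  the initial profile need not satisfy the flux condition at \<open>x = 0\<close>.
  The time derivative is taken within the times at which \<open>x\<close> lies in the liquid, so it is
  one-sided where the interface passes \<open>x\<close>.\<close>

definition classical_regularity ::
  "(real \<Rightarrow> real) \<Rightarrow> (real \<Rightarrow> real \<Rightarrow> real) \<Rightarrow> (real \<Rightarrow> real \<Rightarrow> real) \<Rightarrow>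
    (real \<Rightarrow> real \<Rightarrow> real) \<Rightarrow> (real \<Rightarrow> real \<Rightarrow> real) \<Rightarrow> bool" where
  "classical_regularity s u ux uxx ut \<longleftrightarrow>
     continuous_on (liquid_region s) (\<lambda>(x, t). u x t) \<and>
     continuous_on (liquid_region s - {(0, 0)}) (\<lambda>(x, t). ux x t) \<and>
     (\<forall>\<tau>. bounded ((\<lambda>(x, t). ux x t) ` {(x, t) \<in> liquid_region s. t \<le> \<tau>})) \<and>
     continuous_on {(x, t) \<in> liquid_region s. 0 < t} (\<lambda>(x, t). uxx x t) \<and>
     continuous_on {(x, t) \<in> liquid_region s. 0 < t} (\<lambda>(x, t). ut x t) \<and>
     (\<forall>(x, t) \<in> liquid_region s - {(0, 0)}.
        ((\<lambda>y. u y t) has_real_derivative ux x t) (at x within {0..s t})) \<and>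
     (\<forall>(x, t) \<in> liquid_region s. 0 < t \<longrightarrow>
        ((\<lambda>y. ux y t) has_real_derivative uxx x t) (at x within {0..s t}) \<and>
        ((\<lambda>r. u x r) has_real_derivative ut x t) (at t within {r. (x, r) \<in> liquid_region s}))"

text \<open>Global classical solutions \<open>(T, s, That)\<close> of plant, observer and control law, with the
  measurement \<open>Y = s\<close> substituted.\<close>

definition closed_loop_solution ::
  "real \<Rightarrow> real \<Rightarrow> real \<Rightarrow> real \<Rightarrow> real \<Rightarrow> real \<Rightarrow> real \<Rightarrow>
    (real \<Rightarrow> real) \<Rightarrow> real \<Rightarrow> (real \<Rightarrow> real) \<Rightarrow>
    (real \<Rightarrow> real \<Rightarrow> real) \<Rightarrow> (real \<Rightarrow> real) \<Rightarrow> (real \<Rightarrow> real \<Rightarrow> real) \<Rightarrow> bool" where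
  "closed_loop_solution \<alpha> \<beta> k c Tm lam sr T0 s0 That0 T s That \<longleftrightarrow>
     (\<exists>Tx Txx Tt Thx Thxx Tht sdot.
        classical_regularity s T Tx Txx Tt \<and>
        classical_regularity s That Thx Thxx Tht \<and>
        continuous_on {0..} s \<and>
        (\<forall>t\<ge>0. s t > 0) \<and>
        (\<forall>t>0. (s has_real_derivative sdot t) (at t)) \<and>
        s 0 = s0 \<and>
        (\<forall>x\<in>{0..s0}. T x 0 = T0 x \<and> That x 0 = That0 x) \<and>
        (\<forall>t>0.
           (\<forall>x\<in>{0..s t}. Tt x t = \<alpha> * Txx x t) \<and>
           - k * Tx 0 t = control_law \<alpha> \<beta> k c Tm sr (\<lambda>x. That x t) (s t) \<and>
           T (s t) t = Tm \<and>
           sdot t = - \<beta> * Tx (s t) t \<and>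
           (\<forall>x\<in>{0..s t}. Tht x t =
              \<alpha> * Thxx x t - observer_gain \<alpha> lam x (s t) * (sdot t / \<beta> + Thx (s t) t)) \<and>
           - k * Thx 0 t = control_law \<alpha> \<beta> k c Tm sr (\<lambda>x. That x t) (s t) \<and>
           That (s t) t = Tm))"

definition compatible_with_control ::
  "real \<Rightarrow> real \<Rightarrow> real \<Rightarrow> real \<Rightarrow> real \<Rightarrow> real \<Rightarrow> (real \<Rightarrow> real) \<Rightarrow> real \<Rightarrow> bool" where
  "compatible_with_control \<alpha> \<beta> k c Tm sr That0 s0 \<longleftrightarrow>
     That0 s0 = Tm \<and>
     (\<exists>d. (That0 has_real_derivative d) (at 0 within {0..s0}) \<and>
          - k * d = control_law \<alpha> \<beta> k c Tm sr That0 s0)"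

definition stability_norm ::
  "real \<Rightarrow> real \<Rightarrow> (real \<Rightarrow> real \<Rightarrow> real) \<Rightarrow> (real \<Rightarrow> real) \<Rightarrow> (real \<Rightarrow> real \<Rightarrow> real) \<Rightarrow> real \<Rightarrow> real"
  where
  "stability_norm Tm sr T s That t =
     H1_norm_sq (s t) (\<lambda>x. T x t - That x t) + H1_norm_sq (s t) (\<lambda>x. T x t - Tm) + (s t - sr)\<^sup>2"

end

theory Submission
  imports Defs
begin

text \<open>
  Let \<open>e = T - That\<close>, \<open>u = T - Tm\<close> and \<open>g = e\<^sub>x(s)\<close>. Backstepping turns the error system into
  \<open>w\<^sub>t = \<alpha> w\<^sub>x\<^sub>x - lam w\<close> with \<open>w\<^sub>x(0) = w(s) = 0\<close>. The bounds on the initial data and on \<open>lam\<close> give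
  \<open>w \<le> 0\<close> initially, hence always by the maximum principle; the direct kernel is nonnegative, so
  \<open>e \<le> 0\<close> and \<open>g \<ge> 0\<close>. The scaled control \<open>q\<close> satisfies \<open>q' = - c q + c (1 + \<integral>P) g\<close>, so \<open>q \<ge> 0\<close>, whence
  \<open>u \<ge> 0\<close>, \<open>s' \<ge> 0\<close> and \<open>s \<le> sr\<close>.

  These signs make the decay estimate elementary. With \<open>N = - \<integral> cos(\<kappa> x) e dx\<close>, which is comparable
  to the \<open>L\<^sup>1\<close> norm of \<open>e\<close>, the combination \<open>M = N + \<eta> q\<close> obeys \<open>M' \<le> - m M - (\<alpha>/4) g\<close>: the boundary
  flux \<open>g\<close> is dissipated, and it is the only quantity through which the error drives the rest. Then
  \<open>V = |e\<^sub>x|\<^sup>2 + |u\<^sub>x|\<^sup>2 - 2 q u(0) + |u|\<^sup>2 + K M\<^sup>2\<close> satisfies \<open>V' \<le> - b V\<close> and is equivalent to the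
  stability norm, with constants that do not degenerate as \<open>s0\<close> tends to \<open>0\<close>.
\<close>

text \<open>The backstepping transformation only serves to fix signs; no norm is carried through it,
  and the decay estimate works on e itself. The bound B for the kernels need not be small, so the
  flux g is in general not absorbed by the diffusion of e through its size; its sign is used
  instead, since a linear functional such as N can dissipate g to the first power. Because s \<le>
  sr, the kernels are bounded on one fixed square, and all constants can be chosen before a solution
  is given.

  The regularity dictates the calculus. No mixed derivative u_xt is available, the time derivative
  is one-sided at the interface, and u_x may jump at the corner (0, 0). Time derivatives are
  therefore taken for t > 0 only, from exact increments in the stretched coordinate y = x / s, and
  the initial time is reached by continuity of the functional alone.\<close>

lemma real_fundamental_theorem_of_calculus:
  fixes f f' :: "real \<Rightarrow> real"
  assumes "a \<le> b"
    and "\<And>x. x \<in> {a..b} \<Longrightarrow> (f has_real_derivative f' x) (at x within {a..b})"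
  shows "(f' has_integral (f b - f a)) {a..b}"
  using fundamental_theorem_of_calculus[of a b f f'] assms
  by (simp add: has_real_derivative_iff_has_vector_derivative)

section \<open>The backstepping kernels\<close>

text \<open>\<open>kern z = I\<^sub>1(\<surd>z) / \<surd>z\<close> as an entire function, so that \<open>kern (- z) = J\<^sub>1(\<surd>z) / \<surd>z\<close>.\<close>

definition kern_coeff :: "nat \<Rightarrow> real" where
  "kern_coeff m = (1/4) ^ m / (2 * fact m * fact (m + 1))"

definition kern :: "real \<Rightarrow> real" where
  "kern z = (\<Sum>m. kern_coeff m * z ^ m)"

definition kern' :: "real \<Rightarrow> real" where
  "kern' z = (\<Sum>m. diffs kern_coeff m * z ^ m)"

definition kern'' :: "real \<Rightarrow> real" where
  "kern'' z = (\<Sum>m. diffs (diffs kern_coeff) m * z ^ m)"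

lemma summable_kern: "summable (\<lambda>m. kern_coeff m * z ^ m)"
proof (rule summable_comparison_test)
  show "summable (\<lambda>n. inverse (fact n) * \<bar>z\<bar> ^ n)"
    by (rule summable_exp)
  have "norm (kern_coeff n * z ^ n) \<le> inverse (fact n) * \<bar>z\<bar> ^ n" for n
  proof -
    have "(1/4) ^ n \<le> (1::real)"
      by (simp add: power_le_one)
    moreover have "fact n \<le> (2 * fact n * fact (n + 1) :: real)"
      using fact_ge_1[of "n + 1"] fact_gt_zero[of n] by (smt (verit) mult_le_cancel_left1 mult.assoc)
    ultimately have "kern_coeff n \<le> 1 / fact n"
      unfolding kern_coeff_def by (intro frac_le) auto
    moreover have "0 \<le> kern_coeff n"
      by (simp add: kern_coeff_def)
    ultimately show ?thesis
      by (simp add: abs_mult power_abs divide_inverse mult_right_mono)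
  qed
  then show "\<exists>N. \<forall>n\<ge>N. norm (kern_coeff n * z ^ n) \<le> inverse (fact n) * \<bar>z\<bar> ^ n"
    by blast
qed

lemma DERIV_kern: "(kern has_real_derivative kern' z) (at z)"
  unfolding kern_def[abs_def] kern'_def
  by (rule termdiffs_strong_converges_everywhere) (rule summable_kern)

lemma DERIV_kern': "(kern' has_real_derivative kern'' z) (at z)"
  unfolding kern'_def[abs_def] kern''_def
  by (rule termdiffs_strong_converges_everywhere) (intro termdiff_converges_all summable_kern)

lemmas DERIV_kern_chain = DERIV_kern[THEN DERIV_chain2] DERIV_kern'[THEN DERIV_chain2]

lemma isCont_kern'': "isCont kern'' z"
proof -
  have "(kern'' has_real_derivative (\<Sum>m. diffs (diffs (diffs kern_coeff)) m * z ^ m)) (at z)"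
    unfolding kern''_def[abs_def]
    by (rule termdiffs_strong_converges_everywhere) (intro termdiff_converges_all summable_kern)
  then show ?thesis
    by (rule DERIV_isCont)
qed

lemma continuous_on_kern [continuous_intros]:
  assumes "continuous_on S f"
  shows "continuous_on S (\<lambda>x. kern (f x))"
    and "continuous_on S (\<lambda>x. kern' (f x))"
    and "continuous_on S (\<lambda>x. kern'' (f x))"
  by (rule continuous_on_compose2[OF continuous_at_imp_continuous_on assms, of UNIV];
      use DERIV_kern DERIV_kern' isCont_kern'' in \<open>blast intro: DERIV_isCont\<close>)+

text \<open>Bessel's equation of order one, rewritten for I_1(r) / r as a function of z = r^2; on
  the coefficients k_m it is the recursion (m + 1) (m + 2) k_(m+1) = k_m / 4. The energy bound, the
  convolution identity and the wave equation of the kernels all come down to it.\<close>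

lemma kern_ODE: "z * kern'' z + 2 * kern' z = kern z / 4"
proof -
  have s2: "(\<lambda>m. diffs (diffs kern_coeff) m * z ^ m) sums kern'' z"
    unfolding kern''_def by (intro summable_sums termdiff_converges_all summable_kern)
  define h where "h m = of_nat m * diffs kern_coeff m * z ^ m" for m
  have "(\<lambda>m. h (Suc m)) sums (z * kern'' z)"
    using sums_mult[OF s2, of z] by (simp add: h_def diffs_def mult.assoc mult.left_commute)
  \<comment> \<open>The index shift is free because the factor m makes \<open>h 0\<close>
    vanish.\<close>
  then have "h sums (z * kern'' z)"
    by (subst (asm) sums_Suc_iff) (simp add: h_def)
  moreover have "(\<lambda>m. 2 * (diffs kern_coeff m * z ^ m)) sums (2 * kern' z)"
    unfolding kern'_def
    by (intro sums_mult summable_sums termdiff_converges_all summable_kern)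
  ultimately have "(\<lambda>m. h m + 2 * (diffs kern_coeff m * z ^ m)) sums (z * kern'' z + 2 * kern' z)"
    by (rule sums_add)
  moreover have "h m + 2 * (diffs kern_coeff m * z ^ m) = kern_coeff m * z ^ m / 4" for m
  proof -
    have "(of_nat m + 2) * diffs kern_coeff m = kern_coeff m / 4"
      unfolding diffs_def kern_coeff_def
      by (simp add: divide_simps del: of_nat_Suc fact_Suc)
         (simp add: algebra_simps)
    then show ?thesis
      unfolding h_def by (metis (no_types, opaque_lifting) mult.assoc distrib_right times_divide_eq_left)
  qed
  moreover have "(\<lambda>m. kern_coeff m * z ^ m / 4) sums (kern z / 4)"
    unfolding kern_def by (intro sums_divide summable_sums summable_kern)
  ultimately show ?thesis
    using sums_unique2 by (metis (no_types, lifting) sums_cong)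
qed

lemma kern_0: "kern 0 = 1 / 2"
  unfolding kern_def by (subst suminf_finite[of "{0}"]) (auto simp: kern_coeff_def)

lemma kern_nonneg: "0 \<le> z \<Longrightarrow> 0 \<le> kern z"
  unfolding kern_def by (intro suminf_nonneg summable_kern) (simp add: kern_coeff_def)

text \<open>The energy \<open>F\<^sup>2 + 4 z F'\<^sup>2\<close> of the oscillating branch \<open>F z = kern (- z)\<close> decreases.\<close>

lemma abs_kern_minus_le:
  assumes "0 \<le> z"
  shows "\<bar>kern (- z)\<bar> \<le> 1 / 2"
proof -
  define e where "e x = (kern (- x))\<^sup>2 + 4 * x * (kern' (- x))\<^sup>2" for x
  have "(e has_real_derivative - 12 * (kern' (- x))\<^sup>2) (at x)" for x
  proof -
    have "- x * kern'' (- x) + 2 * kern' (- x) = kern (- x) / 4"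
      by (rule kern_ODE)
    then have *: "4 * x * kern'' (- x) = 8 * kern' (- x) - kern (- x)"
      by (simp add: field_simps)
    have "(e has_real_derivative
       (- 2 * kern (- x) * kern' (- x) + 4 * (kern' (- x))\<^sup>2
         - 2 * kern' (- x) * (4 * x * kern'' (- x)))) (at x)"
      unfolding e_def
      by (auto intro!: derivative_eq_intros DERIV_kern_chain simp: algebra_simps)
    then show ?thesis
      unfolding * by (simp add: algebra_simps power2_eq_square)
  qed
  then have "e z \<le> e 0"
    using assms by (intro DERIV_nonpos_imp_nonincreasing[of 0 z e]) force+
  then have "(kern (- z))\<^sup>2 \<le> (1/2)\<^sup>2"
    using assms unfolding e_def by (simp add: kern_0) (smt (verit) mult_nonneg_nonneg zero_le_power2)
  then show ?thesis
    using abs_le_square_iff[of "kern (- z)" "1/2"] by simp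
qed

text \<open>With \<open>B z = z F z\<close>, where \<open>F = kern\<close>, the equation \<open>B'' = F / 4\<close> makes the convolution
  integrand a multiple of the derivative of the Wronskian of \<open>B a\<close> and \<open>B (a - z)\<close>.\<close>

lemma kern_convolution:
  assumes "0 \<le> z"
  shows "integral {0..z} (\<lambda>a. kern a * kern (a - z)) = 2 * (kern z - kern (- z))"
proof (cases "z = 0")
  case False
  define W where "W a = (kern a + a * kern' a) * ((a - z) * kern (a - z))
    - a * kern a * (kern (a - z) + (a - z) * kern' (a - z))" for a
  have "(W has_real_derivative - (z / 4) * (kern a * kern (a - z))) (at a)" for a
  proof -
    have 1: "a * kern'' a = kern a / 4 - 2 * kern' a"
      and 2: "(a - z) * kern'' (a - z) = kern (a - z) / 4 - 2 * kern' (a - z)"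
      using kern_ODE[of a] kern_ODE[of "a - z"] by auto
    have "(W has_real_derivative (2 * kern' a + a * kern'' a) * ((a - z) * kern (a - z))
       - a * kern a * (2 * kern' (a - z) + (a - z) * kern'' (a - z))) (at a)"
      unfolding W_def
      by (auto intro!: derivative_eq_intros DERIV_kern_chain simp: algebra_simps)
    then show ?thesis
      unfolding 1 2 by (simp add: algebra_simps)
  qed
  then have "((\<lambda>a. - (z / 4) * (kern a * kern (a - z))) has_integral W z - W 0) {0..z}"
    using assms by (intro real_fundamental_theorem_of_calculus) (auto intro: has_field_derivative_at_within)
  then have "- (z / 4) * integral {0..z} (\<lambda>a. kern a * kern (a - z)) = W z - W 0"
    by (metis integral_mult_right integral_unique)
  \<comment> \<open>One product of \<open>W\<close> survives at each end: a - z vanishes at a = z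
    and a vanishes at 0, which leaves a factor \<open>kern 0\<close>.\<close>
  also have "\<dots> = - (z / 4) * (2 * (kern z - kern (- z)))"
    by (simp add: W_def kern_0 algebra_simps)
  finally show ?thesis
    using False by simp
qed simp

section \<open>The observer gain and the two Volterra kernels\<close>

text \<open>The odd powers of the root, divided by the root, form a series in z itself. Smoothness
  at the interface, where the root vanishes, is then no issue, and the value 1/2 prescribed there is
  \<open>kern_0\<close>.\<close>

lemma bessel_I1_quot_sqrt:
  assumes "0 \<le> z"
  shows "bessel_I1_quot (sqrt z) = kern z"
proof (cases "z = 0")
  case False
  then have nz: "sqrt z \<noteq> 0" using assms by simp
  have "(\<lambda>m. (sqrt z) * (kern_coeff m * z ^ m)) sums (sqrt z * kern z)"
    unfolding kern_def by (intro sums_mult summable_sums summable_kern)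
  moreover have "(sqrt z) * (kern_coeff m * z ^ m) =
      (sqrt z / 2) ^ (2 * m + 1) / (fact m * fact (m + 1))" for m
  proof -
    have "(sqrt z / 2) ^ (2 * m + 1) = ((sqrt z / 2)\<^sup>2) ^ m * (sqrt z / 2)"
      by (simp add: power_mult)
    also have "\<dots> = (z / 4) ^ m * (sqrt z / 2)"
      using assms by (simp add: power_divide)
    finally have *: "(sqrt z / 2) ^ (2 * m + 1) = (z / 4) ^ m * (sqrt z / 2)" .
    show ?thesis
      unfolding * by (simp add: kern_coeff_def power_divide ac_simps del: fact_Suc)
  qed
  ultimately have "bessel_I 1 (sqrt z) = sqrt z * kern z"
    unfolding bessel_I_def by (simp add: sums_iff)
  then show ?thesis
    using nz by (simp add: bessel_I1_quot_def)
qed (simp add: bessel_I1_quot_def kern_0)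

text \<open>The transformation is \<open>e x = w x + \<integral>{x..s} bs_kernel x y w y dy\<close>, with inverse
  \<open>w x = e x - \<integral>{x..s} bs_inv_kernel x y e y dy\<close>; the kernels do not depend on \<open>s\<close>.\<close>

definition bs_kernel :: "real \<Rightarrow> real \<Rightarrow> real \<Rightarrow> real" where
  "bs_kernel \<mu> x y = \<mu> * y * kern (\<mu> * (y\<^sup>2 - x\<^sup>2))"

definition bs_inv_kernel :: "real \<Rightarrow> real \<Rightarrow> real \<Rightarrow> real" where
  "bs_inv_kernel \<mu> x y = \<mu> * y * kern (\<mu> * (x\<^sup>2 - y\<^sup>2))"

text \<open>The gain is the trace of the direct kernel at y = l. This choice is what removes the
  interface flux from the target equation.\<close>

lemma observer_gain_eq:
  assumes "0 < \<alpha>" "0 < lam" "0 \<le> x" "x \<le> l"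
  shows "observer_gain \<alpha> lam x l = - \<alpha> * bs_kernel (lam / \<alpha>) x l"
proof -
  have "0 \<le> lam / \<alpha> * (l\<^sup>2 - x\<^sup>2)"
    using assms by (intro mult_nonneg_nonneg) (auto intro: power_mono)
  then show ?thesis
    using assms by (simp add: observer_gain_def bs_kernel_def bessel_I1_quot_sqrt)
qed

lemma bs_kernel_nonneg:
  assumes "0 < \<mu>" "0 \<le> x" "x \<le> y"
  shows "0 \<le> bs_kernel \<mu> x y"
proof -
  have "0 \<le> \<mu> * (y\<^sup>2 - x\<^sup>2)"
    using assms by (intro mult_nonneg_nonneg) (auto intro: power_mono)
  then show ?thesis
    using assms by (simp add: bs_kernel_def kern_nonneg)
qed

text \<open>For x \<le> y the argument of \<open>kern\<close> is nonpositive, and there the energy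
  bound gives 1/2. Together with the 1/2 from integrating y it yields the factor 4 in the condition
  on \<open>lam\<close>.\<close>

lemma abs_bs_inv_kernel_le:
  assumes "0 < \<mu>" "0 \<le> x" "x \<le> y"
  shows "\<bar>bs_inv_kernel \<mu> x y\<bar> \<le> \<mu> * y / 2"
proof -
  have "0 \<le> \<mu> * (y\<^sup>2 - x\<^sup>2)"
    using assms by (intro mult_nonneg_nonneg) (auto intro: power_mono)
  then have "\<bar>kern (- (\<mu> * (y\<^sup>2 - x\<^sup>2)))\<bar> \<le> 1 / 2"
    by (rule abs_kern_minus_le)
  moreover have "- (\<mu> * (y\<^sup>2 - x\<^sup>2)) = \<mu> * (x\<^sup>2 - y\<^sup>2)"
    by (simp add: algebra_simps)
  ultimately have "\<mu> * y * \<bar>kern (\<mu> * (x\<^sup>2 - y\<^sup>2))\<bar> \<le> \<mu> * y * (1 / 2)"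
    using assms by (intro mult_left_mono) auto
  then show ?thesis
    using assms by (simp add: bs_inv_kernel_def abs_mult)
qed

text \<open>Expresses that I + P and I - Q compose to the identity, for the Volterra operators P and
  Q of the two kernels. Substituting a = \<mu> (y^2 - x^2) uses up the factor y and produces the
  integral of \<open>kern_convolution\<close>.\<close>

lemma integral_kernel_kernel_inv:
  assumes "0 < \<mu>" "0 \<le> x" "x \<le> z"
  shows "integral {x..z} (\<lambda>y. bs_kernel \<mu> x y * bs_inv_kernel \<mu> y z)
    = bs_kernel \<mu> x z - bs_inv_kernel \<mu> x z"
proof -
  define A where "A = \<mu> * (z\<^sup>2 - x\<^sup>2)"
  define g where "g y = \<mu> * (y\<^sup>2 - x\<^sup>2)" for y
  have A: "0 \<le> A"
    using assms unfolding A_def by (intro mult_nonneg_nonneg) (auto intro: power_mono)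
  have g: "0 \<le> g y" "g y \<le> A" if "y \<in> {x..z}" for y
    using assms that unfolding A_def g_def
    by (auto intro!: mult_nonneg_nonneg mult_left_mono power_mono)
  have "((\<lambda>y. (2 * \<mu> * y) *\<^sub>R (kern (g y) * kern (g y - A))) has_integral
      (integral {g x..g z} (\<lambda>a. kern a * kern (a - A)))) {x..z}"
  proof (rule has_integral_substitution)
    show "(g has_field_derivative 2 * \<mu> * y) (at y within {x..z})" for y
      unfolding g_def by (auto intro!: derivative_eq_intros)
    show "g ` {x..z} \<subseteq> {0..A}" using g by auto
    show "g x \<le> g z" using g[of z] assms by (simp add: g_def)
  qed (use assms A in \<open>auto intro!: continuous_intros\<close>)
  then have "((\<lambda>y. (\<mu> * z / 2) * ((2 * \<mu> * y) *\<^sub>R (kern (g y) * kern (g y - A)))) has_integral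
      ((\<mu> * z / 2) * (integral {0..A} (\<lambda>a. kern a * kern (a - A))))) {x..z}"
    by (intro has_integral_mult_right) (simp add: g_def A_def)
  moreover have eq: "(\<mu> * z / 2) * ((2 * \<mu> * y) *\<^sub>R (kern (g y) * kern (g y - A)))
      = bs_kernel \<mu> x y * bs_inv_kernel \<mu> y z" for y
  proof -
    have "(\<mu> * (y\<^sup>2 - x\<^sup>2) - \<mu> * (z\<^sup>2 - x\<^sup>2)) = \<mu> * (y\<^sup>2 - z\<^sup>2)"
      by (simp add: algebra_simps)
    then show ?thesis
      by (simp add: bs_kernel_def bs_inv_kernel_def g_def A_def)
  qed
  ultimately have "integral {x..z} (\<lambda>y. bs_kernel \<mu> x y * bs_inv_kernel \<mu> y z) = (\<mu> * z / 2) * (integral {0..A} (\<lambda>a. kern a * kern (a - A)))"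
    by (simp only: integral_unique)
  then show ?thesis
    unfolding kern_convolution[OF A]
    by (simp add: bs_kernel_def bs_inv_kernel_def A_def algebra_simps)
qed

text \<open>The other order of composition. This one cancels the gain in the equation for w, while
  the former recovers e from w. The substitution is now decreasing in y.\<close>

lemma integral_kernel_inv_kernel:
  assumes "0 < \<mu>" "0 \<le> x" "x \<le> z"
  shows "integral {x..z} (\<lambda>y. bs_inv_kernel \<mu> x y * bs_kernel \<mu> y z)
    = bs_kernel \<mu> x z - bs_inv_kernel \<mu> x z"
proof -
  define A where "A = \<mu> * (z\<^sup>2 - x\<^sup>2)"
  define g where "g y = \<mu> * (z\<^sup>2 - y\<^sup>2)" for y
  have A: "0 \<le> A"
    using assms unfolding A_def by (intro mult_nonneg_nonneg) (auto intro: power_mono)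
  have g: "0 \<le> g y" "g y \<le> A" if "y \<in> {x..z}" for y
    using assms that unfolding A_def g_def
    by (auto intro!: mult_nonneg_nonneg mult_left_mono power_mono)
  have gx: "g x = A" "g z = 0" by (auto simp: g_def A_def)
  have "((\<lambda>y. (- 2 * \<mu> * y) *\<^sub>R (kern (g y) * kern (g y - A))) has_integral
      (integral {g x..g z} (\<lambda>a. kern a * kern (a - A))
       - integral {g z..g x} (\<lambda>a. kern a * kern (a - A)))) {x..z}"
  proof (rule has_integral_substitution_general[where s = "{}"])
    show "(g has_field_derivative - 2 * \<mu> * y) (at y within {x..z})" for y
      unfolding g_def by (auto intro!: derivative_eq_intros)
    show "g ` {x..z} \<subseteq> {0..A}" using g by auto
    show "continuous_on {x..z} g" unfolding g_def by (intro continuous_intros)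
  qed (use assms in \<open>auto intro!: continuous_intros\<close>)
  \<comment> \<open>For A > 0 the set is empty; only the integral with reversed limits contributes,
    with a minus sign.\<close>
  moreover have "integral {A..0} (\<lambda>a. kern a * kern (a - A)) = 0"
    using A by (cases "A = 0") auto
  ultimately have "((\<lambda>y. (- \<mu> * z / 2) * ((- 2 * \<mu> * y) *\<^sub>R (kern (g y) * kern (g y - A)))) has_integral
      ((- \<mu> * z / 2) * (- integral {0..A} (\<lambda>a. kern a * kern (a - A))))) {x..z}"
    by (intro has_integral_mult_right) (simp add: gx)
  moreover have eq: "(- \<mu> * z / 2) * ((- 2 * \<mu> * y) *\<^sub>R (kern (g y) * kern (g y - A)))
      = bs_inv_kernel \<mu> x y * bs_kernel \<mu> y z" for y
  proof -
    have "(\<mu> * (z\<^sup>2 - y\<^sup>2) - \<mu> * (z\<^sup>2 - x\<^sup>2)) = \<mu> * (x\<^sup>2 - y\<^sup>2)"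
      by (simp add: algebra_simps)
    then show ?thesis
      by (simp add: bs_kernel_def bs_inv_kernel_def g_def A_def)
  qed
  ultimately have "integral {x..z} (\<lambda>y. bs_inv_kernel \<mu> x y * bs_kernel \<mu> y z) = (- \<mu> * z / 2) * (- integral {0..A} (\<lambda>a. kern a * kern (a - A)))"
    by (simp only: integral_unique)
  then show ?thesis
    unfolding kern_convolution[OF A]
    by (simp add: bs_kernel_def bs_inv_kernel_def A_def algebra_simps)
qed

section \<open>Differentiation and integration on intervals\<close>

lemma continuous_on_compose_pair:
  assumes "continuous_on \<Omega> (\<lambda>(x, y). k x y)" "continuous_on S f" "continuous_on S g"
    and "\<And>p. p \<in> S \<Longrightarrow> (f p, g p) \<in> \<Omega>"
  shows "continuous_on S (\<lambda>p. k (f p) (g p))"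
proof -
  have "continuous_on S (\<lambda>p. (\<lambda>(x, y). k x y) (f p, g p))"
    by (rule continuous_on_compose2[OF assms(1)]) (use assms in \<open>auto intro: continuous_on_Pair\<close>)
  then show ?thesis by simp
qed

text \<open>The increment splits into a change of time at the fixed place g t and a change of place
  at the fixed time r; the second is evaluated by the mean value theorem and the joint continuity of
  \<open>fx\<close>. So the time derivative is needed at one point only, and f need not be jointly
  differentiable.\<close>

lemma DERIV_partial_chain:
  fixes f fx :: "real \<Rightarrow> real \<Rightarrow> real"
  assumes ft: "((\<lambda>r. f (g t) r) has_real_derivative ft) (at t within S)"
    and g: "(g has_real_derivative g') (at t within S)"
    and fx: "\<forall>\<^sub>F r in at t within S. \<forall>x\<in>closed_segment (g t) (g r). (x, r) \<in> \<Omega> \<and>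
      ((\<lambda>x. f x r) has_real_derivative fx x r) (at x within closed_segment (g t) (g r))"
    and cont: "continuous_on \<Omega> (\<lambda>(x, r). fx x r)" and mem: "(g t, t) \<in> \<Omega>"
  shows "((\<lambda>r. f (g r) r) has_real_derivative ft + fx (g t) t * g') (at t within S)"
proof -
  have "\<exists>\<xi>\<in>closed_segment (g t) (g r). f (g r) r - f (g t) r = fx \<xi> r * (g r - g t)"
    if *: "\<forall>x\<in>closed_segment (g t) (g r).
      ((\<lambda>x. f x r) has_real_derivative fx x r) (at x within closed_segment (g t) (g r))" for r
  proof (cases "g t \<le> g r")
    case True
    then have "closed_segment (g t) (g r) = {g t..g r}"
      by (simp add: closed_segment_eq_real_ivl)
    then show ?thesis
      using mvt_very_simple[OF True, of "\<lambda>x. f x r" "\<lambda>x. (*) (fx x r)"] *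
      by (auto simp: has_field_derivative_def)
  next
    case False
    then have "closed_segment (g t) (g r) = {g r..g t}"
      by (simp add: closed_segment_eq_real_ivl)
    then have "\<exists>\<xi>\<in>{g r..g t}. f (g t) r - f (g r) r = fx \<xi> r * (g t - g r)"
      using mvt_very_simple[of "g r" "g t" "\<lambda>x. f x r" "\<lambda>x. (*) (fx x r)"] * False
      by (auto simp: has_field_derivative_def)
    moreover have "f (g r) r - f (g t) r = fx \<xi> r * (g r - g t) \<longleftrightarrow>
        f (g t) r - f (g r) r = fx \<xi> r * (g t - g r)" for \<xi>
      by (auto simp: algebra_simps)
    ultimately show ?thesis
      using \<open>closed_segment (g t) (g r) = {g r..g t}\<close> by simp
  qed
  then obtain \<xi> where \<xi>: "\<And>r. \<forall>x\<in>closed_segment (g t) (g r).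
      ((\<lambda>x. f x r) has_real_derivative fx x r) (at x within closed_segment (g t) (g r)) \<Longrightarrow>
      \<xi> r \<in> closed_segment (g t) (g r) \<and> f (g r) r - f (g t) r = fx (\<xi> r) r * (g r - g t)"
    by metis
  have ev: "\<forall>\<^sub>F r in at t within S. \<xi> r \<in> closed_segment (g t) (g r) \<and> (\<xi> r, r) \<in> \<Omega> \<and>
      f (g r) r - f (g t) r = fx (\<xi> r) r * (g r - g t)"
    using fx by eventually_elim (use \<xi> in blast)
  have gt: "(g \<longlongrightarrow> g t) (at t within S)"
    using DERIV_continuous[OF g] by (simp add: continuous_within)
  have "((\<lambda>r. \<xi> r - g t) \<longlongrightarrow> 0) (at t within S)"
  proof (rule Lim_null_comparison)
    show "\<forall>\<^sub>F r in at t within S. norm (\<xi> r - g t) \<le> norm (g r - g t)"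
      using ev by eventually_elim (auto simp: closed_segment_eq_real_ivl split: if_splits)
    show "((\<lambda>r. norm (g r - g t)) \<longlongrightarrow> 0) (at t within S)"
      using gt by (intro tendsto_norm_zero LIM_zero)
  qed
  then have "(\<xi> \<longlongrightarrow> g t) (at t within S)"
    by (rule LIM_zero_cancel)
  then have "((\<lambda>r. (\<xi> r, r)) \<longlongrightarrow> (g t, t)) (at t within S)"
    by (intro tendsto_Pair tendsto_ident_at)
  from continuous_on_tendsto_compose[OF cont this mem]
  have fx_lim: "((\<lambda>r. fx (\<xi> r) r) \<longlongrightarrow> fx (g t) t) (at t within S)"
    using ev by (simp add: eventually_conj_iff)
  have "((\<lambda>r. (f (g t) r - f (g t) t) / (r - t) + fx (\<xi> r) r * ((g r - g t) / (r - t)))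
      \<longlongrightarrow> ft + fx (g t) t * g') (at t within S)"
    using ft g unfolding has_field_derivative_iff by (intro tendsto_intros fx_lim)
  then have "((\<lambda>r. (f (g r) r - f (g t) t) / (r - t)) \<longlongrightarrow> ft + fx (g t) t * g') (at t within S)"
  proof (rule Lim_transform_eventually)
    show "\<forall>\<^sub>F r in at t within S. (f (g t) r - f (g t) t) / (r - t) + fx (\<xi> r) r * ((g r - g t) / (r - t))
        = (f (g r) r - f (g t) t) / (r - t)"
      using ev
    proof eventually_elim
      case (elim r)
      then have "(f (g t) r - f (g t) t) / (r - t) + fx (\<xi> r) r * ((g r - g t) / (r - t))
        = ((f (g t) r - f (g t) t) + (f (g r) r - f (g t) r)) / (r - t)"
        by (simp add: add_divide_distrib)
      then show ?case by simp
    qed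
  qed
  then show ?thesis
    unfolding has_field_derivative_iff .
qed

text \<open>Serves where an integrand is not differentiated in time directly but its increments are
  known exactly, as at the interface and for the Dirichlet energy.\<close>

lemma DERIV_from_increment:
  fixes F G :: "real \<Rightarrow> real"
  assumes I: "open I" "t \<in> I" and inc: "\<And>r. r \<in> I \<Longrightarrow> F r - F t = (r - t) * G r"
    and G: "continuous_on I G"
  shows "(F has_real_derivative G t) (at t)"
proof -
  have "(G \<longlongrightarrow> G t) (at t)"
    using G I by (simp add: continuous_on_eq_continuous_at isCont_def)
  moreover have "\<forall>\<^sub>F r in at t. G r = (F r - F t) / (r - t)"
    using eventually_at_in_open[OF I] by eventually_elim (use inc in auto)
  ultimately show ?thesis
    unfolding has_field_derivative_iff by (rule Lim_transform_eventually)
qed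

lemma DERIV_nonneg_at_left_max:
  fixes f :: "real \<Rightarrow> real"
  assumes "(f has_real_derivative D) (at b within {a..b})" "a < b"
    and "\<And>x. x \<in> {a..b} \<Longrightarrow> f x \<le> f b"
  shows "0 \<le> D"
proof (rule ccontr)
  assume "\<not> 0 \<le> D"
  then obtain d where d: "d > 0" "\<forall>h>0. b - h \<in> {a..b} \<longrightarrow> h < d \<longrightarrow> f b < f (b - h)"
    using has_real_derivative_neg_dec_left[OF assms(1)] by auto
  define h where "h = min (d/2) (b - a)"
  have "h > 0" "b - h \<in> {a..b}" "h < d"
    using d(1) assms(2) by (auto simp: h_def)
  then show False
    using d(2)[rule_format, of h] assms(3)[of "b - h"] by simp
qed

lemma DERIV_nonneg_at_right_min:
  fixes f :: "real \<Rightarrow> real"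
  assumes "(f has_real_derivative D) (at a within {a..b})" "a < b"
    and "\<And>x. x \<in> {a..b} \<Longrightarrow> f a \<le> f x"
  shows "0 \<le> D"
proof (rule ccontr)
  assume "\<not> 0 \<le> D"
  then obtain d where d: "d > 0" "\<forall>h>0. a + h \<in> {a..b} \<longrightarrow> h < d \<longrightarrow> f (a + h) < f a"
    using has_real_derivative_neg_dec_right[OF assms(1)] by auto
  define h where "h = min (d/2) (b - a)"
  have "h > 0" "a + h \<in> {a..b}" "h < d"
    using d(1) assms(2) by (auto simp: h_def)
  then show False
    using d(2)[rule_format, of h] assms(3)[of "a + h"] by simp
qed

text \<open>If D were negative at the critical point x, then f' would be negative just to its right,
  and the mean value theorem would contradict minimality. The second derivative is used at x
  alone.\<close>

lemma second_deriv_nonneg_at_min: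
  fixes f f' :: "real \<Rightarrow> real"
  assumes x: "x \<in> {a<..<b}"
    and f: "\<And>y. y \<in> {a<..<b} \<Longrightarrow> (f has_real_derivative f' y) (at y)"
    and f': "(f' has_real_derivative D) (at x)"
    and min: "\<And>y. y \<in> {a<..<b} \<Longrightarrow> f x \<le> f y"
  shows "0 \<le> D"
proof (rule ccontr)
  assume "\<not> 0 \<le> D"
  then obtain d where d: "d > 0" "\<forall>h>0. h < d \<longrightarrow> f' (x + h) < f' x"
    using DERIV_neg_dec_right[OF f'] by auto
  have "f' x = 0"
  proof (rule DERIV_local_min[OF f[OF x]])
    show "0 < min (x - a) (b - x)" using x by simp
    show "\<forall>y. \<bar>x - y\<bar> < min (x - a) (b - x) \<longrightarrow> f x \<le> f y"
      using min by (auto simp: abs_less_iff)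
  qed
  define h where "h = min (d/2) ((b - x)/2)"
  have h: "h > 0" "h < d" "x + h < b"
    using d(1) x by (auto simp: h_def min_def field_simps)
  obtain z where z: "x < z" "z < x + h" "f (x + h) - f x = (x + h - x) * f' z"
    using MVT2[of x "x + h" f f'] f x h by force
  have "f' z < 0"
    using d(2)[rule_format, of "z - x"] z h \<open>f' x = 0\<close> by simp
  then have "f (x + h) < f x"
    using z h by (smt (verit) mult_pos_neg)
  moreover have "f x \<le> f (x + h)"
    using min x h by auto
  ultimately show False by simp
qed

section \<open>Integrals with moving limits\<close>

text \<open>Valid without integrability: if one side fails to be integrable so does the other, and
  both integrals are then 0 by convention.\<close>

lemma integral_rescale:
  fixes h :: "real \<Rightarrow> real"
  assumes "l \<le> u"
  shows "integral {l..u} h = (u - l) * integral {0..1} (\<lambda>y. h (l + (u - l) * y))"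
proof (cases "l = u")
  case False
  then have m: "u - l > 0" using assms by simp
  have *: "((\<lambda>y. h (l + (u - l) * y)) has_integral (I / (u - l))) {0..1} \<longleftrightarrow> (h has_integral I) {l..u}" for I
    using has_integral_affinity_iff[OF m, of h l I l u] m
    by (simp add: field_simps)
  show ?thesis
  proof (cases "h integrable_on {l..u}")
    case True
    then have "(h has_integral integral {l..u} h) {l..u}"
      by (rule integrable_integral)
    then have "((\<lambda>y. h (l + (u - l) * y)) has_integral (integral {l..u} h / (u - l))) {0..1}"
      by (simp only: *)
    then show ?thesis
      using m by (simp add: integral_unique)
  next
    case False
    moreover have "\<not> (\<lambda>y. h (l + (u - l) * y)) integrable_on {0..1}"
    proof
      assume "(\<lambda>y. h (l + (u - l) * y)) integrable_on {0..1}"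
      then obtain J where "((\<lambda>y. h (l + (u - l) * y)) has_integral J) {0..1}"
        by blast
      then have "((\<lambda>y. h (l + (u - l) * y)) has_integral (((u - l) * J) / (u - l))) {0..1}"
        using m by simp
      then show False
        using False unfolding * by blast
    qed
    ultimately show ?thesis
      by (simp add: not_integrable_integral)
  qed
qed simp

text \<open>After rescaling to {0..1} the limits become parameters of the integrand. Continuity of
  \<open>K\<close> is asked only on the set swept by the integration, since nothing is known about a
  solution beyond the interface.\<close>

lemma continuous_on_integral_moving:
  fixes K :: "'a::topological_space \<Rightarrow> real \<Rightarrow> real"
  assumes "continuous_on S l" "continuous_on S u" "\<And>p. p \<in> S \<Longrightarrow> l p \<le> u p"
    and K: "continuous_on \<Omega> (\<lambda>(p, y). K p y)"
    and sub: "\<And>p y. p \<in> S \<Longrightarrow> l p \<le> y \<Longrightarrow> y \<le> u p \<Longrightarrow> (p, y) \<in> \<Omega>"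
  shows "continuous_on S (\<lambda>p. integral {l p..u p} (K p))"
proof -
  have mem: "(p, l p + (u p - l p) * y) \<in> \<Omega>" if "p \<in> S" "y \<in> {0..1}" for p y
  proof -
    have "0 \<le> u p - l p" using assms(3) that by simp
    then have "0 \<le> (u p - l p) * y" "(u p - l p) * y \<le> u p - l p"
      using that by (auto simp: mult_left_le)
    then show ?thesis
      using sub[OF that(1), of "l p + (u p - l p) * y"] by simp
  qed
  have "continuous_on (S \<times> {0..1}) (\<lambda>z. l (fst z))" "continuous_on (S \<times> {0..1}) (\<lambda>z. u (fst z))"
    by (intro continuous_on_compose2[OF assms(1)] continuous_on_compose2[OF assms(2)]
        continuous_intros; force)+
  then have "continuous_on (S \<times> {0..1}) (\<lambda>z. (fst z, l (fst z) + (u (fst z) - l (fst z)) * snd z))"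
    by (intro continuous_intros)
  then have "continuous_on (S \<times> {0..1})
      (\<lambda>z. (\<lambda>(p, y). K p y) (fst z, l (fst z) + (u (fst z) - l (fst z)) * snd z))"
    by (rule continuous_on_compose2[OF K]) (use mem in auto)
  then have "continuous_on (S \<times> cbox 0 1) (\<lambda>(p, y). K p (l p + (u p - l p) * y))"
    by (simp add: split_beta)
  then have "continuous_on S (\<lambda>p. integral {0..1} (\<lambda>y. K p (l p + (u p - l p) * y)))"
    using integral_continuous_on_param[of S 0 1 "\<lambda>p y. K p (l p + (u p - l p) * y)"]
    by (simp only: cbox_interval)
  then have "continuous_on S (\<lambda>p. (u p - l p) * integral {0..1} (\<lambda>y. K p (l p + (u p - l p) * y)))"
    by (intro continuous_intros assms)
  then show ?thesis
    by (rule continuous_on_eq) (rule integral_rescale[symmetric], rule assms(3))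
qed

text \<open>Leibniz rule with a moving lower limit: the limit and the parameter of the kernel are
  treated as two independent arguments, and the chain rule then sets both to x.\<close>

lemma DERIV_volterra:
  fixes k k' :: "real \<Rightarrow> real \<Rightarrow> real"
  assumes k: "continuous_on ({a..b} \<times> {a..b}) (\<lambda>(x, y). k x y)"
    and k': "continuous_on ({a..b} \<times> {a..b}) (\<lambda>(x, y). k' x y)"
    and deriv: "\<And>x y. x \<in> {a..b} \<Longrightarrow> y \<in> {a..b} \<Longrightarrow>
      ((\<lambda>x. k x y) has_real_derivative k' x y) (at x within {a..b})"
    and x: "x \<in> {a..b}"
  shows "((\<lambda>x. integral {x..b} (k x)) has_real_derivative integral {x..b} (k' x) - k x x)
    (at x within {a..b})"
proof -
  have kr: "continuous_on {a..b} (k r)" if "r \<in> {a..b}" for r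
    by (rule continuous_on_compose_pair[OF k]) (use that in \<open>auto intro: continuous_intros\<close>)
  have "((\<lambda>r. integral {x..b} (k r)) has_real_derivative integral {x..b} (k' x)) (at x within {a..b})"
    unfolding cbox_interval[symmetric]
  proof (rule leibniz_rule_field_derivative)
    show "((\<lambda>x. k x y) has_field_derivative k' r y) (at r within cbox a b)"
      if "r \<in> cbox a b" "y \<in> cbox x b" for r y
      using deriv that x by auto
    show "k r integrable_on cbox x b" if "r \<in> cbox a b" for r
      using continuous_on_subset[OF kr] x that by (auto intro!: integrable_continuous_interval)
    show "continuous_on (cbox a b \<times> cbox x b) (\<lambda>(x, y). k' x y)"
      by (rule continuous_on_subset[OF k']) (use x in auto)
  qed (use x in auto)
  moreover have "((\<lambda>y. integral {y..b} (k r)) has_real_derivative - k r y) (at y within {a..b})"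
    if "r \<in> {a..b}" "y \<in> {a..b}" for r y
    by (rule integral_has_real_derivative'[OF kr[OF that(1)] that(2)])
  note lower = this
  have seg: "closed_segment x r \<subseteq> {a..b}" if "r \<in> {a..b}" for r
    using x that by (auto simp: closed_segment_eq_real_ivl split: if_splits)
  have "((\<lambda>r. integral {r..b} (k r)) has_real_derivative
      integral {x..b} (k' x) + - k x x * 1) (at x within {a..b})"
  proof (rule DERIV_partial_chain[where f = "\<lambda>y r. integral {y..b} (k r)" and g = "\<lambda>r. r"
          and fx = "\<lambda>y r. - k r y" and \<Omega> = "{a..b} \<times> {a..b}"])
    show "((\<lambda>r. integral {x..b} (k r)) has_real_derivative integral {x..b} (k' x)) (at x within {a..b})"
      by fact
    show "\<forall>\<^sub>F r in at x within {a..b}. \<forall>y\<in>closed_segment x r. (y, r) \<in> {a..b} \<times> {a..b} \<and>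
        ((\<lambda>y. integral {y..b} (k r)) has_real_derivative - k r y) (at y within closed_segment x r)"
      unfolding eventually_at_filter
      using seg lower by (intro always_eventually) (blast intro: DERIV_subset)
    have "continuous_on ({a..b} \<times> {a..b}) (\<lambda>p. k (snd p) (fst p))"
      by (rule continuous_on_compose_pair[OF k]) (auto intro!: continuous_intros)
    then show "continuous_on ({a..b} \<times> {a..b}) (\<lambda>(y, r). - k r y)"
      by (auto simp: split_beta intro: continuous_on_minus)
  qed (use x in \<open>auto intro: DERIV_ident\<close>)
  then show ?thesis by simp
qed

text \<open>With a replaced by a variable lower limit x, both sides vanish at x = b and have the
  same derivative in x.\<close>

lemma integral_triangle_swap:
  fixes k :: "real \<Rightarrow> real \<Rightarrow> real"
  assumes k: "continuous_on ({a..b} \<times> {a..b}) (\<lambda>(y, z). k y z)" and ab: "a \<le> b"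
  shows "integral {a..b} (\<lambda>y. integral {y..b} (k y)) = integral {a..b} (\<lambda>z. integral {a..z} (\<lambda>y. k y z))"
proof -
  \<comment> \<open>For x \<le> z this is the integral over {x..z}. Written as a difference it also
    has the right meaning for z < x, so that it is differentiable in x on the whole square.\<close>
  define G where "G x z = integral {a..z} (\<lambda>y. k y z) - integral {a..x} (\<lambda>y. k y z)" for x z
  define I where "I y = integral {y..b} (k y)" for y
  have kz: "continuous_on {a..b} (\<lambda>y. k y z)" if "z \<in> {a..b}" for z
    by (rule continuous_on_compose_pair[OF k]) (use that in \<open>auto intro: continuous_intros\<close>)
  have I: "continuous_on {a..b} I"
    unfolding I_def
    by (rule continuous_on_integral_moving[OF _ _ _ k]) (auto intro: continuous_intros)
  have G: "continuous_on ({a..b} \<times> {a..b}) (\<lambda>(x, z). G x z)"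
  proof -
    have "continuous_on (({a..b} \<times> {a..b}) \<times> {a..b}) (\<lambda>p. k (snd p) (snd (fst p)))"
      by (rule continuous_on_compose_pair[OF k]) (auto intro!: continuous_intros)
    then have K: "continuous_on (({a..b} \<times> {a..b}) \<times> {a..b}) (\<lambda>(p, y). k y (snd p))"
      by (simp add: split_beta)
    have "continuous_on ({a..b} \<times> {a..b}) (\<lambda>p. integral {a..u p} (\<lambda>y. k y (snd p)))"
      if "continuous_on ({a..b} \<times> {a..b}) u" "u ` ({a..b} \<times> {a..b}) \<subseteq> {a..b}" for u :: "real \<times> real \<Rightarrow> real"
      by (rule continuous_on_integral_moving[OF _ that(1) _ K]) (use that(2) in force)+
    note upper = this
    have "continuous_on ({a..b} \<times> {a..b}) (\<lambda>p. integral {a..snd p} (\<lambda>y. k y (snd p)))"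
      by (rule upper[OF continuous_on_snd[OF continuous_on_id]]) auto
    moreover have "continuous_on ({a..b} \<times> {a..b}) (\<lambda>p. integral {a..fst p} (\<lambda>y. k y (snd p)))"
      by (rule upper[OF continuous_on_fst[OF continuous_on_id]]) auto
    ultimately show ?thesis
      unfolding G_def split_beta by (rule continuous_on_diff)
  qed
  have "((\<lambda>x. integral {x..b} I - integral {x..b} (G x)) has_real_derivative 0) (at x within {a..b})"
    if x: "x \<in> {a..b}" for x
  proof -
    have "((\<lambda>x. integral {x..b} (\<lambda>y. I y)) has_real_derivative integral {x..b} (\<lambda>y. 0) - I x) (at x within {a..b})"
      by (rule DERIV_volterra[where k = "\<lambda>x y. I y"])
        (use x in \<open>auto simp: split_beta intro!: continuous_on_compose2[OF I] continuous_intros\<close>)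
    moreover have "((\<lambda>x. integral {x..b} (G x)) has_real_derivative integral {x..b} (\<lambda>z. - k x z) - G x x)
        (at x within {a..b})"
    proof (rule DERIV_volterra[OF G])
      show "continuous_on ({a..b} \<times> {a..b}) (\<lambda>(x, y). - k x y)"
        using k by (auto simp: split_beta intro: continuous_intros)
      show "((\<lambda>x. G x z) has_real_derivative - k y z) (at y within {a..b})"
        if "y \<in> {a..b}" "z \<in> {a..b}" for y z
        unfolding G_def using integral_has_real_derivative[OF kz[OF that(2)] that(1)]
        by (auto intro!: derivative_eq_intros)
    qed (use x in auto)
    ultimately have "((\<lambda>x. integral {x..b} I - integral {x..b} (G x)) has_real_derivative
        (integral {x..b} (\<lambda>y. 0) - I x) - (integral {x..b} (\<lambda>z. - k x z) - G x x)) (at x within {a..b})"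
      by (intro DERIV_diff) auto
    moreover have "integral {x..b} (\<lambda>z. - k x z) = - I x"
      by (simp add: I_def)
    ultimately show ?thesis
      by (simp add: G_def)
  qed
  then have "((\<lambda>_. 0) has_integral ((integral {b..b} I - integral {b..b} (G b))
      - (integral {a..b} I - integral {a..b} (G a)))) {a..b}"
    using ab by (intro real_fundamental_theorem_of_calculus)
  then have "integral {a..b} I = integral {a..b} (G a)"
    by (auto dest: integral_unique)
  then show ?thesis
    by (simp add: I_def[abs_def] G_def[abs_def])
qed

section \<open>Inequalities of Cauchy-Schwarz and Poincare, and Green's identity\<close>

text \<open>Cauchy-Schwarz against the constant 1, from the nonnegative variance of h about its mean
  \<open>m\<close>.\<close>

lemma integral_square_le:
  fixes h :: "real \<Rightarrow> real"
  assumes "a \<le> b" and h: "continuous_on {a..b} h"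
  shows "(integral {a..b} h)\<^sup>2 \<le> (b - a) * integral {a..b} (\<lambda>x. (h x)\<^sup>2)"
proof (cases "a = b")
  case False
  define m where "m = integral {a..b} h / (b - a)"
  have int: "h integrable_on {a..b}" "(\<lambda>x. (h x)\<^sup>2) integrable_on {a..b}"
    using h by (auto intro!: integrable_continuous_interval continuous_intros)
  have "0 \<le> integral {a..b} (\<lambda>x. (h x - m)\<^sup>2)"
    using h by (intro integral_nonneg integrable_continuous_interval continuous_intros) auto
  also have "(\<lambda>x. (h x - m)\<^sup>2) = (\<lambda>x. (h x)\<^sup>2 - (2 * m) * h x + m\<^sup>2)"
    by (simp add: power2_eq_square algebra_simps)
  also have "integral {a..b} \<dots> = integral {a..b} (\<lambda>x. (h x)\<^sup>2) - (2 * m) * integral {a..b} h + (b - a) * m\<^sup>2"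
  proof -
    have "((\<lambda>x. (h x)\<^sup>2 - (2 * m) * h x + m\<^sup>2) has_integral
        integral {a..b} (\<lambda>x. (h x)\<^sup>2) - (2 * m) * integral {a..b} h + (b - a) * m\<^sup>2) {a..b}"
      using has_integral_const_real[of "m\<^sup>2" a b] assms(1)
      by (intro has_integral_add has_integral_diff has_integral_mult_right integrable_integral int) simp
    then show ?thesis
      by (rule integral_unique)
  qed
  also have "\<dots> = integral {a..b} (\<lambda>x. (h x)\<^sup>2) - (integral {a..b} h)\<^sup>2 / (b - a)"
  proof -
    have "m * (b - a) = integral {a..b} h"
      using False by (simp add: m_def)
    then have "(b - a) * m\<^sup>2 = m * integral {a..b} h"
      by (simp add: power2_eq_square mult.commute mult.left_commute)
    then show ?thesis
      by (simp add: m_def power2_eq_square)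
  qed
  finally show ?thesis
    using False assms(1) by (simp add: field_simps)
qed simp

text \<open>f x is an integral of f' that starts at the zero p. The zero is left free: for u and e
  it will be the interface, for \<open>ex\<close> the fixed end x = 0.\<close>

lemma poincare_pointwise:
  fixes f f' :: "real \<Rightarrow> real"
  assumes f: "\<And>x. x \<in> {0..l} \<Longrightarrow> (f has_real_derivative f' x) (at x within {0..l})"
    and f': "continuous_on {0..l} f'" and p: "p \<in> {0..l}" "f p = 0" and x: "x \<in> {0..l}"
  shows "(f x)\<^sup>2 \<le> l * integral {0..l} (\<lambda>x. (f' x)\<^sup>2)"
proof -
  have *: "(f v - f u)\<^sup>2 \<le> l * integral {0..l} (\<lambda>x. (f' x)\<^sup>2)"
    if "0 \<le> u" "u \<le> v" "v \<le> l" for u v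
  proof -
    have sub: "{u..v} \<subseteq> {0..l}" using that by auto
    have "(f' has_integral (f v - f u)) {u..v}"
      using that sub by (intro real_fundamental_theorem_of_calculus DERIV_subset[OF f sub]) auto
    then have "(f v - f u)\<^sup>2 \<le> (v - u) * integral {u..v} (\<lambda>x. (f' x)\<^sup>2)"
      using integral_square_le[OF that(2) continuous_on_subset[OF f' sub]]
      by (simp add: integral_unique)
    also have "\<dots> \<le> l * integral {0..l} (\<lambda>x. (f' x)\<^sup>2)"
    proof (rule mult_mono)
      show "integral {u..v} (\<lambda>x. (f' x)\<^sup>2) \<le> integral {0..l} (\<lambda>x. (f' x)\<^sup>2)"
        using f' sub by (intro integral_subset_le integrable_continuous_interval continuous_intros
            continuous_on_subset[OF f']) auto
      show "0 \<le> integral {u..v} (\<lambda>x. (f' x)\<^sup>2)"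
        using f' sub by (intro integral_nonneg integrable_continuous_interval continuous_intros
            continuous_on_subset[OF f']) auto
    qed (use that in auto)
    finally show ?thesis .
  qed
  show ?thesis
    using *[of p x] *[of x p] p x by (cases "p \<le> x") auto
qed

lemma poincare:
  fixes f f' :: "real \<Rightarrow> real"
  assumes f: "\<And>x. x \<in> {0..l} \<Longrightarrow> (f has_real_derivative f' x) (at x within {0..l})"
    and f': "continuous_on {0..l} f'" and p: "p \<in> {0..l}" "f p = 0"
  shows "integral {0..l} (\<lambda>x. (f x)\<^sup>2) \<le> l\<^sup>2 * integral {0..l} (\<lambda>x. (f' x)\<^sup>2)"
proof -
  have "continuous_on {0..l} f"
    using f by (rule DERIV_continuous_on)
  then have "integral {0..l} (\<lambda>x. (f x)\<^sup>2) \<le> integral {0..l} (\<lambda>_. l * integral {0..l} (\<lambda>x. (f' x)\<^sup>2))"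
    using poincare_pointwise[OF f f' p]
    by (intro integral_le integrable_continuous_interval continuous_intros) auto
  then show ?thesis
    using p by (simp add: power2_eq_square)
qed

text \<open>Green's second identity. As \<open>v * u'' - v'' * u\<close> is an exact derivative,
  integrability of the term with u'' comes out of the argument rather than going in.\<close>

lemma integral_mult_second_deriv:
  fixes u :: "real \<Rightarrow> real"
  assumes "a \<le> b"
    and u: "\<And>x. x \<in> {a..b} \<Longrightarrow> (u has_real_derivative u' x) (at x within {a..b})"
    and u': "\<And>x. x \<in> {a..b} \<Longrightarrow> (u' has_real_derivative u'' x) (at x within {a..b})"
    and v: "\<And>x. x \<in> {a..b} \<Longrightarrow> (v has_real_derivative v' x) (at x within {a..b})"
    and v': "\<And>x. x \<in> {a..b} \<Longrightarrow> (v' has_real_derivative v'' x) (at x within {a..b})"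
    and cont: "continuous_on {a..b} v''"
  shows "integral {a..b} (\<lambda>x. v x * u'' x)
    = v b * u' b - v a * u' a - v' b * u b + v' a * u a + integral {a..b} (\<lambda>x. v'' x * u x)"
proof -
  have "((\<lambda>x. v x * u'' x - v'' x * u x) has_integral
      (v b * u' b - v' b * u b) - (v a * u' a - v' a * u a)) {a..b}"
    using assms(1)
    by (rule real_fundamental_theorem_of_calculus)
      (auto intro!: derivative_eq_intros u u' v v' simp: algebra_simps)
  moreover have "((\<lambda>x. v'' x * u x) has_integral integral {a..b} (\<lambda>x. v'' x * u x)) {a..b}"
    by (intro integrable_integral integrable_continuous_interval continuous_intros cont
        DERIV_continuous_on[OF u])
  ultimately have "((\<lambda>x. (v x * u'' x - v'' x * u x) + v'' x * u x) has_integral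
      ((v b * u' b - v' b * u b) - (v a * u' a - v' a * u a))
        + integral {a..b} (\<lambda>x. v'' x * u x)) {a..b}"
    by (rule has_integral_add)
  then show ?thesis
    by (simp add: integral_unique)
qed

section \<open>Functions on a domain with a moving boundary\<close>

definition wet_region :: "(real \<Rightarrow> real) \<Rightarrow> (real \<times> real) set" where
  "wet_region s = {(x, t) \<in> liquid_region s. 0 < t}"

lemma mem_wet_region: "(x, t) \<in> wet_region s \<longleftrightarrow> 0 < t \<and> 0 \<le> x \<and> x \<le> s t"
  by (auto simp: wet_region_def liquid_region_def)

text \<open>The first-order regularity on which the transport formulas rest, separated from the
  second space derivative so that products such as weight times error qualify too. Restricting to t
  > 0 keeps the corner (0, 0) out.\<close>

definition C1_wet ::
  "(real \<Rightarrow> real) \<Rightarrow> (real \<Rightarrow> real \<Rightarrow> real) \<Rightarrow> (real \<Rightarrow> real \<Rightarrow> real) \<Rightarrow> (real \<Rightarrow> real \<Rightarrow> real) \<Rightarrow> bool"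
  where
  "C1_wet s f fx ft \<longleftrightarrow>
     continuous_on (wet_region s) (\<lambda>(x, t). f x t) \<and>
     continuous_on (wet_region s) (\<lambda>(x, t). fx x t) \<and>
     continuous_on (wet_region s) (\<lambda>(x, t). ft x t) \<and>
     (\<forall>x t. (x, t) \<in> wet_region s \<longrightarrow>
        ((\<lambda>y. f y t) has_real_derivative fx x t) (at x within {0..s t}) \<and>
        ((\<lambda>r. f x r) has_real_derivative ft x t) (at t within {r. (x, r) \<in> liquid_region s}))"

lemma C1_wetD:
  assumes "C1_wet s f fx ft"
  shows "continuous_on (wet_region s) (\<lambda>(x, t). f x t)"
    and "continuous_on (wet_region s) (\<lambda>(x, t). fx x t)"
    and "continuous_on (wet_region s) (\<lambda>(x, t). ft x t)"
    and "0 < t \<Longrightarrow> 0 \<le> x \<Longrightarrow> x \<le> s t \<Longrightarrow>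
      ((\<lambda>y. f y t) has_real_derivative fx x t) (at x within {0..s t})"
    and "0 < t \<Longrightarrow> 0 \<le> x \<Longrightarrow> x \<le> s t \<Longrightarrow>
      ((\<lambda>r. f x r) has_real_derivative ft x t) (at t within {r. (x, r) \<in> liquid_region s})"
  using assms by (auto simp: C1_wet_def mem_wet_region)

lemma C1_wet_mult:
  assumes f: "C1_wet s f fx ft" and g: "C1_wet s g gx gt"
  shows "C1_wet s (\<lambda>x t. f x t * g x t) (\<lambda>x t. fx x t * g x t + gx x t * f x t)
    (\<lambda>x t. ft x t * g x t + gt x t * f x t)"
  unfolding C1_wet_def mem_wet_region
  using C1_wetD[OF f] C1_wetD[OF g]
  by (auto simp: split_beta intro!: continuous_intros derivative_eq_intros)

lemma C1_wet_space:
  fixes p p' :: "real \<Rightarrow> real"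
  assumes p: "\<And>x. (p has_real_derivative p' x) (at x)" and p': "continuous_on UNIV p'"
  shows "C1_wet s (\<lambda>x t. p x) (\<lambda>x t. p' x) (\<lambda>x t. 0)"
proof -
  have "continuous_on UNIV p"
    using p DERIV_isCont continuous_at_imp_continuous_on by blast
  then have "continuous_on (wet_region s) (\<lambda>z. p (fst z))"
    by (rule continuous_on_compose2) (auto intro: continuous_intros)
  moreover have "continuous_on (wet_region s) (\<lambda>z. p' (fst z))"
    using p' by (rule continuous_on_compose2) (auto intro: continuous_intros)
  ultimately show ?thesis
    unfolding C1_wet_def by (auto simp: split_beta intro: has_field_derivative_at_within[OF p])
qed

section \<open>Calculus in the stretched coordinate y = x / s\<close>

locale moving_boundary =
  fixes s sdot :: "real \<Rightarrow> real"
  assumes s_cont: "continuous_on {0..} s"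
    and s_pos: "\<And>t. 0 \<le> t \<Longrightarrow> 0 < s t"
    and s_deriv: "\<And>t. 0 < t \<Longrightarrow> (s has_real_derivative sdot t) (at t)"
    and sdot_cont: "continuous_on {0<..} sdot"
begin

lemma s_isCont: "0 < t \<Longrightarrow> isCont s t"
  using s_deriv by (rule DERIV_isCont)

lemma stretch_bounds:
  assumes "0 \<le> t" "y \<in> {0..1}"
  shows "0 \<le> s t * y" "s t * y \<le> s t"
  using assms s_pos[of t] by (auto simp: mult_left_le)

lemma eventually_interior:
  assumes "0 < t" "x < s t"
  shows "\<forall>\<^sub>F r in nhds t. 0 < r \<and> x < s r"
proof -
  have "\<forall>\<^sub>F r in nhds t. x < s r"
    using s_isCont[OF assms(1)] assms(2) isCont_def order_tendstoD(1) tendsto_at_iff_tendsto_nhds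
    by blast
  moreover have "\<forall>\<^sub>F r in nhds t. 0 < r"
    using assms(1) eventually_nhds_in_open[of "{0<..}" t] by simp
  ultimately show ?thesis
    by eventually_elim auto
qed

text \<open>A point strictly below the interface, x = 0 included, stays liquid at all times near t,
  which makes the derivative within the liquid times two-sided.\<close>

lemma DERIV_time_interior:
  assumes "C1_wet s f fx ft" "0 < t" "0 \<le> x" "x < s t"
  shows "((\<lambda>r. f x r) has_real_derivative ft x t) (at t)"
proof -
  have "\<forall>\<^sub>F r in nhds t. r \<in> {r. (x, r) \<in> liquid_region s}"
    using eventually_interior[OF assms(2,4)]
    by eventually_elim (use assms(3) in \<open>auto simp: liquid_region_def\<close>)
  then have "at t within {r. (x, r) \<in> liquid_region s} = at t"
    using at_within_nhd[of t _ "{r. (x, r) \<in> liquid_region s}" UNIV]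
    unfolding eventually_nhds by blast
  then show ?thesis
    using C1_wetD(5)[OF assms(1,2,3)] assms(4) by simp
qed

text \<open>The time derivative at fixed stretched coordinate y, that is, along a point carried
  along by the interface in proportion.\<close>

definition material_deriv ::
  "(real \<Rightarrow> real \<Rightarrow> real) \<Rightarrow> (real \<Rightarrow> real \<Rightarrow> real) \<Rightarrow> real \<Rightarrow> real \<Rightarrow> real" where
  "material_deriv fx ft y r = ft (s r * y) r + fx (s r * y) r * (sdot r * y)"

lemma continuous_on_stretch:
  assumes "continuous_on (wet_region s) (\<lambda>(x, t). f x t)"
  shows "continuous_on ({0..1} \<times> {0<..}) (\<lambda>(y, r). f (s r * y) r)"
  unfolding split_beta
proof (rule continuous_on_compose_pair[OF assms])
  show "continuous_on ({0..1} \<times> {0<..}) (\<lambda>p. s (snd p) * fst p)"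
    by (intro continuous_intros continuous_on_compose2[OF s_cont]) auto
qed (use stretch_bounds in \<open>auto simp: mem_wet_region intro: continuous_intros\<close>)

lemma continuous_on_material_deriv:
  assumes "C1_wet s f fx ft"
  shows "continuous_on ({0..1} \<times> {0<..}) (\<lambda>(y, r). material_deriv fx ft y r)"
proof -
  have "continuous_on ({0..1} \<times> {0<..}) (\<lambda>p. sdot (snd p))"
    by (rule continuous_on_compose2[OF sdot_cont]) (auto intro: continuous_intros)
  then show ?thesis
    using continuous_on_stretch[OF C1_wetD(2)[OF assms]] continuous_on_stretch[OF C1_wetD(3)[OF assms]]
    unfolding material_deriv_def split_beta by (intro continuous_intros)
qed

text \<open>The end y = 1 is excluded: the time derivative there is one-sided, and the chain rule
  would need values beyond the interface.\<close>

lemma DERIV_stretch: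
  assumes f: "C1_wet s f fx ft" and t: "0 < t" and y: "y \<in> {0..<1}"
  shows "((\<lambda>r. f (s r * y) r) has_real_derivative material_deriv fx ft y t) (at t)"
  unfolding material_deriv_def
proof (rule DERIV_partial_chain[where f = f and g = "\<lambda>r. s r * y" and fx = fx])
  have lt: "s t * y < s t"
    using y s_pos[of t] t by auto
  show "((\<lambda>r. f (s t * y) r) has_real_derivative ft (s t * y) t) (at t)"
    using t y s_pos[of t] by (intro DERIV_time_interior[OF f t _ lt]) auto
  show "((\<lambda>r. s r * y) has_real_derivative sdot t * y) (at t)"
    using s_deriv[OF t] by (auto intro!: derivative_eq_intros)
  show "continuous_on (wet_region s) (\<lambda>(x, r). fx x r)"
    by (rule C1_wetD[OF f])
  show "(s t * y, t) \<in> wet_region s"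
    using stretch_bounds[of t y] t y by (auto simp: mem_wet_region)
  have "\<forall>\<^sub>F r in at t. 0 < r \<and> s t * y < s r"
    using eventually_interior[OF t lt] by (simp add: eventually_at_filter eventually_mono)
  then show "\<forall>\<^sub>F r in at t. \<forall>x\<in>closed_segment (s t * y) (s r * y). (x, r) \<in> wet_region s \<and>
      ((\<lambda>x. f x r) has_real_derivative fx x r) (at x within closed_segment (s t * y) (s r * y))"
  proof eventually_elim
    case (elim r)
    then have "0 \<le> s t * y" "s t * y \<le> s r" "0 \<le> s r * y" "s r * y \<le> s r"
      using stretch_bounds[of r y] stretch_bounds[of t y] y t by auto
    then have "closed_segment (s t * y) (s r * y) \<subseteq> {0..s r}"
      by (auto simp: closed_segment_eq_real_ivl split: if_splits)
    then show ?case
      using elim DERIV_subset[OF C1_wetD(4)[OF f]] unfolding mem_wet_region by (meson atLeastAtMost_iff subset_iff)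
  qed
qed

text \<open>The mean of the material derivative over the times between t and r. With \<theta> as
  variable of integration it is jointly continuous in y and r, also at r = t, and treats r < t like
  r > t.\<close>

definition increment_quot ::
  "(real \<Rightarrow> real \<Rightarrow> real) \<Rightarrow> (real \<Rightarrow> real \<Rightarrow> real) \<Rightarrow> real \<Rightarrow> real \<Rightarrow> real \<Rightarrow> real" where
  "increment_quot fx ft t y r = integral {0..1} (\<lambda>\<theta>. material_deriv fx ft y (t + \<theta> * (r - t)))"

lemma segment_pos:
  fixes t r \<theta> :: real
  assumes "0 < t" "0 < r" "\<theta> \<in> {0..1}"
  shows "0 < t + \<theta> * (r - t)"
proof -
  have "t + \<theta> * (r - t) = (1 - \<theta>) * t + \<theta> * r"
    by (simp add: algebra_simps)
  also have "\<dots> > 0"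
    using assms by (cases "\<theta> = 0") (auto intro: add_nonneg_pos)
  finally show ?thesis .
qed

lemma continuous_on_increment_quot:
  assumes f: "C1_wet s f fx ft" and t: "0 < t"
  shows "continuous_on ({0..1} \<times> {0<..}) (\<lambda>(y, r). increment_quot fx ft t y r)"
proof -
  have "continuous_on (({0..1} \<times> {0<..}) \<times> {0..1})
      (\<lambda>p. material_deriv fx ft (fst (fst p)) (t + snd p * (snd (fst p) - t)))"
    by (rule continuous_on_compose_pair[OF continuous_on_material_deriv[OF f]])
      (use segment_pos[OF t] in \<open>auto intro!: continuous_intros\<close>)
  then have "continuous_on ({0..1} \<times> {0<..})
      (\<lambda>p. integral (cbox 0 1) (\<lambda>\<theta>. material_deriv fx ft (fst p) (t + \<theta> * (snd p - t))))"
    by (intro integral_continuous_on_param) (simp add: split_beta)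
  then show ?thesis
    by (simp add: increment_quot_def split_beta)
qed

lemma increment_quot_self: "increment_quot fx ft t y t = material_deriv fx ft y t"
  by (simp add: increment_quot_def)

text \<open>At \<open>y = 1\<close>, where the time derivative is only one-sided, the formula follows by continuity.\<close>

lemma stretch_increment:
  assumes f: "C1_wet s f fx ft" and t: "0 < t" and r: "0 < r" and y: "y \<in> {0..1}"
  shows "f (s r * y) r - f (s t * y) t = (r - t) * increment_quot fx ft t y r"
proof -
  define E where "E y = f (s r * y) r - f (s t * y) t - (r - t) * increment_quot fx ft t y r" for y
  have zero: "E y = 0" if y: "y \<in> {0..<1}" for y
  proof -
    define \<rho> where "\<rho> \<theta> = t + \<theta> * (r - t)" for \<theta>
    have "((\<lambda>\<theta>. material_deriv fx ft y (\<rho> \<theta>) * (r - t)) has_integral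
        (f (s (\<rho> 1) * y) (\<rho> 1) - f (s (\<rho> 0) * y) (\<rho> 0))) {0..1}"
    proof (rule real_fundamental_theorem_of_calculus)
      show "((\<lambda>\<theta>. f (s (\<rho> \<theta>) * y) (\<rho> \<theta>)) has_real_derivative
          material_deriv fx ft y (\<rho> \<theta>) * (r - t)) (at \<theta> within {0..1})" if "\<theta> \<in> {0..1}" for \<theta>
      proof (rule DERIV_chain2[where f = "\<lambda>r. f (s r * y) r" and g = \<rho>])
        show "(\<rho> has_real_derivative r - t) (at \<theta> within {0..1})"
          unfolding \<rho>_def by (auto intro!: derivative_eq_intros)
        show "((\<lambda>r. f (s r * y) r) has_real_derivative material_deriv fx ft y (\<rho> \<theta>)) (at (\<rho> \<theta>))"
          unfolding \<rho>_def by (rule DERIV_stretch[OF f segment_pos[OF t r that] y])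
      qed
    qed simp
    from integral_unique[OF this]
    have "integral {0..1} (\<lambda>\<theta>. material_deriv fx ft y (\<rho> \<theta>)) * (r - t)
        = f (s (\<rho> 1) * y) (\<rho> 1) - f (s (\<rho> 0) * y) (\<rho> 0)"
      by (simp only: integral_mult_left)
    then show ?thesis
      by (simp add: E_def increment_quot_def \<rho>_def mult.commute)
  qed
  have "continuous_on {0..1} E"
    unfolding E_def
    by (intro continuous_intros
        continuous_on_compose_pair[OF continuous_on_stretch[OF C1_wetD(1)[OF f]], where f = "\<lambda>y. y"]
        continuous_on_compose_pair[OF continuous_on_increment_quot[OF f t], where f = "\<lambda>y. y"])
      (use t r in auto)
  then have "E y = 0"
    using continuous_constant_on_closure[of "{0..<1}" E 0 y] zero y by simp
  then show ?thesis
    by (simp add: E_def)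
qed

text \<open>The increment formula at y = 1, where it holds although \<open>DERIV_stretch\<close>
  does not reach that far. The derivative is two-sided even though the partial time derivative is
  not.\<close>

lemma DERIV_interface:
  assumes f: "C1_wet s f fx ft" and t: "0 < t"
  shows "((\<lambda>r. f (s r) r) has_real_derivative ft (s t) t + fx (s t) t * sdot t) (at t)"
proof -
  have "((\<lambda>r. f (s r) r) has_real_derivative increment_quot fx ft t 1 t) (at t)"
  proof (rule DERIV_from_increment[where I = "{0<..}" and G = "increment_quot fx ft t 1"])
    show "f (s r) r - f (s t) t = (r - t) * increment_quot fx ft t 1 r" if "r \<in> {0<..}" for r
      using stretch_increment[OF f t, of r 1] that by simp
    show "continuous_on {0<..} (increment_quot fx ft t 1)"
      by (rule continuous_on_compose_pair[OF continuous_on_increment_quot[OF f t]])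
        (auto intro: continuous_intros)
  qed (use t in auto)
  then show ?thesis
    by (simp add: increment_quot_self material_deriv_def)
qed

lemma integral_stretch:
  "0 \<le> t \<Longrightarrow> integral {0..s t} h = s t * integral {0..1} (\<lambda>y. h (s t * y))"
  using integral_rescale[of 0 "s t" h] s_pos[of t] by simp

text \<open>Reynolds transport formula. On {0..1} time acts on the length s and, through the
  material derivative, on the integrand; integrating x f_x by parts gathers the terms with
  \<open>sdot\<close> into the interface value.\<close>

lemma DERIV_integral_moving:
  assumes f: "C1_wet s f fx ft" and t: "0 < t"
  shows "((\<lambda>r. integral {0..s r} (\<lambda>x. f x r)) has_real_derivative
    integral {0..s t} (\<lambda>x. ft x t) + sdot t * f (s t) t) (at t)"
proof -
  define I where "I r = integral {0..1} (\<lambda>y. f (s r * y) r)" for r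
  define G where "G r = integral {0..1} (\<lambda>y. increment_quot fx ft t y r)" for r
  have fc: "continuous_on {0..1} (\<lambda>y. f (s r * y) r)" if "0 < r" for r
    by (rule continuous_on_compose_pair[OF continuous_on_stretch[OF C1_wetD(1)[OF f]], where f = "\<lambda>y. y"])
      (use that in \<open>auto intro: continuous_intros\<close>)
  have "(I has_real_derivative G t) (at t)"
  proof (rule DERIV_from_increment[where I = "{0<..}"])
    show "I r - I t = (r - t) * G r" if "r \<in> {0<..}" for r
    proof -
      have "I r - I t = integral {0..1} (\<lambda>y. f (s r * y) r - f (s t * y) t)"
        unfolding I_def using fc that t
        by (intro integral_diff[symmetric] integrable_continuous_interval) auto
      also have "\<dots> = integral {0..1} (\<lambda>y. (r - t) * increment_quot fx ft t y r)"
        by (rule integral_cong) (use stretch_increment[OF f t] that in auto)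
      finally show ?thesis
        by (simp add: G_def)
    qed
    have "continuous_on ({0<..} \<times> {0..1}) (\<lambda>p. increment_quot fx ft t (snd p) (fst p))"
      by (rule continuous_on_compose_pair[OF continuous_on_increment_quot[OF f t]])
        (auto intro: continuous_intros)
    then show "continuous_on {0<..} G"
      unfolding G_def cbox_interval[symmetric]
      by (intro integral_continuous_on_param) (simp add: split_beta)
  qed (use t in auto)
  then have "((\<lambda>r. s r * I r) has_real_derivative sdot t * I t + G t * s t) (at t)"
    by (rule DERIV_mult[OF s_deriv[OF t]])
  moreover have "\<forall>\<^sub>F r in nhds t. s r * I r = integral {0..s r} (\<lambda>x. f x r)"
    using eventually_nhds_in_open[of "{0<..}" t] t
    by (auto elim!: eventually_mono simp: I_def integral_stretch)
  ultimately have deriv: "((\<lambda>r. integral {0..s r} (\<lambda>x. f x r)) has_real_derivative sdot t * I t + G t * s t) (at t)"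
    by (subst (asm) DERIV_cong_ev[OF refl _ refl])
  have sec: "continuous_on {0..s t} (\<lambda>x. h x t)" if "continuous_on (wet_region s) (\<lambda>(x, t). h x t)"
    for h :: "real \<Rightarrow> real \<Rightarrow> real"
    by (rule continuous_on_compose_pair[OF that]) (use t in \<open>auto simp: mem_wet_region intro: continuous_intros\<close>)
  have "((\<lambda>x. f x t + x * fx x t) has_integral s t * f (s t) t - 0 * f 0 t) {0..s t}"
    using s_pos[of t] t
    by (intro real_fundamental_theorem_of_calculus)
      (auto intro!: derivative_eq_intros C1_wetD(4)[OF f] simp: algebra_simps)
  then have parts: "integral {0..s t} (\<lambda>x. f x t + x * fx x t) = s t * f (s t) t"
    by (simp add: integral_unique)
  have "(sdot t * I t + G t * s t) * s t
      = s t * integral {0..s t} (\<lambda>x. ft x t) + sdot t * integral {0..s t} (\<lambda>x. f x t + x * fx x t)"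
  proof -
    have "G t * s t = integral {0..s t} (\<lambda>x. ft x t + fx x t * (sdot t * (x / s t)))"
      using t s_pos[of t]
      by (simp add: integral_stretch G_def increment_quot_self material_deriv_def mult.commute)
    moreover have "I t * s t = integral {0..s t} (\<lambda>x. f x t)"
      using t by (simp add: integral_stretch I_def mult.commute)
    moreover have "integral {0..s t} (\<lambda>x. ft x t + fx x t * (sdot t * (x / s t)))
        = integral {0..s t} (\<lambda>x. ft x t) + (sdot t / s t) * integral {0..s t} (\<lambda>x. x * fx x t)"
    proof -
      have "integral {0..s t} (\<lambda>x. ft x t + (sdot t / s t) * (x * fx x t))
        = integral {0..s t} (\<lambda>x. ft x t) + integral {0..s t} (\<lambda>x. (sdot t / s t) * (x * fx x t))"
        using sec C1_wetD(2,3)[OF f]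
        by (intro integral_add integrable_continuous_interval continuous_intros) auto
      moreover have "(\<lambda>x. ft x t + fx x t * (sdot t * (x / s t)))
          = (\<lambda>x. ft x t + (sdot t / s t) * (x * fx x t))"
        by (simp add: mult_ac)
      ultimately show ?thesis
        by (simp only: integral_mult_right)
    qed
    moreover have "integral {0..s t} (\<lambda>x. f x t + x * fx x t)
        = integral {0..s t} (\<lambda>x. f x t) + integral {0..s t} (\<lambda>x. x * fx x t)"
      using sec C1_wetD(1,2)[OF f]
      by (intro integral_add integrable_continuous_interval continuous_intros) auto
    ultimately show ?thesis
      using s_pos[of t] t by (simp add: field_simps)
  qed
  also have "\<dots> = (integral {0..s t} (\<lambda>x. ft x t) + sdot t * f (s t) t) * s t"
    by (simp add: parts algebra_simps)
  finally have "sdot t * I t + G t * s t = integral {0..s t} (\<lambda>x. ft x t) + sdot t * f (s t) t"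
    using s_pos[of t] t by simp
  then show ?thesis
    using deriv by simp
qed

text \<open>The mixed derivative \<open>u\<^sub>x\<^sub>t\<close> need not exist: on the stretched domain the increment of the
  Dirichlet energy is integrated by parts in space before dividing by the time step.\<close>

lemma DERIV_dirichlet_energy:
  assumes u: "C1_wet s u ux ut" and uxx: "continuous_on (wet_region s) (\<lambda>(x, t). uxx x t)"
    and ux_deriv: "\<And>x t. (x, t) \<in> wet_region s \<Longrightarrow>
      ((\<lambda>y. ux y t) has_real_derivative uxx x t) (at x within {0..s t})"
    and bc: "\<And>t. 0 < t \<Longrightarrow> u (s t) t = 0" and t: "0 < t"
  shows "((\<lambda>r. integral {0..s r} (\<lambda>x. (ux x r)\<^sup>2)) has_real_derivative
    - sdot t * (ux (s t) t)\<^sup>2 - 2 * ux 0 t * ut 0 t - 2 * integral {0..s t} (\<lambda>x. uxx x t * ut x t)) (at t)"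
proof -
  define U where "U y r = u (s r * y) r" for y r
  define V where "V y r = s r * ux (s r * y) r" for y r
  define W where "W y r = (s r)\<^sup>2 * uxx (s r * y) r" for y r
  define \<delta> where "\<delta> = increment_quot ux ut t"
  define J where "J r = integral {0..1} (\<lambda>y. (V y r)\<^sup>2)" for r
  define G where "G r = \<delta> 1 r * (V 1 r + V 1 t) - \<delta> 0 r * (V 0 r + V 0 t)
    - integral {0..1} (\<lambda>y. \<delta> y r * (W y r + W y t))" for r
  have s_snd: "continuous_on ({0..1} \<times> {0<..}) (\<lambda>p. s (snd p))"
    by (rule continuous_on_compose2[OF s_cont]) (auto intro: continuous_intros)
  have Vc: "continuous_on ({0..1} \<times> {0<..}) (\<lambda>(y, r). V y r)"
    using continuous_on_stretch[OF C1_wetD(2)[OF u]] s_snd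
    unfolding V_def split_beta by (intro continuous_intros)
  have Wc: "continuous_on ({0..1} \<times> {0<..}) (\<lambda>(y, r). W y r)"
    using continuous_on_stretch[OF uxx] s_snd
    unfolding W_def split_beta by (intro continuous_intros)
  have \<delta>c: "continuous_on ({0..1} \<times> {0<..}) (\<lambda>(y, r). \<delta> y r)"
    unfolding \<delta>_def by (rule continuous_on_increment_quot[OF u t])
  have y_sec: "continuous_on {0..1} (\<lambda>y. h y r)"
    if "0 < r" "continuous_on ({0..1} \<times> {0<..}) (\<lambda>(y, r). h y r)" for h :: "real \<Rightarrow> real \<Rightarrow> real" and r
    by (rule continuous_on_compose_pair[OF that(2)]) (use that(1) in \<open>auto intro: continuous_intros\<close>)
  have r_sec: "continuous_on {0<..} (h y)"
    if "y \<in> {0..1}" "continuous_on ({0..1} \<times> {0<..}) (\<lambda>(y, r). h y r)" for h :: "real \<Rightarrow> real \<Rightarrow> real" and y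
    by (rule continuous_on_compose_pair[OF that(2)]) (use that(1) in \<open>auto intro: continuous_intros\<close>)
  have stretch_image: "(*) (s r) ` {0..1} \<subseteq> {0..s r}" if "0 < r" for r
    using stretch_bounds[of r] that by auto
  have DU: "((\<lambda>y. U y r) has_real_derivative V y r) (at y within {0..1})"
    and DV: "((\<lambda>y. V y r) has_real_derivative W y r) (at y within {0..1})"
    if "0 < r" "y \<in> {0..1}" for r y
  proof -
    have m: "((*) (s r) has_real_derivative s r) (at y within {0..1})"
      by (auto intro!: derivative_eq_intros)
    have mem: "(s r * y, r) \<in> wet_region s"
      using stretch_bounds[of r y] that by (auto simp: mem_wet_region)
    have "((\<lambda>x. u x r) has_real_derivative ux (s r * y) r) (at (s r * y) within (*) (s r) ` {0..1})"
      using C1_wetD(4)[OF u, of r "s r * y"] mem DERIV_subset[OF _ stretch_image[OF that(1)]]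
      by (simp add: mem_wet_region)
    from DERIV_image_chain[OF this m] show "((\<lambda>y. U y r) has_real_derivative V y r) (at y within {0..1})"
      by (simp add: U_def V_def o_def mult.commute)
    have "((\<lambda>x. ux x r) has_real_derivative uxx (s r * y) r) (at (s r * y) within (*) (s r) ` {0..1})"
      using ux_deriv[OF mem] by (rule DERIV_subset[OF _ stretch_image[OF that(1)]])
    from DERIV_image_chain[OF this m]
    have "((\<lambda>y. ux (s r * y) r) has_real_derivative uxx (s r * y) r * s r) (at y within {0..1})"
      by (simp add: o_def)
    then show "((\<lambda>y. V y r) has_real_derivative W y r) (at y within {0..1})"
      unfolding V_def W_def by (auto intro!: derivative_eq_intros simp: power2_eq_square)
  qed
  have inc: "U y r - U y t = (r - t) * \<delta> y r" if "0 < r" "y \<in> {0..1}" for y r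
    using stretch_increment[OF u t that] by (simp add: U_def \<delta>_def)
  have "(J has_real_derivative G t) (at t)"
  proof (rule DERIV_from_increment[where I = "{0<..}"])
    show "J r - J t = (r - t) * G r" if "r \<in> {0<..}" for r
    proof -
      have r: "0 < r" using that by simp
      \<comment> \<open>The integrand is the y-derivative of (U r - U t) (V r + V t). It trades the
        difference of squares of \<open>V\<close> for increments of \<open>U\<close>, each of which
        is r - t times \<open>\<delta>\<close>.\<close>
      have "((\<lambda>y. (V y r - V y t) * (V y r + V y t) + (U y r - U y t) * (W y r + W y t)) has_integral
          ((U 1 r - U 1 t) * (V 1 r + V 1 t) - (U 0 r - U 0 t) * (V 0 r + V 0 t))) {0..1}"
        by (rule real_fundamental_theorem_of_calculus)
          (auto intro!: derivative_eq_intros DU DV r t simp: algebra_simps)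
      moreover have "((\<lambda>y. (r - t) * (\<delta> y r * (W y r + W y t))) has_integral
          (r - t) * integral {0..1} (\<lambda>y. \<delta> y r * (W y r + W y t))) {0..1}"
        by (intro has_integral_mult_right integrable_integral integrable_continuous_interval
            continuous_intros y_sec r t \<delta>c Wc)
      ultimately have "((\<lambda>y. ((V y r - V y t) * (V y r + V y t) + (U y r - U y t) * (W y r + W y t))
            - (r - t) * (\<delta> y r * (W y r + W y t))) has_integral
          ((U 1 r - U 1 t) * (V 1 r + V 1 t) - (U 0 r - U 0 t) * (V 0 r + V 0 t))
          - (r - t) * integral {0..1} (\<lambda>y. \<delta> y r * (W y r + W y t))) {0..1}"
        by (rule has_integral_diff)
      moreover have "((U 1 r - U 1 t) * (V 1 r + V 1 t) - (U 0 r - U 0 t) * (V 0 r + V 0 t))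
          - (r - t) * integral {0..1} (\<lambda>y. \<delta> y r * (W y r + W y t)) = (r - t) * G r"
        unfolding inc[OF r, of 0, simplified] inc[OF r, of 1, simplified]
        by (simp add: G_def algebra_simps)
      ultimately have "((\<lambda>y. (V y r)\<^sup>2 - (V y t)\<^sup>2) has_integral (r - t) * G r) {0..1}"
        by (simp only:) (erule has_integral_eq[rotated],
          simp add: inc[OF r] power2_eq_square algebra_simps)
      moreover have "J r - J t = integral {0..1} (\<lambda>y. (V y r)\<^sup>2 - (V y t)\<^sup>2)"
        unfolding J_def
        by (intro integral_diff[symmetric] integrable_continuous_interval continuous_intros y_sec r t Vc)
      ultimately show ?thesis
        by (simp add: integral_unique)
    qed
    have "continuous_on ({0<..} \<times> {0..1}) (\<lambda>p. \<delta> (snd p) (fst p))"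
      "continuous_on ({0<..} \<times> {0..1}) (\<lambda>p. W (snd p) (fst p))"
      "continuous_on ({0<..} \<times> {0..1}) (\<lambda>p. W (snd p) t)"
      by (rule continuous_on_compose_pair[OF \<delta>c] continuous_on_compose_pair[OF Wc];
        use t in \<open>auto intro: continuous_intros\<close>)+
    then have "continuous_on {0<..} (\<lambda>r. integral (cbox 0 1) (\<lambda>y. \<delta> y r * (W y r + W y t)))"
      by (intro integral_continuous_on_param) (auto simp: split_beta intro!: continuous_intros)
    then show "continuous_on {0<..} G"
      unfolding G_def using r_sec[OF _ Vc] r_sec[OF _ \<delta>c] by (intro continuous_intros) auto
  qed (use t in auto)
  then have "((\<lambda>r. J r / s r) has_real_derivative (G t * s t - J t * sdot t) / (s t * s t)) (at t)"
    by (rule DERIV_divide[OF _ s_deriv[OF t]]) (use s_pos[of t] t in auto)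
  \<comment> \<open>\<open>V\<close> carries a factor s and dx = s dy, which leaves one division by
    s.\<close>
  moreover have J_eq: "J r / s r = integral {0..s r} (\<lambda>x. (ux x r)\<^sup>2)" if "0 < r" for r
    using that s_pos[of r]
    by (simp add: integral_stretch J_def V_def power_mult_distrib power2_eq_square[of "s r"])
  then have "\<forall>\<^sub>F r in nhds t. J r / s r = integral {0..s r} (\<lambda>x. (ux x r)\<^sup>2)"
    using eventually_nhds_in_open[of "{0<..}" t] t by (auto elim!: eventually_mono)
  ultimately have deriv: "((\<lambda>r. integral {0..s r} (\<lambda>x. (ux x r)\<^sup>2)) has_real_derivative
      (G t * s t - J t * sdot t) / (s t * s t)) (at t)"
    by (subst (asm) DERIV_cong_ev[OF refl _ refl])
  \<comment> \<open>The boundary condition, differentiated along the interface: ut + ux sdot = 0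
    there.\<close>
  have "\<delta> 1 t = 0"
  proof -
    have "((\<lambda>r. u (s r) r) has_real_derivative 0) (at t)"
      using eventually_nhds_in_open[of "{0<..}" t] t bc
      by (subst DERIV_cong_ev[OF refl _ refl, where g = "\<lambda>_. 0"]) (auto elim!: eventually_mono)
    from DERIV_unique[OF this DERIV_interface[OF u t]] show ?thesis
      by (simp add: \<delta>_def increment_quot_self material_deriv_def)
  qed
  moreover have "\<delta> 0 t = ut 0 t"
    by (simp add: \<delta>_def increment_quot_self material_deriv_def)
  moreover have "integral {0..1} (\<lambda>y. \<delta> y t * (W y t + W y t))
      = 2 * s t * integral {0..s t} (\<lambda>x. uxx x t * ut x t)
        + sdot t * (s t * (ux (s t) t)\<^sup>2 - integral {0..s t} (\<lambda>x. (ux x t)\<^sup>2))"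
  proof -
    have sec: "continuous_on {0..s t} (\<lambda>x. h x t)" if "continuous_on (wet_region s) (\<lambda>(x, t). h x t)"
      for h :: "real \<Rightarrow> real \<Rightarrow> real"
      by (rule continuous_on_compose_pair[OF that]) (use t in \<open>auto simp: mem_wet_region intro: continuous_intros\<close>)
    \<comment> \<open>The transport part of \<open>\<delta>\<close> contributes x ux uxx. Integrated
      by parts it leaves an interface term and a multiple of the energy, and the latter cancels
      against the derivative of 1 / s.\<close>
    have "((\<lambda>x. (ux x t)\<^sup>2 + x * (2 * ux x t * uxx x t)) has_integral
        s t * (ux (s t) t)\<^sup>2 - 0 * (ux 0 t)\<^sup>2) {0..s t}"
      using s_pos[of t] t
      by (intro real_fundamental_theorem_of_calculus)
        (auto intro!: derivative_eq_intros ux_deriv simp: mem_wet_region algebra_simps)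
    moreover have "((\<lambda>x. (ux x t)\<^sup>2) has_integral integral {0..s t} (\<lambda>x. (ux x t)\<^sup>2)) {0..s t}"
      using sec C1_wetD(2)[OF u]
      by (intro integrable_integral integrable_continuous_interval continuous_intros)
    ultimately have "((\<lambda>x. ((ux x t)\<^sup>2 + x * (2 * ux x t * uxx x t)) - (ux x t)\<^sup>2) has_integral
        (s t * (ux (s t) t)\<^sup>2 - 0 * (ux 0 t)\<^sup>2) - integral {0..s t} (\<lambda>x. (ux x t)\<^sup>2)) {0..s t}"
      by (rule has_integral_diff)
    then have 1: "((\<lambda>x. sdot t * (x * (2 * ux x t * uxx x t))) has_integral
        sdot t * (s t * (ux (s t) t)\<^sup>2 - integral {0..s t} (\<lambda>x. (ux x t)\<^sup>2))) {0..s t}"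
      by (intro has_integral_mult_right) simp
    have 2: "((\<lambda>x. (2 * s t) * (uxx x t * ut x t)) has_integral
        (2 * s t) * integral {0..s t} (\<lambda>x. uxx x t * ut x t)) {0..s t}"
      using sec C1_wetD(3)[OF u] uxx
      by (intro has_integral_mult_right integrable_integral integrable_continuous_interval continuous_intros)
    have "integral {0..s t} (\<lambda>x. (2 * s t) * (uxx x t * ut x t) + sdot t * (x * (2 * ux x t * uxx x t)))
        = integral {0..1} (\<lambda>y. \<delta> y t * (W y t + W y t))"
      using t s_pos[of t]
      unfolding integral_stretch[OF less_imp_le[OF t]] integral_mult_right[symmetric]
      by (intro integral_cong) (simp add: \<delta>_def W_def increment_quot_self material_deriv_def
          power2_eq_square algebra_simps)
    then show ?thesis
      using integral_unique[OF has_integral_add[OF 2 1]] by simp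
  qed
  moreover have "J t = s t * integral {0..s t} (\<lambda>x. (ux x t)\<^sup>2)"
    using J_eq[OF t] s_pos[of t] t by (simp add: field_simps)
  ultimately have "G t * s t - J t * sdot t = (s t * s t) *
     (- sdot t * (ux (s t) t)\<^sup>2 - 2 * ux 0 t * ut 0 t - 2 * integral {0..s t} (\<lambda>x. uxx x t * ut x t))"
    by (simp only: G_def V_def) (simp add: algebra_simps)
  moreover have "s t * s t \<noteq> 0"
    using s_pos[of t] t by simp
  ultimately show ?thesis
    using deriv by (simp only: nonzero_mult_div_cancel_left not_False_eq_True)
qed

section \<open>Compactness and continuity up to the initial time\<close>

text \<open>The image of a rectangle under the stretching map. It supplies the minimiser in the
  minimum principle and the bounds for continuous integrands.\<close>

lemma compact_liquid_region: "compact {(x, t) \<in> liquid_region s. t \<le> \<tau>}"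
proof -
  have "continuous_on ({0..1} \<times> {0..\<tau>}) (\<lambda>p. (s (snd p) * fst p, snd p))"
    by (intro continuous_intros continuous_on_compose2[OF s_cont]) auto
  then have "compact ((\<lambda>p. (s (snd p) * fst p, snd p)) ` ({0..1} \<times> {0..\<tau>}))"
    by (intro compact_continuous_image compact_Times compact_Icc)
  moreover have "(\<lambda>p. (s (snd p) * fst p, snd p)) ` ({0..1} \<times> {0..\<tau>}) = {(x, t) \<in> liquid_region s. t \<le> \<tau>}"
  proof (intro set_eqI iffI; clarsimp simp: liquid_region_def)
    fix x t assume xt: "t \<le> \<tau>" "0 \<le> t" "0 \<le> x" "x \<le> s t"
    then have "(x, t) = (\<lambda>p. (s (snd p) * fst p, snd p)) (x / s t, t)" "x / s t \<in> {0..1}"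
      using s_pos[of t] by auto
    then show "(x, t) \<in> (\<lambda>p. (s (snd p) * fst p, snd p)) ` ({0..1} \<times> {0..\<tau>})"
      using xt by (intro image_eqI[of _ _ "(x / s t, t)"]) auto
  next
    fix y t :: real assume "0 \<le> y" "y \<le> 1" "0 \<le> t" "t \<le> \<tau>"
    then show "0 \<le> s t * y \<and> s t * y \<le> s t"
      using stretch_bounds[of t y] by simp
  qed
  ultimately show ?thesis by simp
qed

lemma s_bounded: "\<exists>M. \<forall>t\<in>{0..\<tau>}. s t \<le> M"
proof -
  have "bounded (s ` {0..\<tau>})"
    by (intro compact_imp_bounded compact_continuous_image continuous_on_subset[OF s_cont]) auto
  then show ?thesis
    unfolding bounded_iff by (metis abs_le_D1 imageI real_norm_def)
qed

text \<open>The integrand may jump at the corner \<open>(0, 0)\<close>, so dominated convergence is used.\<close>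

lemma continuous_on_integral_liquid:
  fixes f :: "real \<Rightarrow> real \<Rightarrow> real"
  assumes f: "continuous_on (liquid_region s - {(0, 0)}) (\<lambda>(x, t). f x t)"
    and b: "\<And>\<tau>. bounded ((\<lambda>(x, t). f x t) ` {(x, t) \<in> liquid_region s. t \<le> \<tau>})"
  shows "continuous_on {0..} (\<lambda>t. integral {0..s t} (\<lambda>x. f x t))"
proof -
  \<comment> \<open>y = 0 is the only stretched coordinate whose path meets the corner; the value
    there is overwritten, at no cost to the integral.\<close>
  define g where "g t y = (if y = 0 then 0 else f (s t * y) t)" for t y
  have g_int: "integral {0..s t} (\<lambda>x. f x t) = s t * integral {0..1} (g t)" if "0 \<le> t" for t
    unfolding integral_stretch[OF that]
    by (intro arg_cong[of _ _ "(*) _"] integral_spike[of "{0}"]) (auto simp: g_def)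
  have "continuous (at t within {0..}) (\<lambda>t. integral {0..1} (g t))" if t: "t \<in> {0..}" for t
  proof (rule continuous_within_sequentiallyI)
    fix r :: "nat \<Rightarrow> real"
    assume r: "r \<longlonglongrightarrow> t" "\<forall>n. r n \<in> {0..}"
    then obtain \<tau> where \<tau>: "\<And>n. r n \<le> \<tau>"
      using convergent_imp_Bseq[OF convergentI[OF r(1)]] unfolding Bseq_def
      by (metis abs_le_D1 real_norm_def)
    obtain B where B: "\<And>x t. (x, t) \<in> liquid_region s \<Longrightarrow> t \<le> \<tau> \<Longrightarrow> \<bar>f x t\<bar> \<le> B"
      using b[of \<tau>] unfolding bounded_iff by auto
    have lim: "(\<lambda>n. g (r n) y) \<longlonglongrightarrow> g t y" if y: "y \<in> {0..1}" for y
    proof (cases "y = 0")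
      case False
      have sl: "(\<lambda>n. s (r n)) \<longlonglongrightarrow> s t"
        by (rule continuous_on_tendsto_compose[OF s_cont r(1)]) (use t r in auto)
      have "(\<lambda>n. (\<lambda>(x, t). f x t) (s (r n) * y, r n)) \<longlonglongrightarrow> (\<lambda>(x, t). f x t) (s t * y, t)"
      proof (rule continuous_on_tendsto_compose[OF f])
        show "(\<lambda>n. (s (r n) * y, r n)) \<longlonglongrightarrow> (s t * y, t)"
          by (intro tendsto_intros sl r)
        have "(s q * y, q) \<in> liquid_region s - {(0, 0)}" if "0 \<le> q" for q
          using stretch_bounds[OF that y] s_pos[OF that] False that by (auto simp: liquid_region_def)
        then show "(s t * y, t) \<in> liquid_region s - {(0, 0)}"
          "\<forall>\<^sub>F n in sequentially. (s (r n) * y, r n) \<in> liquid_region s - {(0, 0)}"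
          using t r by auto
      qed
      then show ?thesis
        using False by (simp add: g_def)
    qed (simp add: g_def)
    \<comment> \<open>At q = 0 continuity holds only away from y = 0, and boundedness makes up for
      it.\<close>
    have int: "g q integrable_on {0..1}" if q: "0 \<le> q" "q \<le> \<tau>" for q
    proof -
      have "continuous_on {0<..1} (\<lambda>y. f (s q * y) q)"
        by (rule continuous_on_compose_pair[OF f])
          (use stretch_bounds[of q] s_pos[of q] q in \<open>auto simp: liquid_region_def intro: continuous_intros\<close>)
      then have "(\<lambda>y. f (s q * y) q) absolutely_integrable_on {0<..1}"
        using stretch_bounds[of q] q
        by (intro measurable_bounded_by_integrable_imp_absolutely_integrable[where g = "\<lambda>_. B"]
            continuous_imp_measurable_on_sets_lebesgue)
          (auto intro!: B bounded_set_imp_lmeasurable integrable_on_const simp: liquid_region_def)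
      then have "(\<lambda>y. f (s q * y) q) integrable_on {0<..1}"
        by (rule set_lebesgue_integral_eq_integral)
      then have "g q integrable_on {0<..1}"
        by (rule integrable_eq) (auto simp: g_def)
      then show ?thesis
        by (rule integrable_spike_set) (auto intro: negligible_subset[of "{0}"])
    qed
    show "(\<lambda>n. integral {0..1} (g (r n))) \<longlonglongrightarrow> integral {0..1} (g t)"
    proof (rule dominated_convergence(2)[where h = "\<lambda>_. \<bar>B\<bar>"])
      show "norm (g (r n) y) \<le> \<bar>B\<bar>" if "y \<in> {0..1}" for n y
        using B[of "s (r n) * y" "r n"] stretch_bounds[of "r n" y] that r(2) \<tau>[of n]
        by (force simp: g_def liquid_region_def)
    qed (use lim int r \<tau> in auto)
  qed
  then have "continuous_on {0..} (\<lambda>t. s t * integral {0..1} (g t))"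
    by (intro continuous_on_mult s_cont) (simp add: continuous_on_eq_continuous_within)
  then show ?thesis
    by (rule continuous_on_eq) (use g_int in auto)
qed

lemma continuous_on_integral_liquid':
  fixes f :: "real \<Rightarrow> real \<Rightarrow> real"
  assumes f: "continuous_on (liquid_region s) (\<lambda>(x, t). f x t)"
  shows "continuous_on {0..} (\<lambda>t. integral {0..s t} (\<lambda>x. f x t))"
proof (rule continuous_on_integral_liquid)
  show "continuous_on (liquid_region s - {(0, 0)}) (\<lambda>(x, t). f x t)"
    using f by (rule continuous_on_subset) auto
  show "bounded ((\<lambda>(x, t). f x t) ` {(x, t) \<in> liquid_region s. t \<le> \<tau>})" for \<tau>
    by (intro compact_imp_bounded compact_continuous_image compact_liquid_region
        continuous_on_subset[OF f]) auto
qed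

end

section \<open>A minimum principle on the moving domain\<close>

text \<open>The perturbation \<epsilon> (t + M - x) makes the inequalities strict: its slope in time
  rules out a negative minimum inside, its slope in space rules one out at x = 0, and x \<le> M
  keeps it nonnegative. The equation is used in the open interior only, and the term with
  \<open>lam\<close> has the right sign where v < 0.\<close>

lemma (in moving_boundary) parabolic_minimum_principle:
  fixes v vx vxx vt :: "real \<Rightarrow> real \<Rightarrow> real"
  assumes \<alpha>: "0 \<le> \<alpha>" and lam: "0 \<le> lam"
    and cont: "continuous_on (liquid_region s) (\<lambda>(x, t). v x t)"
    and vx: "\<And>x t. 0 < t \<Longrightarrow> 0 < x \<Longrightarrow> x < s t \<Longrightarrow> ((\<lambda>y. v y t) has_real_derivative vx x t) (at x)"
    and vxx: "\<And>x t. 0 < t \<Longrightarrow> 0 < x \<Longrightarrow> x < s t \<Longrightarrow> ((\<lambda>y. vx y t) has_real_derivative vxx x t) (at x)"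
    and vt: "\<And>x t. 0 < t \<Longrightarrow> 0 < x \<Longrightarrow> x < s t \<Longrightarrow> ((\<lambda>r. v x r) has_real_derivative vt x t) (at t)"
    and pde: "\<And>x t. 0 < t \<Longrightarrow> 0 < x \<Longrightarrow> x < s t \<Longrightarrow> vt x t \<ge> \<alpha> * vxx x t - lam * v x t"
    and flux: "\<And>t. 0 < t \<Longrightarrow> \<exists>d\<le>0. ((\<lambda>y. v y t) has_real_derivative d) (at 0 within {0..s t})"
    and bc: "\<And>t. 0 < t \<Longrightarrow> 0 \<le> v (s t) t"
    and ic: "\<And>x. 0 \<le> x \<Longrightarrow> x \<le> s 0 \<Longrightarrow> 0 \<le> v x 0"
    and mem: "0 \<le> \<tau>" "0 \<le> \<xi>" "\<xi> \<le> s \<tau>"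
  shows "0 \<le> v \<xi> \<tau>"
proof (rule ccontr)
  assume neg: "\<not> 0 \<le> v \<xi> \<tau>"
  define C where "C = {(x, t) \<in> liquid_region s. t \<le> \<tau>}"
  obtain M where M: "\<And>t. t \<in> {0..\<tau>} \<Longrightarrow> s t \<le> M"
    using s_bounded by blast
  have M_pos: "0 < M"
    using M[of \<tau>] s_pos[of \<tau>] mem by auto
  \<comment> \<open>Small enough for z to be at most half of the negative value v \<xi> \<tau> at
    the offending point.\<close>
  define \<epsilon> where "\<epsilon> = - v \<xi> \<tau> / (2 * (\<tau> + M))"
  have \<epsilon>: "0 < \<epsilon>"
    unfolding \<epsilon>_def using neg mem M_pos by (intro divide_pos_pos) auto
  define z where "z x t = v x t + \<epsilon> * (t + M - x)" for x t
  have z_lower: "v x t \<le> z x t" if "(x, t) \<in> C" for x t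
    using that M[of t] \<epsilon> by (auto simp: C_def z_def liquid_region_def)
  have "compact C"
    unfolding C_def by (rule compact_liquid_region)
  moreover have memC: "(\<xi>, \<tau>) \<in> C"
    using mem by (auto simp: C_def liquid_region_def)
  moreover have "continuous_on C (\<lambda>(x, t). z x t)"
    using continuous_on_subset[OF cont, of C]
    unfolding z_def by (auto simp: C_def split_beta intro!: continuous_intros)
  ultimately obtain p where p: "p \<in> C" "\<And>q. q \<in> C \<Longrightarrow> (\<lambda>(x, t). z x t) p \<le> (\<lambda>(x, t). z x t) q"
    using continuous_attains_inf[of C "\<lambda>(x, t). z x t"] by blast
  obtain x t where xt: "p = (x, t)" by force
  have t: "0 \<le> t" "t \<le> \<tau>" and x: "0 \<le> x" "x \<le> s t"
    using p(1) by (auto simp: C_def liquid_region_def xt)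
  have min: "z x t \<le> z y r" if "0 \<le> r" "r \<le> \<tau>" "0 \<le> y" "y \<le> s r" for y r
    using p(2)[of "(y, r)"] that by (auto simp: C_def liquid_region_def xt)
  have "\<epsilon> * (\<tau> + M - \<xi>) \<le> \<epsilon> * (\<tau> + M)"
    using \<epsilon> mem by (intro mult_left_mono) auto
  also have "\<dots> = - v \<xi> \<tau> / 2"
    using M_pos mem by (simp add: \<epsilon>_def field_simps)
  finally have z_neg: "z x t < 0"
    using neg min[of \<tau> \<xi>] mem unfolding z_def by linarith
  then have v_neg: "v x t < 0"
    using z_lower[of x t] p(1) xt by auto
  have t_pos: "0 < t"
    using ic[of x] v_neg t x by (cases "t = 0") auto
  have x_lt: "x < s t"
    using bc[OF t_pos] v_neg x by (cases "x = s t") auto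
  have x_pos: "0 < x"
  proof (rule ccontr)
    assume "\<not> 0 < x"
    then have [simp]: "x = 0" using x by simp
    obtain d where d: "d \<le> 0" "((\<lambda>y. v y t) has_real_derivative d) (at 0 within {0..s t})"
      using flux[OF t_pos] by blast
    have "((\<lambda>y. z y t) has_real_derivative d - \<epsilon>) (at 0 within {0..s t})"
      unfolding z_def by (auto intro!: derivative_eq_intros d(2))
    then have "0 \<le> d - \<epsilon>"
      using s_pos[of t] t min[of t] by (intro DERIV_nonneg_at_right_min) auto
    then show False
      using d(1) \<epsilon> by simp
  qed
  have "0 \<le> vxx x t"
  proof (rule second_deriv_nonneg_at_min)
    show "x \<in> {0<..<s t}" using x_pos x_lt by simp
    show "((\<lambda>y. z y t) has_real_derivative vx y t - \<epsilon>) (at y)" if "y \<in> {0<..<s t}" for y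
      unfolding z_def using that t_pos by (auto intro!: derivative_eq_intros vx)
    show "((\<lambda>y. vx y t - \<epsilon>) has_real_derivative vxx x t) (at x)"
      using vxx[OF t_pos x_pos x_lt] by (auto intro!: derivative_eq_intros)
    show "z x t \<le> z y t" if "y \<in> {0<..<s t}" for y
      using min[of t y] t that by auto
  qed
  then have "0 \<le> \<alpha> * vxx x t - lam * v x t"
    using mult_nonneg_nonneg[OF \<alpha>, of "vxx x t"] mult_nonneg_nonpos[OF lam, of "v x t"] v_neg by simp
  then have vt_nonneg: "0 \<le> vt x t"
    using pde[OF t_pos x_pos x_lt] by linarith
  obtain d where d: "0 < d" "\<And>r. dist r t < d \<Longrightarrow> 0 < r \<and> x < s r"
    using eventually_interior[OF t_pos x_lt] unfolding eventually_nhds_metric by blast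
  \<comment> \<open>Only times up to t are compared, since t may be the final time \<tau>.\<close>
  have "((\<lambda>r. - z x r) has_real_derivative - (vt x t + \<epsilon>)) (at t within {t - d / 2..t})"
    unfolding z_def
    by (rule has_field_derivative_at_within)
      (auto intro!: derivative_eq_intros vt[OF t_pos x_pos x_lt])
  moreover have "- z x r \<le> - z x t" if "r \<in> {t - d / 2..t}" for r
    using d(1) d(2)[of r] that min[of r x] t x by (auto simp: dist_real_def)
  ultimately have "0 \<le> - (vt x t + \<epsilon>)"
    using d(1) by (intro DERIV_nonneg_at_left_max[of "\<lambda>r. - z x r" _ t "t - d / 2"]) auto
  then show False
    using vt_nonneg \<epsilon> by simp
qed

section \<open>Sign of the observer error\<close>

lemma continuous_on_bs_kernel [continuous_intros]:
  assumes "continuous_on S f" "continuous_on S g"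
  shows "continuous_on S (\<lambda>p. bs_kernel \<mu> (f p) (g p))"
    and "continuous_on S (\<lambda>p. bs_inv_kernel \<mu> (f p) (g p))"
  unfolding bs_kernel_def bs_inv_kernel_def by (intro continuous_intros assms)+

text \<open>\<open>A0\<close> and \<open>B0\<close> stand for the slopes Hl - H and Hu that enclose
  the initial error; \<open>gain\<close> is the condition on \<open>lam\<close> with denominators
  cleared.\<close>

locale observer_error = moving_boundary +
  fixes \<alpha> lam :: real and e ex exx et :: "real \<Rightarrow> real \<Rightarrow> real" and A0 B0 :: real
  assumes \<alpha>: "0 < \<alpha>" and lam: "0 < lam"
    and e_cont: "continuous_on (liquid_region s) (\<lambda>(x, t). e x t)"
    and e_C1: "C1_wet s e ex et"
    and exx_cont: "continuous_on (wet_region s) (\<lambda>(x, t). exx x t)"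
    and ex_deriv: "\<And>x t. (x, t) \<in> wet_region s \<Longrightarrow>
      ((\<lambda>y. ex y t) has_real_derivative exx x t) (at x within {0..s t})"
    and e_pde: "\<And>x t. (x, t) \<in> wet_region s \<Longrightarrow>
      et x t = \<alpha> * exx x t + \<alpha> * bs_kernel (lam / \<alpha>) x (s t) * ex (s t) t"
    and e_flux: "\<And>t. 0 < t \<Longrightarrow> ex 0 t = 0"
    and e_bc: "\<And>t. 0 < t \<Longrightarrow> e (s t) t = 0"
    and e_init: "\<And>x. 0 \<le> x \<Longrightarrow> x \<le> s 0 \<Longrightarrow> - B0 * (s 0 - x) \<le> e x 0 \<and> e x 0 \<le> - A0 * (s 0 - x)"
    and A0: "0 \<le> A0" and gain: "lam * (s 0)\<^sup>2 * B0 \<le> 4 * \<alpha> * A0"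
begin

abbreviation \<mu> :: real where "\<mu> \<equiv> lam / \<alpha>"

lemma mu_pos: "0 < \<mu>"
  using \<alpha> lam by simp

section \<open>The kernel equation and the target system\<close>

definition Qx :: "real \<Rightarrow> real \<Rightarrow> real" where
  "Qx x y = 2 * \<mu>\<^sup>2 * x * y * kern' (\<mu> * (x\<^sup>2 - y\<^sup>2))"

definition Qxx :: "real \<Rightarrow> real \<Rightarrow> real" where
  "Qxx x y = 2 * \<mu>\<^sup>2 * y * kern' (\<mu> * (x\<^sup>2 - y\<^sup>2)) + 4 * \<mu> ^ 3 * x\<^sup>2 * y * kern'' (\<mu> * (x\<^sup>2 - y\<^sup>2))"

definition Qy :: "real \<Rightarrow> real \<Rightarrow> real" where
  "Qy x y = \<mu> * kern (\<mu> * (x\<^sup>2 - y\<^sup>2)) - 2 * \<mu>\<^sup>2 * y\<^sup>2 * kern' (\<mu> * (x\<^sup>2 - y\<^sup>2))"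

definition Qyy :: "real \<Rightarrow> real \<Rightarrow> real" where
  "Qyy x y = - 6 * \<mu>\<^sup>2 * y * kern' (\<mu> * (x\<^sup>2 - y\<^sup>2)) + 4 * \<mu> ^ 3 * y ^ 3 * kern'' (\<mu> * (x\<^sup>2 - y\<^sup>2))"

lemma DERIV_Q:
  "((\<lambda>x. bs_inv_kernel \<mu> x y) has_real_derivative Qx x y) (at x)"
  "((\<lambda>x. Qx x y) has_real_derivative Qxx x y) (at x)"
  "((\<lambda>y. bs_inv_kernel \<mu> x y) has_real_derivative Qy x y) (at y)"
  "((\<lambda>y. Qy x y) has_real_derivative Qyy x y) (at y)"
proof -
  define m where "m = \<mu>"
  show "((\<lambda>x. bs_inv_kernel \<mu> x y) has_real_derivative Qx x y) (at x)"
    unfolding bs_inv_kernel_def Qx_def m_def[symmetric]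
    by (rule derivative_eq_intros DERIV_kern_chain refl | simp add: power2_eq_square)+
  show "((\<lambda>x. Qx x y) has_real_derivative Qxx x y) (at x)"
    unfolding Qx_def Qxx_def m_def[symmetric]
    by (rule derivative_eq_intros DERIV_kern_chain refl | simp add: power2_eq_square power3_eq_cube)+
  show "((\<lambda>y. bs_inv_kernel \<mu> x y) has_real_derivative Qy x y) (at y)"
    unfolding bs_inv_kernel_def Qy_def m_def[symmetric]
    by (rule derivative_eq_intros DERIV_kern_chain refl | simp add: power2_eq_square)+
  show "((\<lambda>y. Qy x y) has_real_derivative Qyy x y) (at y)"
    unfolding Qy_def Qyy_def m_def[symmetric]
    by (rule derivative_eq_intros DERIV_kern_chain refl | simp add: power2_eq_square power3_eq_cube algebra_simps)+
qed

text \<open>With z = \<mu> (x^2 - y^2) this is 4 \<mu>^2 y times \<open>kern_ODE\<close>. It is the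
  source of the damping term - lam w in the target equation.\<close>

lemma Q_wave: "Qxx x y - Qyy x y = \<mu> * bs_inv_kernel \<mu> x y"
proof -
  define m where "m = \<mu>"
  define z where "z = m * (x\<^sup>2 - y\<^sup>2)"
  have "Qxx x y - Qyy x y = 4 * m\<^sup>2 * y * (z * kern'' z + 2 * kern' z)"
    unfolding Qxx_def Qyy_def m_def[symmetric] z_def
    by (simp add: algebra_simps power2_eq_square power3_eq_cube)
  also have "\<dots> = m * bs_inv_kernel m x y"
    unfolding kern_ODE bs_inv_kernel_def z_def[symmetric] by (simp add: power2_eq_square)
  finally show ?thesis
    by (simp only: m_def)
qed

lemma continuous_on_Q [continuous_intros]:
  assumes "continuous_on S f" "continuous_on S g"
  shows "continuous_on S (\<lambda>p. Qx (f p) (g p))" "continuous_on S (\<lambda>p. Qxx (f p) (g p))"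
    "continuous_on S (\<lambda>p. Qy (f p) (g p))" "continuous_on S (\<lambda>p. Qyy (f p) (g p))"
  unfolding Qx_def Qxx_def Qy_def Qyy_def by (intro continuous_intros assms)+

definition w :: "real \<Rightarrow> real \<Rightarrow> real" where
  "w x t = e x t - integral {x..s t} (\<lambda>y. bs_inv_kernel \<mu> x y * e y t)"

definition wx :: "real \<Rightarrow> real \<Rightarrow> real" where
  "wx x t = ex x t + \<mu> / 2 * x * e x t - integral {x..s t} (\<lambda>y. Qx x y * e y t)"

definition wxx :: "real \<Rightarrow> real \<Rightarrow> real" where
  "wxx x t = exx x t + \<mu> / 2 * e x t + \<mu> / 2 * x * ex x t + Qx x x * e x t
    - integral {x..s t} (\<lambda>y. Qxx x y * e y t)"

text \<open>The moving limit leaves no term, because e vanishes at the interface.\<close>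

definition wt :: "real \<Rightarrow> real \<Rightarrow> real" where
  "wt x t = et x t - integral {x..s t} (\<lambda>y. bs_inv_kernel \<mu> x y * et y t)"

lemma e_section: "0 \<le> t \<Longrightarrow> continuous_on {0..s t} (\<lambda>y. e y t)"
  by (rule continuous_on_compose_pair[OF e_cont]) (auto simp: liquid_region_def intro: continuous_intros)

lemma wet_section:
  assumes "0 < t" "continuous_on (wet_region s) (\<lambda>(x, t). h x t)"
  shows "continuous_on {0..s t} (\<lambda>y. h y t)"
  by (rule continuous_on_compose_pair[OF assms(2)]) (use assms(1) in \<open>auto simp: mem_wet_region intro: continuous_intros\<close>)

lemma DERIV_volterra_kernel:
  assumes k: "\<And>x y. ((\<lambda>x. k x y) has_real_derivative k' x y) (at x)"
    and kc: "continuous_on UNIV (\<lambda>(x, y). k x y)" and kc': "continuous_on UNIV (\<lambda>(x, y). k' x y)"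
    and t: "0 \<le> t" and x: "x \<in> {0..s t}"
  shows "((\<lambda>x. integral {x..s t} (\<lambda>y. k x y * e y t)) has_real_derivative
    integral {x..s t} (\<lambda>y. k' x y * e y t) - k x x * e x t) (at x within {0..s t})"
proof -
  have "continuous_on ({0..s t} \<times> {0..s t}) (\<lambda>p. e (snd p) t)"
    by (rule continuous_on_compose2[OF e_section[OF t]]) (auto intro: continuous_intros)
  moreover have "continuous_on ({0..s t} \<times> {0..s t}) (\<lambda>p. k (fst p) (snd p))"
    "continuous_on ({0..s t} \<times> {0..s t}) (\<lambda>p. k' (fst p) (snd p))"
    using kc kc' by (auto simp: split_beta intro: continuous_on_subset)
  ultimately show ?thesis
    using x
    by (intro DERIV_volterra)
      (auto simp: split_beta intro!: continuous_intros derivative_eq_intros has_field_derivative_at_within[OF k])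
qed

lemma kernel_diag: "bs_inv_kernel \<mu> x x = \<mu> / 2 * x"
  by (simp add: bs_inv_kernel_def kern_0)

lemma DERIV_w:
  assumes "0 < t" "x \<in> {0..s t}"
  shows "((\<lambda>x. w x t) has_real_derivative wx x t) (at x within {0..s t})"
proof -
  have "((\<lambda>x. integral {x..s t} (\<lambda>y. bs_inv_kernel \<mu> x y * e y t)) has_real_derivative
    integral {x..s t} (\<lambda>y. Qx x y * e y t) - bs_inv_kernel \<mu> x x * e x t) (at x within {0..s t})"
    by (rule DERIV_volterra_kernel[OF DERIV_Q(1)])
      (use assms in \<open>auto simp: split_beta intro!: continuous_intros\<close>)
  then show ?thesis
    unfolding w_def wx_def kernel_diag using assms
    by (auto intro!: derivative_eq_intros C1_wetD(4)[OF e_C1])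
qed

lemma DERIV_wx:
  assumes "0 < t" "x \<in> {0..s t}"
  shows "((\<lambda>x. wx x t) has_real_derivative wxx x t) (at x within {0..s t})"
proof -
  define m where "m = \<mu> / 2"
  have "((\<lambda>x. integral {x..s t} (\<lambda>y. Qx x y * e y t)) has_real_derivative
    integral {x..s t} (\<lambda>y. Qxx x y * e y t) - Qx x x * e x t) (at x within {0..s t})"
    by (rule DERIV_volterra_kernel[OF DERIV_Q(2)])
      (use assms in \<open>auto simp: split_beta intro!: continuous_intros\<close>)
  then show ?thesis
    unfolding wx_def wxx_def m_def[symmetric] using assms
    by (auto intro!: derivative_eq_intros C1_wetD(4)[OF e_C1] ex_deriv simp: mem_wet_region)
qed

text \<open>The integral over {x..s r} is that over {0..s r} minus that over {0..x}: the transport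
  formula treats the first, differentiation under the integral with fixed limits the second.\<close>

lemma DERIV_wt:
  assumes t: "0 < t" and x: "0 \<le> x" "x < s t"
  shows "((\<lambda>r. w x r) has_real_derivative wt x t) (at t)"
proof -
  let ?Q = "bs_inv_kernel \<mu> x"
  obtain d where d: "0 < d" "\<And>r. dist r t < d \<Longrightarrow> 0 < r \<and> x < s r"
    using eventually_interior[OF t x(2)] unfolding eventually_nhds_metric by blast
  have "C1_wet s (\<lambda>y t. ?Q y) (\<lambda>y t. Qy x y) (\<lambda>y t. 0)"
    by (rule C1_wet_space[OF DERIV_Q(3)]) (intro continuous_intros)
  from DERIV_integral_moving[OF C1_wet_mult[OF this e_C1] t]
  have full: "((\<lambda>r. integral {0..s r} (\<lambda>y. ?Q y * e y r)) has_real_derivative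
      integral {0..s t} (\<lambda>y. ?Q y * et y t)) (at t)"
    using e_bc[OF t] by (simp add: mult.commute)
  have in_wet: "(y, r) \<in> wet_region s" if "r \<in> ball t d" "y \<in> {0..x}" for y r
    using d(2)[of r] that by (auto simp: mem_wet_region dist_commute)
  have "((\<lambda>r. integral (cbox 0 x) (\<lambda>y. ?Q y * e y r)) has_real_derivative
      integral (cbox 0 x) (\<lambda>y. ?Q y * et y t)) (at t within ball t d)"
  proof (rule leibniz_rule_field_derivative)
    show "((\<lambda>r. ?Q y * e y r) has_real_derivative ?Q y * et y r) (at r within ball t d)"
      if "r \<in> ball t d" "y \<in> cbox 0 x" for r y
    proof -
      have "((\<lambda>r. e y r) has_real_derivative et y r) (at r)"
        using d(2)[of r] that by (intro DERIV_time_interior[OF e_C1]) (auto simp: dist_commute)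
      then show ?thesis
        by (auto intro!: derivative_eq_intros intro: has_field_derivative_at_within)
    qed
    show "(\<lambda>y. ?Q y * e y r) integrable_on cbox 0 x" if "r \<in> ball t d" for r
      using d(2)[of r] that unfolding cbox_interval
      by (intro integrable_continuous_interval continuous_intros continuous_on_subset[OF e_section[of r]])
        (auto simp: dist_commute)
    have "continuous_on (ball t d \<times> cbox 0 x) (\<lambda>p. et (snd p) (fst p))"
      by (rule continuous_on_compose_pair[OF C1_wetD(3)[OF e_C1]])
        (use in_wet in \<open>auto intro: continuous_intros\<close>)
    then show "continuous_on (ball t d \<times> cbox 0 x) (\<lambda>(r, y). ?Q y * et y r)"
      by (auto simp: split_beta intro!: continuous_intros)
  qed (use d in auto)
  then have low: "((\<lambda>r. integral {0..x} (\<lambda>y. ?Q y * e y r)) has_real_derivative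
      integral {0..x} (\<lambda>y. ?Q y * et y t)) (at t)"
    using d(1) by (simp add: at_within_open[of t "ball t d"])
  have split: "integral {0..s r} (\<lambda>y. ?Q y * h y) - integral {0..x} (\<lambda>y. ?Q y * h y)
      = integral {x..s r} (\<lambda>y. ?Q y * h y)"
    if "x < s r" "continuous_on {0..s r} (\<lambda>y. h y)" for h r
  proof -
    have "(\<lambda>y. ?Q y * h y) integrable_on {0..s r}"
      by (intro integrable_continuous_interval continuous_intros that(2))
    from Henstock_Kurzweil_Integration.integral_combine[OF _ _ this, of x] show ?thesis
      using x that(1) by simp
  qed
  have "((\<lambda>r. integral {0..s r} (\<lambda>y. ?Q y * e y r) - integral {0..x} (\<lambda>y. ?Q y * e y r))
      has_real_derivative integral {x..s t} (\<lambda>y. ?Q y * et y t)) (at t)"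
    using DERIV_diff[OF full low] split[OF x(2) wet_section[OF t C1_wetD(3)[OF e_C1]]] by simp
  moreover have "\<forall>\<^sub>F r in nhds t. integral {0..s r} (\<lambda>y. ?Q y * e y r) - integral {0..x} (\<lambda>y. ?Q y * e y r)
      = integral {x..s r} (\<lambda>y. ?Q y * e y r)"
    using eventually_interior[OF t x(2)] by eventually_elim (intro split e_section, auto)
  ultimately have "((\<lambda>r. integral {x..s r} (\<lambda>y. ?Q y * e y r))
      has_real_derivative integral {x..s t} (\<lambda>y. ?Q y * et y t)) (at t)"
    by (subst (asm) DERIV_cong_ev[OF refl _ refl])
  then show ?thesis
    unfolding w_def wt_def
    by (auto intro!: derivative_eq_intros DERIV_time_interior[OF e_C1] t x)
qed

text \<open>Green's identity moves the second derivative from e to the kernel, the composition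
  identity disposes of the flux, and the kernel equation turns what remains into - lam w.\<close>

lemma w_pde:
  assumes t: "0 < t" and x: "0 \<le> x" "x \<le> s t"
  shows "wt x t = \<alpha> * wxx x t - lam * w x t"
proof -
  let ?Q = "bs_inv_kernel \<mu> x" and ?P = "\<lambda>y. bs_kernel \<mu> y (s t)" and ?g = "ex (s t) t"
  have sub: "{x..s t} \<subseteq> {0..s t}" using x by auto
  have sec: "continuous_on {x..s t} (\<lambda>y. h y t)" if "continuous_on (wet_region s) (\<lambda>(x, t). h x t)" for h
    by (rule continuous_on_subset[OF wet_section[OF t that] sub])
  note e_sec = sec[OF C1_wetD(1)[OF e_C1]] and exx_sec = sec[OF exx_cont]
  have Qexx: "integral {x..s t} (\<lambda>y. ?Q y * exx y t)
      = ?Q (s t) * ?g - \<mu> / 2 * x * ex x t + Qy x x * e x t + integral {x..s t} (\<lambda>y. Qyy x y * e y t)"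
  proof -
    have "integral {x..s t} (\<lambda>y. ?Q y * exx y t)
      = ?Q (s t) * ?g - ?Q x * ex x t - Qy x (s t) * e (s t) t + Qy x x * e x t
        + integral {x..s t} (\<lambda>y. Qyy x y * e y t)"
    proof (rule integral_mult_second_deriv)
      show "((\<lambda>y. e y t) has_real_derivative ex y t) (at y within {x..s t})"
        "((\<lambda>y. ex y t) has_real_derivative exx y t) (at y within {x..s t})" if "y \<in> {x..s t}" for y
        using that t x
        by (auto intro!: DERIV_subset[OF C1_wetD(4)[OF e_C1] sub] DERIV_subset[OF ex_deriv sub]
            simp: mem_wet_region)
    qed (use x in \<open>auto intro!: has_field_derivative_at_within[OF DERIV_Q(3)]
        has_field_derivative_at_within[OF DERIV_Q(4)] continuous_intros\<close>)
    then show ?thesis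
      using e_bc[OF t] by (simp add: kernel_diag)
  qed
  \<comment> \<open>The term with Q(s) cancels the one in \<open>Qexx\<close>, and the surviving
    \<alpha> g P(x, s) is the one carried by \<open>et\<close> itself. Here the choice of the gain
    pays off.\<close>
  have Qet: "integral {x..s t} (\<lambda>y. ?Q y * et y t)
      = \<alpha> * integral {x..s t} (\<lambda>y. ?Q y * exx y t) + \<alpha> * ?g * (bs_kernel \<mu> x (s t) - ?Q (s t))"
  proof -
    have "integral {x..s t} (\<lambda>y. ?Q y * et y t)
        = integral {x..s t} (\<lambda>y. \<alpha> * (?Q y * exx y t) + \<alpha> * ?g * (?Q y * ?P y))"
      by (rule integral_cong) (use t x in \<open>simp add: e_pde mem_wet_region algebra_simps\<close>)
    also have "\<dots> = integral {x..s t} (\<lambda>y. \<alpha> * (?Q y * exx y t)) + integral {x..s t} (\<lambda>y. \<alpha> * ?g * (?Q y * ?P y))"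
      by (intro integral_add integrable_continuous_interval continuous_intros exx_sec)
    finally show ?thesis
      using integral_kernel_inv_kernel[OF mu_pos x] by simp
  qed
  have Qwave: "integral {x..s t} (\<lambda>y. Qxx x y * e y t) - integral {x..s t} (\<lambda>y. Qyy x y * e y t)
      = \<mu> * integral {x..s t} (\<lambda>y. ?Q y * e y t)"
  proof -
    have "integral {x..s t} (\<lambda>y. Qxx x y * e y t) - integral {x..s t} (\<lambda>y. Qyy x y * e y t)
        = integral {x..s t} (\<lambda>y. Qxx x y * e y t - Qyy x y * e y t)"
      by (intro integral_diff[symmetric] integrable_continuous_interval continuous_intros e_sec)
    also have "\<dots> = integral {x..s t} (\<lambda>y. \<mu> * (?Q y * e y t))"
      using Q_wave[of x] by (intro integral_cong) (metis (no_types) left_diff_distrib mult.assoc)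
    finally show ?thesis by simp
  qed
  \<comment> \<open>Derivative of the diagonal value Q(x, x) = \<mu> x / 2.\<close>
  have diag: "Qy x x = \<mu> / 2 - Qx x x"
    by (simp add: Qx_def Qy_def kern_0 power2_eq_square)
  have lam_eq: "lam = \<alpha> * \<mu>"
    using \<alpha> by simp
  have et: "et x t = \<alpha> * exx x t + \<alpha> * bs_kernel \<mu> x (s t) * ?g"
    using e_pde[of x t] t x by (simp add: mem_wet_region)
  define m where "m = \<mu>"
  have "wt x t = \<alpha> * exx x t + \<alpha> * (m / 2 * x * ex x t) - \<alpha> * ((m / 2 - Qx x x) * e x t)
      - \<alpha> * integral {x..s t} (\<lambda>y. Qyy x y * e y t)"
    unfolding wt_def Qet Qexx et diag unfolding m_def[symmetric] by (simp add: algebra_simps)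
  also have "\<dots> = \<alpha> * wxx x t - (\<alpha> * m) * w x t"
  proof -
    have "integral {x..s t} (\<lambda>y. Qyy x y * e y t) = integral {x..s t} (\<lambda>y. Qxx x y * e y t)
        - m * integral {x..s t} (\<lambda>y. bs_inv_kernel m x y * e y t)"
      using Qwave unfolding m_def[symmetric] by simp
    note J = this
    show ?thesis
      unfolding wxx_def w_def m_def[symmetric] J by (simp add: algebra_simps)
  qed
  finally show ?thesis
    unfolding m_def lam_eq[symmetric] .
qed

lemma w_cont: "continuous_on (liquid_region s) (\<lambda>(x, t). w x t)"
proof -
  define \<Omega> where "\<Omega> = {((x, t), y). 0 \<le> t \<and> 0 \<le> x \<and> x \<le> y \<and> y \<le> s t}"
  have "continuous_on (liquid_region s)
      (\<lambda>p. integral {fst p..s (snd p)} (\<lambda>y. bs_inv_kernel \<mu> (fst p) y * e y (snd p)))"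
  proof (rule continuous_on_integral_moving)
    show "continuous_on (liquid_region s) (\<lambda>p. s (snd p))"
      by (rule continuous_on_compose2[OF s_cont]) (auto simp: liquid_region_def intro: continuous_intros)
    have "continuous_on \<Omega> (\<lambda>z. e (snd z) (snd (fst z)))"
      by (rule continuous_on_compose_pair[OF e_cont])
        (auto simp: liquid_region_def \<Omega>_def intro!: continuous_on_fst continuous_on_snd continuous_on_id)
    then show "continuous_on \<Omega> (\<lambda>(p, y). bs_inv_kernel \<mu> (fst p) y * e y (snd p))"
      by (auto simp: split_beta intro!: continuous_intros)
  qed (auto simp: liquid_region_def \<Omega>_def intro: continuous_intros)
  then show ?thesis
    using e_cont unfolding w_def split_beta by (rule continuous_on_diff[rotated])
qed

text \<open>Both parts of w are compared with s 0 - x: the integral is at most \<mu> B0 (s 0)^2 / 4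
  times it, and \<open>gain\<close> says that this does not exceed the \<open>A0\<close> times s 0 -
  x by which e is negative.\<close>

lemma w_init:
  assumes x: "0 \<le> x" "x \<le> s 0"
  shows "w x 0 \<le> 0"
proof -
  let ?Q = "bs_inv_kernel \<mu> x"
  define I where "I = integral {x..s 0} (\<lambda>y. ?Q y * e y 0)"
  have B0: "0 \<le> B0"
  proof -
    have "- B0 * (s 0 - 0) \<le> e 0 0" "e 0 0 \<le> - A0 * (s 0 - 0)"
      using e_init[of 0] s_pos[of 0] by auto
    then have "- B0 * (s 0 - 0) \<le> - A0 * (s 0 - 0)"
      by (rule order_trans)
    then have "A0 \<le> B0"
      using s_pos[of 0] by simp
    then show ?thesis
      using A0 by simp
  qed
  have "norm I \<le> integral {x..s 0} (\<lambda>y. (\<mu> / 2 * B0 * (s 0 - x)) * y)"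
    unfolding I_def
  proof (rule integral_norm_bound_integral)
    show "(\<lambda>y. ?Q y * e y 0) integrable_on {x..s 0}"
      using x by (intro integrable_continuous_interval continuous_intros continuous_on_subset[OF e_section]) auto
    show "(\<lambda>y. (\<mu> / 2 * B0 * (s 0 - x)) * y) integrable_on {x..s 0}"
      by (intro integrable_continuous_interval continuous_intros)
    show "norm (?Q y * e y 0) \<le> (\<mu> / 2 * B0 * (s 0 - x)) * y" if y: "y \<in> {x..s 0}" for y
    proof -
      have "0 \<le> A0 * (s 0 - y)"
        using A0 y by simp
      then have "\<bar>e y 0\<bar> \<le> B0 * (s 0 - y)"
        using e_init[of y] x y by auto
      also have "\<dots> \<le> B0 * (s 0 - x)"
        using B0 y by (intro mult_left_mono) auto
      finally have "\<bar>?Q y\<bar> * \<bar>e y 0\<bar> \<le> (\<mu> * y / 2) * (B0 * (s 0 - x))"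
        using abs_bs_inv_kernel_le[OF mu_pos x(1), of y] y by (intro mult_mono) auto
      then show ?thesis
        by (simp add: abs_mult mult_ac)
    qed
  qed
  also have "\<dots> = (\<mu> / 2 * B0 * (s 0 - x)) * (((s 0)\<^sup>2 - x\<^sup>2) / 2)"
    using x by (simp only: integral_mult_right integral_ident if_True)
  also have "\<dots> \<le> (\<mu> / 2 * B0 * (s 0 - x)) * ((s 0)\<^sup>2 / 2)"
    using \<alpha> lam B0 x by (intro mult_left_mono mult_nonneg_nonneg) auto
  also have "\<dots> = (lam * (s 0)\<^sup>2 * B0) * (s 0 - x) / (4 * \<alpha>)"
    by simp
  also have "\<dots> \<le> (4 * \<alpha> * A0) * (s 0 - x) / (4 * \<alpha>)"
    using gain x \<alpha> by (intro divide_right_mono mult_right_mono) auto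
  also have "\<dots> = A0 * (s 0 - x)"
    using \<alpha> by simp
  finally show ?thesis
    using e_init[OF x] unfolding w_def I_def[symmetric] by (auto simp: abs_le_iff)
qed

lemma w_nonpos:
  assumes "0 \<le> t" "0 \<le> x" "x \<le> s t"
  shows "w x t \<le> 0"
proof -
  have "0 \<le> - w x t"
  proof (rule parabolic_minimum_principle[where v = "\<lambda>x t. - w x t" and vx = "\<lambda>x t. - wx x t"
        and vxx = "\<lambda>x t. - wxx x t" and vt = "\<lambda>x t. - wt x t" and \<alpha> = \<alpha> and lam = lam])
    show "continuous_on (liquid_region s) (\<lambda>(x, t). - w x t)"
      using w_cont by (auto simp: split_beta intro: continuous_intros)
    fix x t assume t: "0 < (t::real)"
    \<comment> \<open>The kernel depends on x through x^2, so \<open>Qx\<close> vanishes at x = 0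
      and the Neumann condition passes from e to w.\<close>
    have "wx 0 t = 0"
      using e_flux[OF t] by (simp add: wx_def Qx_def)
    then show "\<exists>d\<le>0. ((\<lambda>y. - w y t) has_real_derivative d) (at 0 within {0..s t})"
      using DERIV_w[OF t, of 0] s_pos[of t] t by (intro exI[of _ 0]) (auto intro!: derivative_eq_intros)
    show "0 \<le> - w (s t) t"
      using e_bc[OF t] by (simp add: w_def)
    assume x: "0 < x" "x < s t"
    show "((\<lambda>y. - w y t) has_real_derivative - wx x t) (at x)"
      using DERIV_w[OF t, of x] x at_within_Icc_at[of 0 x "s t"] by (auto intro!: derivative_eq_intros)
    show "((\<lambda>y. - wx y t) has_real_derivative - wxx x t) (at x)"
      using DERIV_wx[OF t, of x] x at_within_Icc_at[of 0 x "s t"] by (auto intro!: derivative_eq_intros)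
    show "((\<lambda>r. - w x r) has_real_derivative - wt x t) (at t)"
      using DERIV_wt[OF t, of x] x by (auto intro!: derivative_eq_intros)
    show "\<alpha> * - wxx x t - lam * - w x t \<le> - wt x t"
      using w_pde[OF t, of x] x by simp
  qed (use \<alpha> lam w_init assms in auto)
  then show ?thesis by simp
qed

section \<open>Back from the target system to the error\<close>

text \<open>Exchanging the order of integration on the triangle reduces the double integral to the
  composition identity for the kernels.\<close>

lemma e_eq_transform_w:
  assumes "0 \<le> t" "0 \<le> x" "x \<le> s t"
  shows "e x t = w x t + integral {x..s t} (\<lambda>y. bs_kernel \<mu> x y * w y t)"
proof -
  let ?P = "bs_kernel \<mu>" and ?Q = "bs_inv_kernel \<mu>"
  have sub: "{x..s t} \<subseteq> {0..s t}" using assms by auto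
  note e_sec = continuous_on_subset[OF e_section[OF assms(1)] sub]
  have e2: "continuous_on ({x..s t} \<times> {x..s t}) (\<lambda>p. e (snd p) t)"
    by (rule continuous_on_compose2[OF e_sec]) (auto intro: continuous_intros)
  have inner: "continuous_on {x..s t} (\<lambda>y. integral {y..s t} (\<lambda>z. ?Q y z * e z t))"
    by (rule continuous_on_integral_moving[where \<Omega> = "{x..s t} \<times> {x..s t}"])
      (use e2 in \<open>auto simp: split_beta intro!: continuous_intros\<close>)
  have "integral {x..s t} (\<lambda>y. ?P x y * w y t)
      = integral {x..s t} (\<lambda>y. ?P x y * e y t - ?P x y * integral {y..s t} (\<lambda>z. ?Q y z * e z t))"
    by (simp add: w_def algebra_simps)
  also have "\<dots> = integral {x..s t} (\<lambda>y. ?P x y * e y t)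
      - integral {x..s t} (\<lambda>y. ?P x y * integral {y..s t} (\<lambda>z. ?Q y z * e z t))"
    by (intro integral_diff integrable_continuous_interval continuous_intros e_sec inner)
  also have "integral {x..s t} (\<lambda>y. ?P x y * integral {y..s t} (\<lambda>z. ?Q y z * e z t))
      = integral {x..s t} (\<lambda>y. integral {y..s t} (\<lambda>z. ?P x y * (?Q y z * e z t)))"
    by simp
  also have "\<dots> = integral {x..s t} (\<lambda>z. integral {x..z} (\<lambda>y. ?P x y * (?Q y z * e z t)))"
    by (rule integral_triangle_swap)
      (use e2 assms in \<open>auto simp: split_beta intro!: continuous_intros\<close>)
  also have "\<dots> = integral {x..s t} (\<lambda>z. ?P x z * e z t - ?Q x z * e z t)"
  proof (rule integral_cong)
    fix z assume z: "z \<in> {x..s t}"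
    have "integral {x..z} (\<lambda>y. ?P x y * (?Q y z * e z t)) = integral {x..z} (\<lambda>y. ?P x y * ?Q y z) * e z t"
      by (simp add: mult.assoc[symmetric])
    also have "integral {x..z} (\<lambda>y. ?P x y * ?Q y z) = ?P x z - ?Q x z"
      using integral_kernel_kernel_inv[OF mu_pos assms(2), of z] z by simp
    finally show "integral {x..z} (\<lambda>y. ?P x y * (?Q y z * e z t)) = ?P x z * e z t - ?Q x z * e z t"
      by (simp only: left_diff_distrib)
  qed
  also have "\<dots> = integral {x..s t} (\<lambda>z. ?P x z * e z t) - integral {x..s t} (\<lambda>z. ?Q x z * e z t)"
    by (intro integral_diff integrable_continuous_interval continuous_intros e_sec)
  finally show ?thesis
    by (simp add: w_def)
qed

lemma e_nonpos:
  assumes "0 \<le> t" "0 \<le> x" "x \<le> s t"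
  shows "e x t \<le> 0"
proof -
  have "integral {x..s t} (\<lambda>y. bs_kernel \<mu> x y * w y t) \<le> integral {x..s t} (\<lambda>y. 0)"
  proof (rule integral_le)
    have "continuous_on {x..s t} (\<lambda>y. w y t)"
      by (rule continuous_on_compose_pair[OF w_cont])
        (use assms in \<open>auto simp: liquid_region_def intro: continuous_intros\<close>)
    then show "(\<lambda>y. bs_kernel \<mu> x y * w y t) integrable_on {x..s t}"
      by (intro integrable_continuous_interval continuous_intros)
    show "bs_kernel \<mu> x y * w y t \<le> 0" if "y \<in> {x..s t}" for y
      using bs_kernel_nonneg[OF mu_pos assms(2), of y] w_nonpos[of t y] that assms
      by (intro mult_nonneg_nonpos) auto
  qed auto
  then show ?thesis
    using e_eq_transform_w[OF assms] w_nonpos[OF assms] by simp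
qed

text \<open>e attains its maximum 0 at the interface, the right end of the interval.\<close>

lemma interface_flux_nonneg: "0 < t \<Longrightarrow> 0 \<le> ex (s t) t"
  using DERIV_nonneg_at_left_max[OF C1_wetD(4)[OF e_C1, of t "s t"]] s_pos[of t] e_nonpos[of t] e_bc[of t]
  by auto

end

section \<open>Bounds for the direct kernel and a Gronwall estimate\<close>

definition bs_kernel_x :: "real \<Rightarrow> real \<Rightarrow> real \<Rightarrow> real" where
  "bs_kernel_x \<mu> x y = - 2 * \<mu>\<^sup>2 * x * y * kern' (\<mu> * (y\<^sup>2 - x\<^sup>2))"

definition bs_kernel_xx :: "real \<Rightarrow> real \<Rightarrow> real \<Rightarrow> real" where
  "bs_kernel_xx \<mu> x y = - 2 * \<mu>\<^sup>2 * y * kern' (\<mu> * (y\<^sup>2 - x\<^sup>2))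
    + 4 * \<mu> ^ 3 * x\<^sup>2 * y * kern'' (\<mu> * (y\<^sup>2 - x\<^sup>2))"

lemma DERIV_bs_kernel:
  "((\<lambda>x. bs_kernel \<mu> x y) has_real_derivative bs_kernel_x \<mu> x y) (at x)"
  "((\<lambda>x. bs_kernel_x \<mu> x y) has_real_derivative bs_kernel_xx \<mu> x y) (at x)"
  unfolding bs_kernel_def bs_kernel_x_def bs_kernel_xx_def
  by (rule derivative_eq_intros DERIV_kern_chain refl | simp add: power2_eq_square power3_eq_cube)+

lemma continuous_on_bs_kernel_xx [continuous_intros]:
  assumes "continuous_on S f" "continuous_on S g"
  shows "continuous_on S (\<lambda>p. bs_kernel_xx \<mu> (f p) (g p))"
  unfolding bs_kernel_xx_def by (intro continuous_intros assms)+

text \<open>Compactness of a fixed square. With L the setpoint, the bound is independent of the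
  solution as soon as s \<le> sr is known.\<close>

lemma bs_kernel_bounded:
  "\<exists>B>0. \<forall>x\<in>{0..L}. \<forall>y\<in>{0..L}. bs_kernel \<mu> x y \<le> B \<and> \<bar>bs_kernel_xx \<mu> x y\<bar> \<le> B"
proof -
  have "compact ((\<lambda>p. (bs_kernel \<mu> (fst p) (snd p), bs_kernel_xx \<mu> (fst p) (snd p))) ` ({0..L} \<times> {0..L}))"
    by (intro compact_continuous_image compact_Times compact_Icc continuous_intros)
  then obtain B where B: "0 < B" "\<And>p. p \<in> {0..L} \<times> {0..L} \<Longrightarrow>
      norm (bs_kernel \<mu> (fst p) (snd p), bs_kernel_xx \<mu> (fst p) (snd p)) \<le> B"
    by (auto dest!: compact_imp_bounded simp: bounded_pos)
  have "bs_kernel \<mu> x y \<le> B \<and> \<bar>bs_kernel_xx \<mu> x y\<bar> \<le> B" if "x \<in> {0..L}" "y \<in> {0..L}" for x y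
    using B(2)[of "(x, y)"] that norm_fst_le[of "bs_kernel \<mu> x y" "bs_kernel_xx \<mu> x y"]
      norm_snd_le[of "bs_kernel_xx \<mu> x y" "bs_kernel \<mu> x y"] by auto
  then show ?thesis
    using B(1) by blast
qed

text \<open>Gronwall: exp (b t) V t is nonincreasing. The derivative is asked for t > 0 only, and
  continuity links it to the initial value. V may be negative, as when the lemma is applied to -
  q.\<close>

lemma exponential_decay:
  fixes V :: "real \<Rightarrow> real"
  assumes cont: "continuous_on {0..} V"
    and deriv: "\<And>t. 0 < t \<Longrightarrow> \<exists>d. (V has_real_derivative d) (at t) \<and> d \<le> - b * V t"
    and t: "0 \<le> t"
  shows "V t \<le> V 0 * exp (- b * t)"
proof -
  have "- (exp (b * 0) * V 0) \<le> - (exp (b * t) * V t)"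
  proof (rule DERIV_nonneg_imp_increasing_open[OF t])
    fix x assume x: "0 < x" "x < t"
    obtain d where d: "(V has_real_derivative d) (at x)" "d \<le> - b * V x"
      using deriv[OF x(1)] by blast
    have "((\<lambda>t. - (exp (b * t) * V t)) has_real_derivative - (exp (b * x) * (b * V x + d))) (at x)"
      by (rule derivative_eq_intros d(1) refl | simp add: algebra_simps)+
    moreover have "exp (b * x) * (b * V x + d) \<le> 0"
      using d(2) by (intro mult_nonneg_nonpos) auto
    ultimately show "\<exists>y. ((\<lambda>t. - (exp (b * t) * V t)) has_real_derivative y) (at x) \<and> 0 \<le> y"
      by (intro exI[of _ "- (exp (b * x) * (b * V x + d))"]) simp
  next
    show "continuous_on {0..t} (\<lambda>t. - (exp (b * t) * V t))"
      by (intro continuous_intros continuous_on_subset[OF cont]) auto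
  qed
  then have "exp (b * t) * V t * exp (- b * t) \<le> V 0 * exp (- b * t)"
    by (intro mult_right_mono) auto
  moreover have "exp (b * t) * V t * exp (- b * t) = V t"
    by (simp add: exp_minus field_simps)
  ultimately show ?thesis by (simp only:)
qed

lemma C1_wet_diff:
  assumes f: "C1_wet s f fx ft" and g: "C1_wet s g gx gt"
  shows "C1_wet s (\<lambda>x t. f x t - g x t) (\<lambda>x t. fx x t - gx x t) (\<lambda>x t. ft x t - gt x t)"
  unfolding C1_wet_def mem_wet_region
  using C1_wetD[OF f] C1_wetD[OF g]
  by (auto simp: split_beta intro!: continuous_intros derivative_eq_intros)

section \<open>The Lyapunov functional\<close>

text \<open>\<open>B\<close>, \<open>\<eta>\<close>, \<open>m\<close> and \<open>K\<close> enter
  through inequalities so that they can be fixed ahead of the solution. \<open>\<eta>\<close> keeps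
  the flux that drives q below half of what N dissipates, \<open>m\<close> is the decay rate of M,
  and the bounds on \<open>K\<close> pay in turn for the flux term in the energy of e, the terms
  with q^2, and the indefinite - 2 q u(0).\<close>

locale closed_loop = observer_error s sdot \<alpha> lam e ex exx et A0 B0
  for s sdot :: "real \<Rightarrow> real" and \<alpha> lam :: real and e ex exx et :: "real \<Rightarrow> real \<Rightarrow> real" and A0 B0 :: real +
  fixes \<beta> c sr B \<eta> m K :: real and u ux uxx ut :: "real \<Rightarrow> real \<Rightarrow> real"
  assumes \<beta>: "0 < \<beta>" and c: "0 < c"
    and u_cont: "continuous_on (liquid_region s) (\<lambda>(x, t). u x t)"
    and u_C1: "C1_wet s u ux ut"
    and uxx_cont: "continuous_on (wet_region s) (\<lambda>(x, t). uxx x t)"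
    and ux_deriv: "\<And>x t. (x, t) \<in> wet_region s \<Longrightarrow>
      ((\<lambda>y. ux y t) has_real_derivative uxx x t) (at x within {0..s t})"
    and u_pde: "\<And>x t. (x, t) \<in> wet_region s \<Longrightarrow> ut x t = \<alpha> * uxx x t"
    and u_bc: "\<And>t. 0 < t \<Longrightarrow> u (s t) t = 0"
    and u_flux: "\<And>t. 0 < t \<Longrightarrow>
      ux 0 t = c * (1 / \<alpha> * integral {0..s t} (\<lambda>x. u x t - e x t) + 1 / \<beta> * (s t - sr))"
    and stefan: "\<And>t. 0 < t \<Longrightarrow> sdot t = - \<beta> * ux (s t) t"
    and u_init: "\<And>x. 0 \<le> x \<Longrightarrow> x \<le> s 0 \<Longrightarrow> 0 \<le> u x 0"
    and q_init: "1 / \<alpha> * integral {0..s 0} (\<lambda>x. u x 0 - e x 0) + 1 / \<beta> * (s 0 - sr) \<le> 0"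
    and ux_corner: "continuous_on (liquid_region s - {(0, 0)}) (\<lambda>(x, t). ux x t)"
      "\<And>\<tau>. bounded ((\<lambda>(x, t). ux x t) ` {(x, t) \<in> liquid_region s. t \<le> \<tau>})"
    and ex_corner: "continuous_on (liquid_region s - {(0, 0)}) (\<lambda>(x, t). ex x t)"
      "\<And>\<tau>. bounded ((\<lambda>(x, t). ex x t) ` {(x, t) \<in> liquid_region s. t \<le> \<tau>})"
    and B_pos: "0 < B"
    and B: "\<And>x y. x \<in> {0..sr} \<Longrightarrow> y \<in> {0..sr} \<Longrightarrow>
      bs_kernel (lam / \<alpha>) x y \<le> B \<and> \<bar>bs_kernel_xx (lam / \<alpha>) x y\<bar> \<le> B"
    and \<eta>: "0 < \<eta>" "\<eta> * c * (1 + sr * B) \<le> \<alpha> / 4"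
    and m: "0 < m" "m \<le> \<alpha> * (pi / (3 * sr))\<^sup>2" "m \<le> c"
    and K: "8 * B \<le> K" "\<alpha> * sr + 2 * c\<^sup>2 * sr / \<alpha> \<le> K * m * \<eta>\<^sup>2" "4 * sr \<le> K * \<eta>\<^sup>2"
begin

section \<open>The control law and the signs it enforces\<close>

text \<open>The control divided by k; the estimate enters as That - Tm = u - e.\<close>

definition q :: "real \<Rightarrow> real" where
  "q t = - c * (1 / \<alpha> * integral {0..s t} (\<lambda>x. u x t - e x t) + 1 / \<beta> * (s t - sr))"

abbreviation g :: "real \<Rightarrow> real" where
  "g t \<equiv> ex (s t) t"

definition gain_mass :: "real \<Rightarrow> real" where
  "gain_mass t = integral {0..s t} (\<lambda>x. bs_kernel \<mu> x (s t))"

lemma u_section: "0 \<le> t \<Longrightarrow> continuous_on {0..s t} (\<lambda>y. u y t)"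
  by (rule continuous_on_compose_pair[OF u_cont]) (auto simp: liquid_region_def intro: continuous_intros)

lemma ux_q: "0 < t \<Longrightarrow> ux 0 t = - q t"
  by (simp add: u_flux q_def)

lemma q_cont: "continuous_on {0..} q"
proof -
  have "continuous_on (liquid_region s) (\<lambda>(x, t). u x t - e x t)"
    using u_cont e_cont by (auto simp: split_beta intro: continuous_intros)
  from continuous_on_integral_liquid'[OF this] show ?thesis
    unfolding q_def by (intro continuous_intros s_cont)
qed

lemma gain_mass_nonneg: "0 \<le> t \<Longrightarrow> 0 \<le> gain_mass t"
  unfolding gain_mass_def
  by (intro integral_nonneg integrable_continuous_interval continuous_intros)
    (use bs_kernel_nonneg[OF mu_pos] in auto)

lemma integral_et:
  assumes t: "0 < t" and p: "continuous_on {0..s t} p"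
  shows "integral {0..s t} (\<lambda>x. p x * et x t) = \<alpha> * integral {0..s t} (\<lambda>x. p x * exx x t)
    + \<alpha> * g t * integral {0..s t} (\<lambda>x. p x * bs_kernel \<mu> x (s t))"
proof -
  have "integral {0..s t} (\<lambda>x. p x * et x t)
      = integral {0..s t} (\<lambda>x. \<alpha> * (p x * exx x t) + \<alpha> * g t * (p x * bs_kernel \<mu> x (s t)))"
    by (rule integral_cong) (use t in \<open>simp add: e_pde mem_wet_region algebra_simps\<close>)
  also have "\<dots> = integral {0..s t} (\<lambda>x. \<alpha> * (p x * exx x t))
      + integral {0..s t} (\<lambda>x. \<alpha> * g t * (p x * bs_kernel \<mu> x (s t)))"
    by (intro integral_add integrable_continuous_interval continuous_intros p wet_section[OF t exx_cont])
  finally show ?thesis by simp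
qed

text \<open>The condition v' 0 = 0 removes the unknown value e(0, t), and the boundary conditions of
  e remove the rest apart from the flux g. Constants, the cosine and the direct kernel all qualify
  as weights.\<close>

lemma green_e:
  assumes t: "0 < t"
    and v: "\<And>x. (v has_real_derivative v' x) (at x)" "\<And>x. (v' has_real_derivative v'' x) (at x)"
    and cont: "continuous_on UNIV v''" and v'0: "v' 0 = 0"
  shows "integral {0..s t} (\<lambda>x. v x * exx x t) = v (s t) * g t + integral {0..s t} (\<lambda>x. v'' x * e x t)"
proof -
  have "integral {0..s t} (\<lambda>x. v x * exx x t)
    = v (s t) * ex (s t) t - v 0 * ex 0 t - v' (s t) * e (s t) t + v' 0 * e 0 t
      + integral {0..s t} (\<lambda>x. v'' x * e x t)"
    by (rule integral_mult_second_deriv)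
      (use s_pos[of t] t in \<open>auto intro!: C1_wetD(4)[OF e_C1] ex_deriv has_field_derivative_at_within[OF v(1)]
        has_field_derivative_at_within[OF v(2)] continuous_on_subset[OF cont] simp: mem_wet_region\<close>)
  then show ?thesis
    using e_bc[OF t] e_flux[OF t] v'0 by simp
qed

text \<open>By the Stefan condition the interface flux of u cancels against sdot / \<beta>, so that
  q is driven only by the flux of the error, directly and through the mass that the observer
  injects.\<close>

lemma DERIV_q:
  assumes t: "0 < t"
  shows "(q has_real_derivative - c * q t + c * (1 + gain_mass t) * g t) (at t)"
proof -
  have "((\<lambda>r. integral {0..s r} (\<lambda>x. u x r - e x r)) has_real_derivative
      integral {0..s t} (\<lambda>x. ut x t - et x t)) (at t)"
    using DERIV_integral_moving[OF C1_wet_diff[OF u_C1 e_C1] t] u_bc[OF t] e_bc[OF t] by simp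
  then have "(q has_real_derivative
      - c * (1 / \<alpha> * integral {0..s t} (\<lambda>x. ut x t - et x t) + 1 / \<beta> * (sdot t - 0))) (at t)"
    unfolding q_def[abs_def] by (intro DERIV_cmult DERIV_add DERIV_diff DERIV_const s_deriv[OF t])
  then have deriv: "(q has_real_derivative
      - c * (1 / \<alpha> * integral {0..s t} (\<lambda>x. ut x t - et x t) + 1 / \<beta> * sdot t)) (at t)"
    by (simp only: diff_zero)
  have "integral {0..s t} (\<lambda>x. ut x t - et x t) = integral {0..s t} (\<lambda>x. ut x t) - integral {0..s t} (\<lambda>x. et x t)"
    by (intro integral_diff integrable_continuous_interval wet_section[OF t] C1_wetD(3)[OF u_C1] C1_wetD(3)[OF e_C1])
  also have "integral {0..s t} (\<lambda>x. et x t) = \<alpha> * g t + \<alpha> * g t * gain_mass t"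
    using integral_et[OF t, of "\<lambda>_. 1"] green_e[OF t, of "\<lambda>_. 1" "\<lambda>_. 0" "\<lambda>_. 0"]
    by (simp add: gain_mass_def)
  also have "integral {0..s t} (\<lambda>x. ut x t) = \<alpha> * (ux (s t) t + q t)"
  proof -
    have "((\<lambda>x. \<alpha> * uxx x t) has_integral \<alpha> * (ux (s t) t - ux 0 t)) {0..s t}"
      using s_pos[of t] t
      by (intro has_integral_mult_right real_fundamental_theorem_of_calculus ux_deriv)
        (auto simp: mem_wet_region)
    then have "integral {0..s t} (\<lambda>x. \<alpha> * uxx x t) = \<alpha> * (ux (s t) t - ux 0 t)"
      by (rule integral_unique)
    moreover have "integral {0..s t} (\<lambda>x. ut x t) = integral {0..s t} (\<lambda>x. \<alpha> * uxx x t)"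
      by (rule integral_cong) (use t in \<open>simp add: u_pde mem_wet_region\<close>)
    ultimately show ?thesis
      using ux_q[OF t] by (simp only: diff_minus_eq_add)
  qed
  finally have I: "integral {0..s t} (\<lambda>x. ut x t - et x t)
      = \<alpha> * (ux (s t) t + q t) - (\<alpha> * g t + \<alpha> * g t * gain_mass t)" .
  have "- c * (1 / \<alpha> * integral {0..s t} (\<lambda>x. ut x t - et x t) + 1 / \<beta> * sdot t)
      = - c * q t + c * (1 + gain_mass t) * g t"
    unfolding I stefan[OF t] using \<alpha> \<beta> by (simp add: field_simps)
  then show ?thesis
    using deriv by simp
qed

lemma q_nonneg:
  assumes t: "0 \<le> t"
  shows "0 \<le> q t"
proof -
  have "- q t \<le> - q 0 * exp (- c * t)"
  proof (rule exponential_decay[OF _ _ t])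
    show "continuous_on {0..} (\<lambda>t. - q t)"
      by (intro continuous_intros q_cont)
    fix t :: real assume t: "0 < t"
    have "0 \<le> c * (1 + gain_mass t) * g t"
      using c gain_mass_nonneg[of t] interface_flux_nonneg[OF t] t by simp
    then show "\<exists>d. ((\<lambda>t. - q t) has_real_derivative d) (at t) \<and> d \<le> - c * - q t"
      using DERIV_minus[OF DERIV_q[OF t]] by (intro exI conjI) auto
  qed
  moreover have "0 \<le> q 0"
    using q_init c unfolding q_def by (intro mult_nonpos_nonpos) auto
  ultimately show ?thesis
    by (smt (verit) exp_ge_zero mult_nonneg_nonneg minus_mult_left)
qed

lemma u_nonneg:
  assumes "0 \<le> t" "0 \<le> x" "x \<le> s t"
  shows "0 \<le> u x t"
proof (rule parabolic_minimum_principle[where v = u and vx = ux and vxx = uxx and vt = ut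
      and \<alpha> = \<alpha> and lam = 0])
  fix x t assume t: "0 < (t::real)"
  show "\<exists>d\<le>0. ((\<lambda>y. u y t) has_real_derivative d) (at 0 within {0..s t})"
    using C1_wetD(4)[OF u_C1 t, of 0] s_pos[of t] t q_nonneg[of t] ux_q[OF t]
    by (intro exI[of _ "ux 0 t"]) auto
  show "0 \<le> u (s t) t"
    using u_bc[OF t] by simp
  assume x: "0 < x" "x < s t"
  show "((\<lambda>y. u y t) has_real_derivative ux x t) (at x)"
    using C1_wetD(4)[OF u_C1 t, of x] x at_within_Icc_at[of 0 x "s t"] by simp
  show "((\<lambda>y. ux y t) has_real_derivative uxx x t) (at x)"
    using ux_deriv[of x t] t x at_within_Icc_at[of 0 x "s t"] by (simp add: mem_wet_region)
  show "((\<lambda>r. u x r) has_real_derivative ut x t) (at t)"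
    using DERIV_time_interior[OF u_C1 t] x by simp
  show "\<alpha> * uxx x t - 0 * u x t \<le> ut x t"
    using u_pde[of x t] t x by (simp add: mem_wet_region)
qed (use \<alpha> u_cont u_init assms in auto)

lemma sdot_nonneg:
  assumes t: "0 < t"
  shows "0 \<le> sdot t"
proof -
  have "0 \<le> - ux (s t) t"
    by (rule DERIV_nonneg_at_left_max[of "\<lambda>x. - u x t" _ "s t" 0])
      (use t s_pos[of t] u_nonneg[of t] u_bc[OF t] C1_wetD(4)[OF u_C1 t, of "s t"]
        in \<open>auto intro!: derivative_eq_intros\<close>)
  then show ?thesis
    using \<beta> by (simp add: stefan[OF t] mult_nonneg_nonpos)
qed

text \<open>q \<ge> 0 bounds (s - sr) / \<beta> by minus the estimated heat content, the integral of
  u - e, which is nonnegative by the two signs already known.\<close>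

lemma s_le_sr:
  assumes t: "0 \<le> t"
  shows "s t \<le> sr"
proof -
  have "0 \<le> integral {0..s t} (\<lambda>x. u x t - e x t)"
    by (intro integral_nonneg integrable_continuous_interval continuous_intros u_section e_section t)
      (use u_nonneg[OF t] e_nonpos[OF t] in force)
  then have "0 \<le> 1 / \<alpha> * integral {0..s t} (\<lambda>x. u x t - e x t)"
    using \<alpha> by simp
  moreover have "1 / \<alpha> * integral {0..s t} (\<lambda>x. u x t - e x t) + 1 / \<beta> * (s t - sr) \<le> 0"
    using q_nonneg[OF t] c unfolding q_def by (simp add: mult_le_0_iff)
  ultimately have "1 / \<beta> * (s t - sr) \<le> 0" by linarith
  then show ?thesis
    using \<beta> by (simp add: divide_le_0_iff)
qed

lemma sr_pos: "0 < sr"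
  using s_le_sr[of 0] s_pos[of 0] by simp

lemma gain_mass_le:
  assumes "0 < t"
  shows "gain_mass t \<le> sr * B"
proof -
  have "gain_mass t \<le> integral {0..s t} (\<lambda>_. B)"
    unfolding gain_mass_def
    by (intro integral_le integrable_continuous_interval continuous_intros)
      (use B s_le_sr[of t] s_pos[of t] assms in auto)
  also have "\<dots> \<le> sr * B"
    using s_le_sr[of t] s_pos[of t] assms B_pos by simp
  finally show ?thesis .
qed

section \<open>The weighted mass of the error\<close>

text \<open>The angle \<kappa> x reaches only pi / 3 at x = sr, so the weight stays at least 1/2 on
  every interval {0..s t}.\<close>

definition \<kappa> :: real where "\<kappa> = pi / (3 * sr)"

text \<open>The weight is an eigenfunction with v' 0 = 0 and v'' = - \<kappa>^2 v, so this moment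
  decays on its own at rate \<alpha> \<kappa>^2.\<close>

definition N :: "real \<Rightarrow> real" where
  "N t = - integral {0..s t} (\<lambda>x. cos (\<kappa> * x) * e x t)"

definition L1 :: "real \<Rightarrow> real" where
  "L1 t = - integral {0..s t} (\<lambda>x. e x t)"

lemma cos_ge_half:
  assumes "0 \<le> x" "x \<le> sr"
  shows "1 / 2 \<le> cos (\<kappa> * x)"
proof -
  have "\<kappa> * x \<le> pi / 3"
    using assms sr_pos by (simp add: \<kappa>_def field_simps)
  moreover have "0 \<le> \<kappa> * x"
    using assms sr_pos by (simp add: \<kappa>_def)
  ultimately have "cos (pi / 3) \<le> cos (\<kappa> * x)"
    using pi_gt_zero by (intro cos_monotone_0_pi_le) auto
  then show ?thesis
    by (simp add: cos_60)
qed

lemma L1_nonneg: "0 \<le> t \<Longrightarrow> 0 \<le> L1 t"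
  unfolding L1_def integral_neg[symmetric]
  by (intro integral_nonneg integrable_continuous_interval continuous_intros e_section)
    (use e_nonpos in force)+

lemma L1_le_N:
  assumes t: "0 \<le> t"
  shows "L1 t \<le> 2 * N t"
proof -
  have "integral {0..s t} (\<lambda>x. - e x t) \<le> integral {0..s t} (\<lambda>x. 2 * - (cos (\<kappa> * x) * e x t))"
  proof (rule integral_le)
    show "- e x t \<le> 2 * - (cos (\<kappa> * x) * e x t)" if "x \<in> {0..s t}" for x
    proof -
      have "1 / 2 * - e x t \<le> cos (\<kappa> * x) * - e x t"
        using cos_ge_half[of x] s_le_sr[OF t] e_nonpos[OF t, of x] that by (intro mult_right_mono) auto
      then show ?thesis by simp
    qed
  qed (intro integrable_continuous_interval continuous_intros e_section t)+
  then show ?thesis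
    by (simp add: L1_def N_def)
qed

lemma N_le_L1:
  assumes t: "0 \<le> t"
  shows "N t \<le> L1 t"
proof -
  have "integral {0..s t} (\<lambda>x. - (cos (\<kappa> * x) * e x t)) \<le> integral {0..s t} (\<lambda>x. - e x t)"
  proof (rule integral_le)
    show "- (cos (\<kappa> * x) * e x t) \<le> - e x t" if "x \<in> {0..s t}" for x
      using mult_right_mono[of "cos (\<kappa> * x)" 1 "- e x t"] e_nonpos[OF t, of x] that by simp
  qed (intro integrable_continuous_interval continuous_intros e_section t)+
  then show ?thesis
    by (simp add: L1_def N_def)
qed

lemma N_nonneg: "0 \<le> t \<Longrightarrow> 0 \<le> N t"
  using L1_nonneg L1_le_N by force

text \<open>In Green's identity the flux has the coefficient cos (\<kappa> s) plus the integral of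
  the gain kernel against the weight. The first is at least 1/2 and the second is nonnegative, so
  the injection adds to the dissipation of g.\<close>

lemma DERIV_N:
  assumes t: "0 < t"
  shows "\<exists>d. (N has_real_derivative d) (at t) \<and> d \<le> - \<alpha> * \<kappa>\<^sup>2 * N t - \<alpha> / 2 * g t"
proof -
  have "C1_wet s (\<lambda>x t. cos (\<kappa> * x)) (\<lambda>x t. - \<kappa> * sin (\<kappa> * x)) (\<lambda>x t. 0)"
    by (rule C1_wet_space) (auto intro!: derivative_eq_intros continuous_intros)
  from DERIV_integral_moving[OF C1_wet_mult[OF this e_C1] t]
  have "((\<lambda>r. integral {0..s r} (\<lambda>x. cos (\<kappa> * x) * e x r)) has_real_derivative
      integral {0..s t} (\<lambda>x. cos (\<kappa> * x) * et x t)) (at t)"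
    using e_bc[OF t] by (simp add: mult.commute)
  then have deriv: "(N has_real_derivative - integral {0..s t} (\<lambda>x. cos (\<kappa> * x) * et x t)) (at t)"
    unfolding N_def by (rule DERIV_minus)
  define J where "J = integral {0..s t} (\<lambda>x. cos (\<kappa> * x) * bs_kernel \<mu> x (s t))"
  have "integral {0..s t} (\<lambda>x. cos (\<kappa> * x) * exx x t)
      = cos (\<kappa> * s t) * g t + integral {0..s t} (\<lambda>x. - \<kappa>\<^sup>2 * cos (\<kappa> * x) * e x t)"
    by (rule green_e[OF t, where v' = "\<lambda>x. - \<kappa> * sin (\<kappa> * x)"])
      (auto intro!: derivative_eq_intros continuous_intros simp: power2_eq_square)
  also have "\<dots> = cos (\<kappa> * s t) * g t + \<kappa>\<^sup>2 * N t"
    by (simp add: N_def mult.assoc)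
  finally have eq: "- integral {0..s t} (\<lambda>x. cos (\<kappa> * x) * et x t)
      = - \<alpha> * \<kappa>\<^sup>2 * N t - \<alpha> * (cos (\<kappa> * s t) + J) * g t"
    using integral_et[OF t, of "\<lambda>x. cos (\<kappa> * x)"]
    by (simp add: J_def continuous_intros algebra_simps)
  have "0 \<le> J"
    unfolding J_def
  proof (intro integral_nonneg integrable_continuous_interval continuous_intros)
    show "0 \<le> cos (\<kappa> * x) * bs_kernel \<mu> x (s t)" if "x \<in> {0..s t}" for x
      using cos_ge_half[of x] s_le_sr[of t] t that bs_kernel_nonneg[OF mu_pos, of x "s t"] by simp
  qed
  then have "1 / 2 \<le> cos (\<kappa> * s t) + J"
    using cos_ge_half[of "s t"] s_le_sr[of t] s_pos[of t] t by simp
  then have "\<alpha> * (1 / 2) * g t \<le> \<alpha> * (cos (\<kappa> * s t) + J) * g t"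
    using \<alpha> interface_flux_nonneg[OF t] by (intro mult_right_mono mult_left_mono) auto
  then show ?thesis
    using deriv eq by (intro exI conjI) auto
qed

definition M :: "real \<Rightarrow> real" where
  "M t = N t + \<eta> * q t"

lemma M_nonneg: "0 \<le> t \<Longrightarrow> 0 \<le> M t"
  using N_nonneg q_nonneg \<eta> by (simp add: M_def)

lemma N_le_M: "0 \<le> t \<Longrightarrow> N t \<le> M t"
  using q_nonneg \<eta> by (simp add: M_def)

lemma q_le_M: "0 \<le> t \<Longrightarrow> (\<eta> * q t)\<^sup>2 \<le> (M t)\<^sup>2"
  using N_nonneg q_nonneg \<eta> by (intro power_mono) (auto simp: M_def)

text \<open>The flux that q picks up, scaled by \<eta>, costs at most \<alpha>/4 of the \<alpha>/2
  dissipated by N; the rest is kept for the energy of e.\<close>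

lemma DERIV_M:
  assumes t: "0 < t"
  shows "\<exists>d. (M has_real_derivative d) (at t) \<and> d \<le> - m * M t - \<alpha> / 4 * g t"
proof -
  obtain d where d: "(N has_real_derivative d) (at t)" "d \<le> - \<alpha> * \<kappa>\<^sup>2 * N t - \<alpha> / 2 * g t"
    using DERIV_N[OF t] by blast
  have g: "0 \<le> g t" by (rule interface_flux_nonneg[OF t])
  have "(M has_real_derivative d + \<eta> * (- c * q t + c * (1 + gain_mass t) * g t)) (at t)"
    unfolding M_def by (auto intro!: derivative_eq_intros d(1) DERIV_q[OF t])
  moreover have "d + \<eta> * (- c * q t + c * (1 + gain_mass t) * g t) \<le> - m * M t - \<alpha> / 4 * g t"
  proof -
    have "\<eta> * c * (1 + gain_mass t) \<le> \<eta> * c * (1 + sr * B)"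
      using gain_mass_le[OF t] \<eta>(1) c by (intro mult_left_mono) auto
    then have "\<eta> * c * (1 + gain_mass t) \<le> \<alpha> / 4"
      using \<eta>(2) by linarith
    then have 1: "\<eta> * c * (1 + gain_mass t) * g t \<le> \<alpha> / 4 * g t"
      using g by (rule mult_right_mono)
    have 2: "m * N t \<le> \<alpha> * \<kappa>\<^sup>2 * N t"
      using m N_nonneg[of t] t by (intro mult_right_mono) (auto simp: \<kappa>_def)
    have 3: "m * (\<eta> * q t) \<le> c * (\<eta> * q t)"
      using m q_nonneg[of t] \<eta>(1) t by (intro mult_right_mono) auto
    show ?thesis
      using 1 2 3 d(2) by (simp add: M_def algebra_simps)
  qed
  ultimately show ?thesis by blast
qed

section \<open>Decay of the energies\<close>

definition Ee :: "real \<Rightarrow> real" where "Ee t = integral {0..s t} (\<lambda>x. (ex x t)\<^sup>2)"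
definition Eu :: "real \<Rightarrow> real" where "Eu t = integral {0..s t} (\<lambda>x. (ux x t)\<^sup>2)"
definition Lu :: "real \<Rightarrow> real" where "Lu t = integral {0..s t} (\<lambda>x. (u x t)\<^sup>2)"
definition Le :: "real \<Rightarrow> real" where "Le t = integral {0..s t} (\<lambda>x. (e x t)\<^sup>2)"
definition Ae :: "real \<Rightarrow> real" where "Ae t = integral {0..s t} (\<lambda>x. (exx x t)\<^sup>2)"

text \<open>Integrating by parts twice turns the nonlocal term into \<open>g\<close> times the \<open>L\<^sup>1\<close> norm of the
  error plus a term of favourable sign, which the decay of \<open>M\<close> absorbs.\<close>

lemma DERIV_Ee:
  assumes t: "0 < t"
  shows "\<exists>d. (Ee has_real_derivative d) (at t) \<and> d \<le> - 2 * \<alpha> * Ae t + 4 * \<alpha> * B * (g t * M t)"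
proof -
  let ?P = "\<lambda>x. bs_kernel \<mu> x (s t)" and ?Pxx = "\<lambda>x. bs_kernel_xx \<mu> x (s t)"
  have g: "0 \<le> g t" by (rule interface_flux_nonneg[OF t])
  have exx_sec: "continuous_on {0..s t} (\<lambda>x. exx x t)"
    by (rule wet_section[OF t exx_cont])
  have "(Ee has_real_derivative - sdot t * (g t)\<^sup>2 - 2 * integral {0..s t} (\<lambda>x. exx x t * et x t)) (at t)"
    using DERIV_dirichlet_energy[OF e_C1 exx_cont ex_deriv e_bc t] e_flux[OF t]
    unfolding Ee_def[abs_def] by simp
  moreover have "- sdot t * (g t)\<^sup>2 - 2 * integral {0..s t} (\<lambda>x. exx x t * et x t)
      \<le> - 2 * \<alpha> * Ae t + 4 * \<alpha> * B * (g t * M t)"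
  proof -
    have "integral {0..s t} (\<lambda>x. exx x t * et x t) = \<alpha> * Ae t + \<alpha> * g t * integral {0..s t} (\<lambda>x. ?P x * exx x t)"
      using integral_et[OF t exx_sec] by (simp add: Ae_def power2_eq_square mult.commute)
    \<comment> \<open>Both derivatives land on the kernel, and e remains undifferentiated, in the
      form that M controls through the \<open>L1\<close> mass.\<close>
    also have "integral {0..s t} (\<lambda>x. ?P x * exx x t) = ?P (s t) * g t + integral {0..s t} (\<lambda>x. ?Pxx x * e x t)"
      by (rule green_e[OF t DERIV_bs_kernel]) (auto intro!: continuous_intros simp: bs_kernel_x_def)
    finally have eq: "integral {0..s t} (\<lambda>x. exx x t * et x t)
        = \<alpha> * Ae t + \<alpha> * g t * (?P (s t) * g t + integral {0..s t} (\<lambda>x. ?Pxx x * e x t))" .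
    have "norm (integral {0..s t} (\<lambda>x. ?Pxx x * e x t)) \<le> integral {0..s t} (\<lambda>x. B * - e x t)"
    proof (rule integral_norm_bound_integral)
      show "norm (?Pxx x * e x t) \<le> B * - e x t" if "x \<in> {0..s t}" for x
        using B[of x "s t"] s_le_sr[of t] s_pos[of t] t that e_nonpos[of t x] B_pos
          mult_mono[of "\<bar>?Pxx x\<bar>" B "\<bar>e x t\<bar>" "- e x t"]
        by (simp add: abs_mult)
    qed (use t in \<open>intro integrable_continuous_interval continuous_intros e_section; simp\<close>)+
    also have "\<dots> = B * L1 t"
      by (simp add: L1_def)
    also have "\<dots> \<le> B * (2 * M t)"
      using B_pos L1_le_N[of t] N_le_M[of t] t by (intro mult_left_mono) auto
    finally have "- (2 * B * M t) \<le> integral {0..s t} (\<lambda>x. ?Pxx x * e x t)"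
      by (simp add: abs_le_iff)
    moreover have "0 \<le> ?P (s t) * g t"
      using g bs_kernel_nonneg[OF mu_pos, of "s t" "s t"] s_pos[of t] t by simp
    ultimately have "- (2 * B * M t) \<le> ?P (s t) * g t + integral {0..s t} (\<lambda>x. ?Pxx x * e x t)"
      by linarith
    then have "\<alpha> * g t * - (2 * B * M t)
        \<le> \<alpha> * g t * (?P (s t) * g t + integral {0..s t} (\<lambda>x. ?Pxx x * e x t))"
      using \<alpha> g by (intro mult_left_mono) auto
    moreover have "0 \<le> sdot t * (g t)\<^sup>2"
      using sdot_nonneg[OF t] by simp
    ultimately show ?thesis
      unfolding eq by (simp add: algebra_simps)
  qed
  ultimately show ?thesis by blast
qed

lemma u0_bound:
  assumes t: "0 < t"
  shows "(u 0 t)\<^sup>2 \<le> s t * Eu t"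
  unfolding Eu_def
  by (rule poincare_pointwise[where p = "s t"])
    (use t s_pos[of t] u_bc[OF t] in \<open>auto intro!: C1_wetD(4)[OF u_C1] wet_section C1_wetD(2)[OF u_C1]\<close>)

text \<open>Young's inequality with a free weight p: 1 serves \<open>Lu\<close>, \<alpha> / (2 c)
  serves \<open>F\<close>, and 1/2 the coercivity of V. The factor s t of the trace estimate divides
  out, so the bound does not degenerate for a thin liquid layer.\<close>

lemma q_u0_bound:
  assumes t: "0 < t" and p: "0 < p"
  shows "2 * (q t * u 0 t) \<le> p * Eu t + sr / p * (q t)\<^sup>2"
proof -
  have s: "0 < s t" using s_pos t by simp
  have "0 \<le> (p * u 0 t - s t * q t)\<^sup>2"
    by simp
  then have "2 * (q t * u 0 t) * (p * s t) \<le> p\<^sup>2 * (u 0 t)\<^sup>2 + (s t)\<^sup>2 * (q t)\<^sup>2"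
    by (simp add: power2_eq_square algebra_simps)
  also have "\<dots> \<le> p\<^sup>2 * (s t * Eu t) + s t * sr * (q t)\<^sup>2"
    using u0_bound[OF t] s_le_sr[of t] s t
    by (intro add_mono mult_left_mono mult_right_mono) (auto simp: power2_eq_square)
  also have "\<dots> = (p * Eu t + sr / p * (q t)\<^sup>2) * (p * s t)"
    using p by (simp add: field_simps power2_eq_square)
  finally show ?thesis
    using p s by (simp add: mult_le_cancel_right)
qed

text \<open>The heating enters as q u(0), and splitting it with weight 1 leaves half of the
  dissipation. That half also outweighs the \<alpha>/2 \<open>Eu\<close> by which F may
  grow.\<close>

lemma DERIV_Lu:
  assumes t: "0 < t"
  shows "\<exists>d. (Lu has_real_derivative d) (at t) \<and> d \<le> - \<alpha> * Eu t + \<alpha> * sr * (q t)\<^sup>2"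
proof -
  have deriv: "(Lu has_real_derivative integral {0..s t} (\<lambda>x. ut x t * u x t + ut x t * u x t)) (at t)"
    using DERIV_integral_moving[OF C1_wet_mult[OF u_C1 u_C1] t] u_bc[OF t]
    unfolding Lu_def[abs_def] by (simp add: power2_eq_square)
  have "((\<lambda>x. ux x t * ux x t + u x t * uxx x t) has_integral u (s t) t * ux (s t) t - u 0 t * ux 0 t) {0..s t}"
    using s_pos[of t] t
    by (intro real_fundamental_theorem_of_calculus)
      (auto intro!: derivative_eq_intros C1_wetD(4)[OF u_C1] ux_deriv simp: mem_wet_region)
  moreover have "((\<lambda>x. (ux x t)\<^sup>2) has_integral Eu t) {0..s t}"
    unfolding Eu_def
    by (intro integrable_integral integrable_continuous_interval continuous_intros wet_section[OF t]
        C1_wetD(2)[OF u_C1])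
  ultimately have H: "((\<lambda>x. (2 * \<alpha>) * ((ux x t * ux x t + u x t * uxx x t) - (ux x t)\<^sup>2)) has_integral
      (2 * \<alpha>) * ((u (s t) t * ux (s t) t - u 0 t * ux 0 t) - Eu t)) {0..s t}"
    by (intro has_integral_mult_right has_integral_diff)
  have "integral {0..s t} (\<lambda>x. ut x t * u x t + ut x t * u x t)
      = integral {0..s t} (\<lambda>x. (2 * \<alpha>) * ((ux x t * ux x t + u x t * uxx x t) - (ux x t)\<^sup>2))"
    by (rule integral_cong) (use t in \<open>simp add: u_pde mem_wet_region power2_eq_square algebra_simps\<close>)
  also have "\<dots> = 2 * \<alpha> * (q t * u 0 t - Eu t)"
    unfolding integral_unique[OF H] using u_bc[OF t] ux_q[OF t] by (simp add: algebra_simps)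
  also have "\<dots> = \<alpha> * (2 * (q t * u 0 t)) - 2 * \<alpha> * Eu t"
    by (simp add: algebra_simps)
  also have "\<dots> \<le> \<alpha> * (1 * Eu t + sr / 1 * (q t)\<^sup>2) - 2 * \<alpha> * Eu t"
    using q_u0_bound[OF t, of 1] \<alpha> by (intro diff_right_mono mult_left_mono) auto
  also have "\<dots> = - \<alpha> * Eu t + \<alpha> * sr * (q t)\<^sup>2"
    by (simp add: algebra_simps)
  finally show ?thesis
    using deriv by blast
qed

text \<open>Subtracting \<open>2 q u(0)\<close> removes the uncontrolled \<open>q u\<^sub>t(0)\<close>; what the product rule
  leaves of \<open>q'\<close> has a favourable sign since \<open>g\<close> and \<open>u(0)\<close> are nonnegative.\<close>

definition F :: "real \<Rightarrow> real" where "F t = Eu t - 2 * (q t * u 0 t)"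

lemma DERIV_F:
  assumes t: "0 < t"
  shows "\<exists>d. (F has_real_derivative d) (at t) \<and> d \<le> \<alpha> / 2 * Eu t + 2 * c\<^sup>2 * sr / \<alpha> * (q t)\<^sup>2"
proof -
  have u0: "0 \<le> u 0 t" using u_nonneg[of t 0] s_pos[of t] t by simp
  define A where "A = integral {0..s t} (\<lambda>x. uxx x t * ut x t)"
  define r where "r = c * (1 + gain_mass t) * g t"
  have "(Eu has_real_derivative - sdot t * (ux (s t) t)\<^sup>2 - 2 * ux 0 t * ut 0 t - 2 * A) (at t)"
    using DERIV_dirichlet_energy[OF u_C1 uxx_cont ux_deriv u_bc t] unfolding Eu_def[abs_def] A_def .
  moreover have "((\<lambda>r. u 0 r) has_real_derivative ut 0 t) (at t)"
    using s_pos[of t] t by (intro DERIV_time_interior[OF u_C1]) auto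
  ultimately have deriv: "(F has_real_derivative
      - sdot t * (ux (s t) t)\<^sup>2 - 2 * A + 2 * c * (q t * u 0 t) - 2 * (r * u 0 t)) (at t)"
    unfolding F_def[abs_def] using DERIV_q[OF t] ux_q[OF t]
    by (auto intro!: derivative_eq_intros simp: r_def algebra_simps)
  \<comment> \<open>Only the sign of the second-order dissipation of u is used; the decay of
    \<open>Eu\<close> is supplied by \<open>Lu\<close>.\<close>
  have "integral {0..s t} (\<lambda>x. uxx x t * ut x t) = integral {0..s t} (\<lambda>x. \<alpha> * (uxx x t)\<^sup>2)"
    by (rule integral_cong) (use t in \<open>simp add: u_pde mem_wet_region power2_eq_square\<close>)
  also have "0 \<le> \<dots>"
    using \<alpha> by (intro integral_nonneg integrable_continuous_interval continuous_intros
        wet_section[OF t uxx_cont]) auto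
  finally have "0 \<le> A" by (simp add: A_def)
  moreover have "0 \<le> sdot t * (ux (s t) t)\<^sup>2"
    using sdot_nonneg[OF t] by simp
  moreover have "0 \<le> r * u 0 t"
    using c gain_mass_nonneg[of t] interface_flux_nonneg[OF t] u0 t by (simp add: r_def)
  moreover have "c * (2 * (q t * u 0 t)) \<le> c * (\<alpha> / (2 * c) * Eu t + sr / (\<alpha> / (2 * c)) * (q t)\<^sup>2)"
    using q_u0_bound[OF t, of "\<alpha> / (2 * c)"] \<alpha> c by (intro mult_left_mono) auto
  moreover have "c * (\<alpha> / (2 * c) * Eu t + sr / (\<alpha> / (2 * c)) * (q t)\<^sup>2)
      = \<alpha> / 2 * Eu t + 2 * c\<^sup>2 * sr / \<alpha> * (q t)\<^sup>2"
    using c \<alpha> by (simp add: field_simps power2_eq_square)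
  ultimately have "- sdot t * (ux (s t) t)\<^sup>2 - 2 * A + 2 * c * (q t * u 0 t) - 2 * (r * u 0 t)
      \<le> \<alpha> / 2 * Eu t + 2 * c\<^sup>2 * sr / \<alpha> * (q t)\<^sup>2"
    by simp
  then show ?thesis
    using deriv by blast
qed

definition V :: "real \<Rightarrow> real" where
  "V t = Ee t + F t + Lu t + K * (M t)\<^sup>2"

lemma K_pos: "0 < K"
  using K(1) B_pos by simp

text \<open>Poincare's inequality for \<open>ex\<close>, whose zero is the insulated end x =
  0.\<close>

lemma Ee_le:
  assumes t: "0 < t"
  shows "Ee t \<le> sr\<^sup>2 * Ae t"
proof -
  have "Ee t \<le> (s t)\<^sup>2 * Ae t"
    unfolding Ee_def Ae_def
    by (rule poincare[where p = 0])
      (use t s_pos[of t] e_flux[OF t] in \<open>auto intro!: ex_deriv wet_section exx_cont simp: mem_wet_region\<close>)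
  also have "\<dots> \<le> sr\<^sup>2 * Ae t"
  proof (intro mult_right_mono power_mono)
    show "0 \<le> Ae t"
      unfolding Ae_def
      by (intro integral_nonneg integrable_continuous_interval continuous_intros wet_section[OF t exx_cont]) simp
  qed (use s_le_sr[of t] s_pos[of t] t in auto)
  finally show ?thesis .
qed

lemma E_nonneg:
  assumes t: "0 < t"
  shows "0 \<le> Ee t" "0 \<le> Eu t"
  unfolding Ee_def Eu_def
  by (intro integral_nonneg integrable_continuous_interval continuous_intros wet_section[OF t]
      C1_wetD(2)[OF e_C1] C1_wetD(2)[OF u_C1]; simp)+

lemma Lu_le:
  assumes t: "0 < t"
  shows "Lu t \<le> sr\<^sup>2 * Eu t"
proof -
  have "Lu t \<le> (s t)\<^sup>2 * Eu t"
    unfolding Lu_def Eu_def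
    by (rule poincare[where p = "s t"])
      (use t s_pos[of t] u_bc[OF t] in \<open>auto intro!: C1_wetD(4)[OF u_C1] wet_section C1_wetD(2)[OF u_C1]\<close>)
  also have "\<dots> \<le> sr\<^sup>2 * Eu t"
    using s_le_sr[of t] s_pos[of t] t E_nonneg[OF t] by (intro mult_right_mono power_mono) auto
  finally show ?thesis .
qed

lemma Le_le:
  assumes t: "0 < t"
  shows "Le t \<le> sr\<^sup>2 * Ee t"
proof -
  have "Le t \<le> (s t)\<^sup>2 * Ee t"
    unfolding Le_def Ee_def
    by (rule poincare[where p = "s t"])
      (use t s_pos[of t] e_bc[OF t] in \<open>auto intro!: C1_wetD(4)[OF e_C1] wet_section C1_wetD(2)[OF e_C1]\<close>)
  also have "\<dots> \<le> sr\<^sup>2 * Ee t"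
    using s_le_sr[of t] s_pos[of t] t E_nonneg[OF t] by (intro mult_right_mono power_mono) auto
  finally show ?thesis .
qed

text \<open>What is left of the dissipation consists of \<open>Ae\<close>, \<open>Eu\<close> and the
  square of M; each upper bound on b compares one of them with its share of V.\<close>

lemma V_deriv:
  assumes t: "0 < t" and b: "0 < b" "b * sr\<^sup>2 \<le> 2 * \<alpha>" "b * (1 + sr\<^sup>2) \<le> \<alpha> / 2" "b \<le> m"
  shows "\<exists>d. (V has_real_derivative d) (at t) \<and> d \<le> - b * V t"
proof -
  obtain d1 where d1: "(Ee has_real_derivative d1) (at t)"
    "d1 \<le> - 2 * \<alpha> * Ae t + 4 * \<alpha> * B * (g t * M t)" using DERIV_Ee[OF t] by blast
  obtain d2 where d2: "(F has_real_derivative d2) (at t)"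
    "d2 \<le> \<alpha> / 2 * Eu t + 2 * c\<^sup>2 * sr / \<alpha> * (q t)\<^sup>2" using DERIV_F[OF t] by blast
  obtain d3 where d3: "(Lu has_real_derivative d3) (at t)"
    "d3 \<le> - \<alpha> * Eu t + \<alpha> * sr * (q t)\<^sup>2" using DERIV_Lu[OF t] by blast
  obtain d4 where d4: "(M has_real_derivative d4) (at t)"
    "d4 \<le> - m * M t - \<alpha> / 4 * g t" using DERIV_M[OF t] by blast
  have M0: "0 \<le> M t" using M_nonneg t by simp
  have g: "0 \<le> g t" by (rule interface_flux_nonneg[OF t])
  have "(V has_real_derivative d1 + d2 + d3 + K * (2 * M t * d4)) (at t)"
    unfolding V_def[abs_def] by (auto intro!: derivative_eq_intros d1(1) d2(1) d3(1) d4(1))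
  moreover have "d1 + d2 + d3 + K * (2 * M t * d4) \<le> - b * V t"
  proof -
    have "(2 * K * M t) * d4 \<le> (2 * K * M t) * (- m * M t - \<alpha> / 4 * g t)"
      using d4(2) M0 K_pos by (intro mult_left_mono) auto
    then have M_term: "K * (2 * M t * d4) \<le> - 2 * K * m * (M t)\<^sup>2 - \<alpha> / 2 * (K * (g t * M t))"
      by (simp add: power2_eq_square algebra_simps)
    have "8 * B * (g t * M t) \<le> K * (g t * M t)"
      using K(1) g M0 by (intro mult_right_mono) auto
    then have absorb: "4 * \<alpha> * B * (g t * M t) \<le> \<alpha> / 2 * (K * (g t * M t))"
      using mult_left_mono[of "8 * B * (g t * M t)" "K * (g t * M t)" "\<alpha> / 2"] \<alpha> by simp
    \<comment> \<open>The terms with q^2 from \<open>Lu\<close> and \<open>F\<close> use up half of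
      the decay 2 K m M^2.\<close>
    have "(\<alpha> * sr + 2 * c\<^sup>2 * sr / \<alpha>) * (q t)\<^sup>2 \<le> K * m * \<eta>\<^sup>2 * (q t)\<^sup>2"
      using K(2) by (intro mult_right_mono) auto
    also have "\<dots> = K * m * (\<eta> * q t)\<^sup>2"
      by (simp add: power_mult_distrib)
    also have "\<dots> \<le> K * m * (M t)\<^sup>2"
      using q_le_M[of t] t K_pos m by (intro mult_left_mono) auto
    finally have q_term: "\<alpha> * sr * (q t)\<^sup>2 + 2 * c\<^sup>2 * sr / \<alpha> * (q t)\<^sup>2 \<le> K * m * (M t)\<^sup>2"
      by (simp add: distrib_right)
    have "d1 + d2 + d3 + K * (2 * M t * d4) \<le> - 2 * \<alpha> * Ae t - \<alpha> / 2 * Eu t - K * m * (M t)\<^sup>2"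
      using d1(2) d2(2) d3(2) M_term absorb q_term by linarith
    moreover have "b * V t \<le> 2 * \<alpha> * Ae t + \<alpha> / 2 * Eu t + K * m * (M t)\<^sup>2"
    proof -
      have "0 \<le> q t * u 0 t"
        using q_nonneg[of t] u_nonneg[of t 0] s_pos[of t] t by simp
      then have "V t \<le> Ee t + Eu t + Lu t + K * (M t)\<^sup>2"
        unfolding V_def F_def by simp
      also have "\<dots> \<le> sr\<^sup>2 * Ae t + (1 + sr\<^sup>2) * Eu t + K * (M t)\<^sup>2"
        using Ee_le[OF t] Lu_le[OF t] by (simp add: distrib_right)
      finally have "b * V t \<le> b * (sr\<^sup>2 * Ae t + (1 + sr\<^sup>2) * Eu t + K * (M t)\<^sup>2)"
        using b(1) by (intro mult_left_mono) auto
      also have "\<dots> = (b * sr\<^sup>2) * Ae t + (b * (1 + sr\<^sup>2)) * Eu t + b * (K * (M t)\<^sup>2)"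
        by (simp add: algebra_simps)
      also have "\<dots> \<le> (2 * \<alpha>) * Ae t + (\<alpha> / 2) * Eu t + m * (K * (M t)\<^sup>2)"
      proof (intro add_mono mult_right_mono b(2) b(3) b(4))
        show "0 \<le> Ae t"
          unfolding Ae_def
          by (intro integral_nonneg integrable_continuous_interval continuous_intros wet_section[OF t exx_cont]) simp
      qed (use E_nonneg[OF t] K_pos in auto)
      finally show ?thesis
        by (simp add: mult_ac)
    qed
    ultimately show ?thesis by linarith
  qed
  ultimately show ?thesis by blast
qed

section \<open>Continuity up to t = 0 and equivalence with the stability norm\<close>

lemma energy_cont:
  fixes f :: "real \<Rightarrow> real \<Rightarrow> real"
  assumes f: "continuous_on (liquid_region s - {(0, 0)}) (\<lambda>(x, t). f x t)"
    and b: "\<And>\<tau>. bounded ((\<lambda>(x, t). f x t) ` {(x, t) \<in> liquid_region s. t \<le> \<tau>})"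
  shows "continuous_on {0..} (\<lambda>t. integral {0..s t} (\<lambda>x. (f x t)\<^sup>2))"
proof (rule continuous_on_integral_liquid[where f = "\<lambda>x t. (f x t)\<^sup>2"])
  show "continuous_on (liquid_region s - {(0, 0)}) (\<lambda>(x, t). (f x t)\<^sup>2)"
    using f by (auto simp: split_beta intro: continuous_intros)
  fix \<tau>
  obtain C where "\<And>x t. (x, t) \<in> liquid_region s \<Longrightarrow> t \<le> \<tau> \<Longrightarrow> \<bar>f x t\<bar> \<le> C"
    using b[of \<tau>] unfolding bounded_iff by auto
  then have "\<And>x t. (x, t) \<in> liquid_region s \<Longrightarrow> t \<le> \<tau> \<Longrightarrow> \<bar>(f x t)\<^sup>2\<bar> \<le> C\<^sup>2"
    by (metis abs_ge_zero abs_power2 power2_abs power_mono)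
  then show "bounded ((\<lambda>(x, t). (f x t)\<^sup>2) ` {(x, t) \<in> liquid_region s. t \<le> \<tau>})"
    unfolding bounded_iff by auto
qed

lemma V_cont: "continuous_on {0..} V"
proof -
  have "continuous_on (liquid_region s) (\<lambda>(x, t). (u x t)\<^sup>2)"
    using u_cont by (auto simp: split_beta intro: continuous_intros)
  then have "continuous_on {0..} Lu"
    unfolding Lu_def[abs_def] by (rule continuous_on_integral_liquid')
  moreover have "continuous_on (liquid_region s) (\<lambda>(x, t). cos (\<kappa> * x) * e x t)"
    using e_cont by (auto simp: split_beta intro!: continuous_intros)
  then have "continuous_on {0..} N"
    unfolding N_def[abs_def] by (intro continuous_on_minus continuous_on_integral_liquid')
  moreover have "continuous_on {0..} Ee" "continuous_on {0..} Eu"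
    unfolding Ee_def[abs_def] Eu_def[abs_def]
    by (rule energy_cont[OF ex_corner] energy_cont[OF ux_corner])+
  moreover have "continuous_on {0..} (\<lambda>t. u 0 t)"
    by (rule continuous_on_compose_pair[OF u_cont])
      (use s_pos in \<open>auto simp: liquid_region_def less_imp_le intro: continuous_intros\<close>)
  ultimately show ?thesis
    unfolding V_def[abs_def] F_def M_def by (intro continuous_intros q_cont)
qed

definition \<Phi> :: "real \<Rightarrow> real" where
  "\<Phi> t = Le t + Ee t + Lu t + Eu t + (s t - sr)\<^sup>2"

lemma integral_u_square: "0 \<le> t \<Longrightarrow> (integral {0..s t} (\<lambda>x. u x t))\<^sup>2 \<le> sr * Lu t"
  and integral_e_square: "0 \<le> t \<Longrightarrow> (integral {0..s t} (\<lambda>x. e x t))\<^sup>2 \<le> sr * Le t"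
proof -
  have *: "(integral {0..s t} h)\<^sup>2 \<le> sr * integral {0..s t} (\<lambda>x. (h x)\<^sup>2)"
    if "0 \<le> t" "continuous_on {0..s t} h" for h
  proof -
    have "(integral {0..s t} h)\<^sup>2 \<le> (s t - 0) * integral {0..s t} (\<lambda>x. (h x)\<^sup>2)"
      using s_pos[OF that(1)] that(2) by (intro integral_square_le) auto
    also have "\<dots> \<le> sr * integral {0..s t} (\<lambda>x. (h x)\<^sup>2)"
      using s_le_sr[OF that(1)] that(2)
      by (intro mult_right_mono integral_nonneg integrable_continuous_interval continuous_intros) auto
    finally show ?thesis .
  qed
  show "0 \<le> t \<Longrightarrow> (integral {0..s t} (\<lambda>x. u x t))\<^sup>2 \<le> sr * Lu t"
    unfolding Lu_def by (rule *[OF _ u_section])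
  show "0 \<le> t \<Longrightarrow> (integral {0..s t} (\<lambda>x. e x t))\<^sup>2 \<le> sr * Le t"
    unfolding Le_def by (rule *[OF _ e_section])
qed

lemma square_sum3: "(x + y + z)\<^sup>2 \<le> 3 * (x\<^sup>2 + y\<^sup>2 + z\<^sup>2)" for x y z :: real
proof -
  have "3 * (x\<^sup>2 + y\<^sup>2 + z\<^sup>2) - (x + y + z)\<^sup>2 = (x - y)\<^sup>2 + (y - z)\<^sup>2 + (x - z)\<^sup>2"
    by (simp add: power2_eq_square algebra_simps)
  then show ?thesis
    by (smt (verit) zero_le_power2)
qed

lemma q_expand:
  assumes "0 \<le> t"
  shows "q t = - (c / \<alpha>) * integral {0..s t} (\<lambda>x. u x t) + (c / \<alpha>) * integral {0..s t} (\<lambda>x. e x t)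
    - (c / \<beta>) * (s t - sr)"
proof -
  have "integral {0..s t} (\<lambda>x. u x t - e x t) = integral {0..s t} (\<lambda>x. u x t) - integral {0..s t} (\<lambda>x. e x t)"
    by (intro integral_diff integrable_continuous_interval u_section e_section assms)
  then show ?thesis
    unfolding q_def by (simp only:) (simp add: algebra_simps add_divide_distrib diff_divide_distrib)
qed

text \<open>The interface error does not occur in V. It is recovered by solving the control law for
  s - sr: M controls q and the integral of e, and \<open>Lu\<close> controls the integral of
  u.\<close>

lemma \<Phi>_le_V:
  assumes t: "0 < t"
  shows "\<Phi> t \<le> (sr\<^sup>2 + 4 + 3 * \<beta>\<^sup>2 * sr / \<alpha>\<^sup>2 + 2 / K * (3 * \<beta>\<^sup>2 / (c * \<eta>)\<^sup>2 + 12 * \<beta>\<^sup>2 / \<alpha>\<^sup>2)) * V t"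
proof -
  define X where "X = integral {0..s t} (\<lambda>x. u x t)"
  define Y where "Y = integral {0..s t} (\<lambda>x. e x t)"
  define C where "C = 3 * \<beta>\<^sup>2 / (c * \<eta>)\<^sup>2 + 12 * \<beta>\<^sup>2 / \<alpha>\<^sup>2"
  have t0: "0 \<le> t" using t by simp
  have C: "0 \<le> C" unfolding C_def by simp
  have M0: "0 \<le> M t" using M_nonneg t by simp
  have Lu0: "0 \<le> Lu t"
    unfolding Lu_def by (intro integral_nonneg integrable_continuous_interval continuous_intros u_section t0) simp
  \<comment> \<open>With weight 1/2 the indefinite term costs half of \<open>Eu\<close> and, by the
    last condition on \<open>K\<close>, at most half of K M^2.\<close>
  have lower: "Ee t + Eu t / 2 + Lu t + K / 2 * (M t)\<^sup>2 \<le> V t"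
  proof -
    have "4 * sr * (q t)\<^sup>2 \<le> K * \<eta>\<^sup>2 * (q t)\<^sup>2"
      using K(3) by (intro mult_right_mono) auto
    also have "\<dots> = K * (\<eta> * q t)\<^sup>2"
      by (simp add: power_mult_distrib)
    also have "\<dots> \<le> K * (M t)\<^sup>2"
      using q_le_M[OF t0] K_pos by (intro mult_left_mono) auto
    finally show ?thesis
      using q_u0_bound[OF t, of "1/2"] unfolding V_def F_def by simp
  qed
  have "s t - sr = - (\<beta> / c) * q t + - (\<beta> / \<alpha>) * X + (\<beta> / \<alpha>) * Y"
    using q_expand[OF t0] \<alpha> \<beta> c unfolding X_def[symmetric] Y_def[symmetric]
    by (simp add: field_simps)
  then have "(s t - sr)\<^sup>2 \<le> 3 * ((- (\<beta> / c) * q t)\<^sup>2 + (- (\<beta> / \<alpha>) * X)\<^sup>2 + ((\<beta> / \<alpha>) * Y)\<^sup>2)"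
    by (simp only: square_sum3)
  also have "\<dots> = 3 * (\<beta> / c)\<^sup>2 * (q t)\<^sup>2 + 3 * (\<beta> / \<alpha>)\<^sup>2 * X\<^sup>2 + 3 * (\<beta> / \<alpha>)\<^sup>2 * Y\<^sup>2"
    by (simp only: power_mult_distrib power2_minus distrib_left mult.assoc)
  also have "\<dots> \<le> 3 * (\<beta> / c)\<^sup>2 * ((M t)\<^sup>2 / \<eta>\<^sup>2) + 3 * (\<beta> / \<alpha>)\<^sup>2 * (sr * Lu t) + 3 * (\<beta> / \<alpha>)\<^sup>2 * (4 * (M t)\<^sup>2)"
  proof (intro add_mono mult_left_mono)
    show "(q t)\<^sup>2 \<le> (M t)\<^sup>2 / \<eta>\<^sup>2"
      using q_le_M[OF t0] \<eta>(1) by (simp add: power_mult_distrib field_simps)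
    show "X\<^sup>2 \<le> sr * Lu t"
      unfolding X_def by (rule integral_u_square[OF t0])
    have "L1 t \<le> 2 * M t"
      using L1_le_N[OF t0] N_le_M[OF t0] by simp
    then have "(L1 t)\<^sup>2 \<le> (2 * M t)\<^sup>2"
      using L1_nonneg[OF t0] by (intro power_mono) auto
    then show "Y\<^sup>2 \<le> 4 * (M t)\<^sup>2"
      by (simp add: L1_def Y_def power_mult_distrib)
  qed auto
  also have "\<dots> = 3 * \<beta>\<^sup>2 * sr / \<alpha>\<^sup>2 * Lu t + C * (M t)\<^sup>2"
    unfolding C_def using c \<eta>(1) \<alpha> by (simp add: field_simps power_mult_distrib)
  finally have s_bound: "(s t - sr)\<^sup>2 \<le> 3 * \<beta>\<^sup>2 * sr / \<alpha>\<^sup>2 * Lu t + C * (M t)\<^sup>2" .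
  have KM: "0 \<le> K / 2 * (M t)\<^sup>2" using K_pos by simp
  have parts: "Ee t \<le> V t" "Eu t \<le> 2 * V t" "Lu t \<le> V t" "(M t)\<^sup>2 \<le> 2 / K * V t" "0 \<le> V t"
  proof -
    show "Ee t \<le> V t" "Eu t \<le> 2 * V t" "Lu t \<le> V t" "0 \<le> V t"
      using lower E_nonneg[OF t] Lu0 KM by linarith+
    have "K / 2 * (M t)\<^sup>2 \<le> V t"
      using lower E_nonneg[OF t] Lu0 by linarith
    then show "(M t)\<^sup>2 \<le> 2 / K * V t"
      using K_pos by (simp add: field_simps)
  qed
  have "\<Phi> t \<le> (sr\<^sup>2 + 1) * Ee t + Eu t + (1 + 3 * \<beta>\<^sup>2 * sr / \<alpha>\<^sup>2) * Lu t + C * (M t)\<^sup>2"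
    using s_bound Le_le[OF t] unfolding \<Phi>_def by (simp add: distrib_right)
  also have "\<dots> \<le> (sr\<^sup>2 + 1) * V t + 2 * V t + (1 + 3 * \<beta>\<^sup>2 * sr / \<alpha>\<^sup>2) * V t + C * (2 / K * V t)"
    using parts C sr_pos by (intro add_mono mult_left_mono) auto
  also have "\<dots> = (sr\<^sup>2 + 4 + 3 * \<beta>\<^sup>2 * sr / \<alpha>\<^sup>2 + 2 / K * C) * V t"
    by (simp add: algebra_simps)
  finally show ?thesis
    unfolding C_def .
qed

text \<open>The case t = 0 is included, where the fluxes may jump at the corner; the argument avoids
  integrability, since an integral that does not exist is 0 by convention.\<close>

lemma norms_nonneg:
  assumes "0 \<le> t"
  shows "0 \<le> Ee t" "0 \<le> Eu t" "0 \<le> Le t" "0 \<le> Lu t"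
proof -
  have *: "0 \<le> integral S (\<lambda>x. (f x)\<^sup>2)" for S and f :: "real \<Rightarrow> real"
    by (cases "(\<lambda>x. (f x)\<^sup>2) integrable_on S") (auto intro: integral_nonneg simp: not_integrable_integral)
  show "0 \<le> Ee t" "0 \<le> Eu t" "0 \<le> Le t" "0 \<le> Lu t"
    unfolding Ee_def Eu_def Le_def Lu_def by (rule *)+
qed

text \<open>The term - 2 q u(0) is dropped by sign, so no trace estimate is needed at the initial
  time, where the flux may be discontinuous. M is bounded through the law for q and Cauchy-Schwarz
  for the mass of e.\<close>

lemma V_init_le:
  "V 0 \<le> (1 + K * (2 * sr + 6 * (\<eta> * c)\<^sup>2 * (2 * sr / \<alpha>\<^sup>2 + 1 / \<beta>\<^sup>2))) * \<Phi> 0"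
proof -
  define X where "X = integral {0..s 0} (\<lambda>x. u x 0)"
  define Y where "Y = integral {0..s 0} (\<lambda>x. e x 0)"
  note nn = norms_nonneg[OF order_refl]
  have \<Phi>_parts: "Le 0 \<le> \<Phi> 0" "Lu 0 \<le> \<Phi> 0" "(s 0 - sr)\<^sup>2 \<le> \<Phi> 0" "Ee 0 + Eu 0 + Lu 0 \<le> \<Phi> 0" "0 \<le> \<Phi> 0"
    using nn unfolding \<Phi>_def by (auto intro: add_nonneg_nonneg)
  have X2: "X\<^sup>2 \<le> sr * \<Phi> 0" and Y2: "Y\<^sup>2 \<le> sr * \<Phi> 0"
    using order_trans[OF integral_u_square mult_left_mono[OF \<Phi>_parts(2), of sr]]
      order_trans[OF integral_e_square mult_left_mono[OF \<Phi>_parts(1), of sr]] sr_pos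
    unfolding X_def Y_def by simp_all
  have "q 0 = - (c / \<alpha>) * X + (c / \<alpha>) * Y + - (c / \<beta>) * (s 0 - sr)"
    using q_expand[of 0] unfolding X_def Y_def by simp
  then have "(q 0)\<^sup>2 \<le> 3 * ((- (c / \<alpha>) * X)\<^sup>2 + ((c / \<alpha>) * Y)\<^sup>2 + (- (c / \<beta>) * (s 0 - sr))\<^sup>2)"
    by (simp only: square_sum3)
  also have "\<dots> = 3 * ((c / \<alpha>)\<^sup>2 * X\<^sup>2 + (c / \<alpha>)\<^sup>2 * Y\<^sup>2 + (c / \<beta>)\<^sup>2 * (s 0 - sr)\<^sup>2)"
    by (simp only: power_mult_distrib power2_minus)
  also have "\<dots> \<le> 3 * ((c / \<alpha>)\<^sup>2 * (sr * \<Phi> 0) + (c / \<alpha>)\<^sup>2 * (sr * \<Phi> 0) + (c / \<beta>)\<^sup>2 * \<Phi> 0)"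
    using X2 Y2 \<Phi>_parts(3) by (intro mult_left_mono add_mono) auto
  also have "\<dots> = 3 * c\<^sup>2 * (2 * sr / \<alpha>\<^sup>2 + 1 / \<beta>\<^sup>2) * \<Phi> 0"
    by (simp add: power_divide algebra_simps)
  finally have q2: "(q 0)\<^sup>2 \<le> 3 * c\<^sup>2 * (2 * sr / \<alpha>\<^sup>2 + 1 / \<beta>\<^sup>2) * \<Phi> 0" .
  have "(N 0)\<^sup>2 \<le> (L1 0)\<^sup>2"
    using N_nonneg[of 0] N_le_L1[of 0] by (intro power_mono) auto
  also have "\<dots> \<le> sr * \<Phi> 0"
    using Y2 by (simp add: L1_def Y_def)
  finally have N2: "(N 0)\<^sup>2 \<le> sr * \<Phi> 0" .
  have "(M 0)\<^sup>2 \<le> 2 * (N 0)\<^sup>2 + 2 * \<eta>\<^sup>2 * (q 0)\<^sup>2"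
  proof -
    have "2 * (N 0)\<^sup>2 + 2 * \<eta>\<^sup>2 * (q 0)\<^sup>2 - (M 0)\<^sup>2 = (N 0 - \<eta> * q 0)\<^sup>2"
      by (simp add: M_def power2_eq_square algebra_simps)
    then show ?thesis
      by (smt (verit) zero_le_power2)
  qed
  also have "\<dots> \<le> 2 * (sr * \<Phi> 0) + 2 * \<eta>\<^sup>2 * (3 * c\<^sup>2 * (2 * sr / \<alpha>\<^sup>2 + 1 / \<beta>\<^sup>2) * \<Phi> 0)"
    using N2 q2 by (intro add_mono mult_left_mono) auto
  also have "\<dots> = (2 * sr + 6 * (\<eta> * c)\<^sup>2 * (2 * sr / \<alpha>\<^sup>2 + 1 / \<beta>\<^sup>2)) * \<Phi> 0"
    by (simp add: power_mult_distrib algebra_simps)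
  finally have M2: "K * (M 0)\<^sup>2 \<le> K * ((2 * sr + 6 * (\<eta> * c)\<^sup>2 * (2 * sr / \<alpha>\<^sup>2 + 1 / \<beta>\<^sup>2)) * \<Phi> 0)"
    using K_pos by (intro mult_left_mono) auto
  have "0 \<le> q 0 * u 0 0"
    using q_nonneg[of 0] u_nonneg[of 0 0] s_pos[of 0] by simp
  then have "V 0 \<le> Ee 0 + Eu 0 + Lu 0 + K * (M 0)\<^sup>2"
    unfolding V_def F_def by simp
  also have "\<dots> \<le> \<Phi> 0 + K * ((2 * sr + 6 * (\<eta> * c)\<^sup>2 * (2 * sr / \<alpha>\<^sup>2 + 1 / \<beta>\<^sup>2)) * \<Phi> 0)"
    using \<Phi>_parts(4) M2 by (rule add_mono)
  also have "\<dots> = (1 + K * (2 * sr + 6 * (\<eta> * c)\<^sup>2 * (2 * sr / \<alpha>\<^sup>2 + 1 / \<beta>\<^sup>2))) * \<Phi> 0"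
    by (simp only: distrib_right mult.assoc mult_1)
  finally show ?thesis .
qed

lemma \<Phi>_decay:
  assumes t: "0 \<le> t" and b: "0 < b" "b * sr\<^sup>2 \<le> 2 * \<alpha>" "b * (1 + sr\<^sup>2) \<le> \<alpha> / 2" "b \<le> m"
  shows "\<Phi> t \<le> (sr\<^sup>2 + 4 + 3 * \<beta>\<^sup>2 * sr / \<alpha>\<^sup>2 + 2 / K * (3 * \<beta>\<^sup>2 / (c * \<eta>)\<^sup>2 + 12 * \<beta>\<^sup>2 / \<alpha>\<^sup>2))
    * (1 + K * (2 * sr + 6 * (\<eta> * c)\<^sup>2 * (2 * sr / \<alpha>\<^sup>2 + 1 / \<beta>\<^sup>2))) * \<Phi> 0 * exp (- b * t)"
    (is "_ \<le> ?C1 * ?C2 * _ * _")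
proof (cases "t = 0")
  \<comment> \<open>\<open>\<Phi>_le_V\<close> is available for t > 0 only; at t = 0 it suffices
    that both constants are at least 1.\<close>
  case True
  have "1 \<le> ?C1"
  proof -
    have "0 \<le> sr\<^sup>2" "0 \<le> 3 * \<beta>\<^sup>2 * sr / \<alpha>\<^sup>2" "0 \<le> 2 / K * (3 * \<beta>\<^sup>2 / (c * \<eta>)\<^sup>2 + 12 * \<beta>\<^sup>2 / \<alpha>\<^sup>2)"
      using sr_pos K_pos by auto
    then show ?thesis by linarith
  qed
  moreover have "1 \<le> ?C2"
    using sr_pos K_pos by simp
  ultimately have "1 * 1 \<le> ?C1 * ?C2"
    by (intro mult_mono) auto
  moreover have "0 \<le> \<Phi> 0"
    using norms_nonneg[of 0] unfolding \<Phi>_def by simp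
  ultimately have "1 * \<Phi> 0 \<le> ?C1 * ?C2 * \<Phi> 0"
    by (intro mult_right_mono) auto
  then show ?thesis
    using True by simp
next
  case False
  then have t': "0 < t" using t by simp
  have C1: "0 \<le> ?C1"
    using sr_pos K_pos by (auto intro!: add_nonneg_nonneg)
  have "\<Phi> t \<le> ?C1 * V t"
    by (rule \<Phi>_le_V[OF t'])
  also have "\<dots> \<le> ?C1 * (V 0 * exp (- b * t))"
    by (intro mult_left_mono C1 exponential_decay[OF V_cont _ t] V_deriv b)
  also have "\<dots> \<le> ?C1 * ((?C2 * \<Phi> 0) * exp (- b * t))"
    by (intro mult_left_mono mult_right_mono V_init_le C1) auto
  finally show ?thesis
    by (simp only: mult.assoc)
qed

end

section \<open>Exponential stability\<close>

lemma classical_regularityD: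
  assumes "classical_regularity s v vx vxx vt"
  shows "continuous_on (liquid_region s) (\<lambda>(x, t). v x t)"
    and "continuous_on (liquid_region s - {(0, 0)}) (\<lambda>(x, t). vx x t)"
    and "bounded ((\<lambda>(x, t). vx x t) ` {(x, t) \<in> liquid_region s. t \<le> \<tau>})"
    and "continuous_on (wet_region s) (\<lambda>(x, t). vxx x t)"
    and "0 \<le> t \<Longrightarrow> 0 < x \<Longrightarrow> x < s t \<Longrightarrow> ((\<lambda>y. v y t) has_real_derivative vx x t) (at x)"
    and "(x, t) \<in> wet_region s \<Longrightarrow> ((\<lambda>y. vx y t) has_real_derivative vxx x t) (at x within {0..s t})"
    and "C1_wet s v vx vt"
proof -
  note reg = assms[unfolded classical_regularity_def wet_region_def[symmetric]]
  show "continuous_on (liquid_region s) (\<lambda>(x, t). v x t)"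
    "continuous_on (liquid_region s - {(0, 0)}) (\<lambda>(x, t). vx x t)"
    "bounded ((\<lambda>(x, t). vx x t) ` {(x, t) \<in> liquid_region s. t \<le> \<tau>})"
    "continuous_on (wet_region s) (\<lambda>(x, t). vxx x t)"
    using reg by blast+
  show "((\<lambda>y. v y t) has_real_derivative vx x t) (at x)" if "0 \<le> t" "0 < x" "x < s t"
  proof -
    have "(x, t) \<in> liquid_region s - {(0, 0)}"
      using that by (auto simp: liquid_region_def)
    then have "((\<lambda>y. v y t) has_real_derivative vx x t) (at x within {0..s t})"
      using reg by blast
    then show ?thesis
      using that by (simp add: at_within_Icc_at)
  qed
  show "((\<lambda>y. vx y t) has_real_derivative vxx x t) (at x within {0..s t})" if "(x, t) \<in> wet_region s"
    using reg that by (auto simp: wet_region_def)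
  have sub: "wet_region s \<subseteq> liquid_region s - {(0, 0)}"
    by (auto simp: wet_region_def)
  show "C1_wet s v vx vt"
    unfolding C1_wet_def
  proof (intro conjI allI impI)
    show "continuous_on (wet_region s) (\<lambda>(x, t). v x t)" "continuous_on (wet_region s) (\<lambda>(x, t). vx x t)"
      "continuous_on (wet_region s) (\<lambda>(x, t). vt x t)"
      using reg continuous_on_subset sub by blast+
    fix x t assume xt: "(x, t) \<in> wet_region s"
    then have "(x, t) \<in> liquid_region s - {(0, 0)}"
      using sub by blast
    then show "((\<lambda>y. v y t) has_real_derivative vx x t) (at x within {0..s t})"
      using reg by blast
    show "((\<lambda>r. v x r) has_real_derivative vt x t) (at t within {r. (x, r) \<in> liquid_region s})"
      using reg xt by (auto simp: wet_region_def)
  qed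
qed

lemma H1_norm_sq_eq:
  assumes "\<And>x. 0 < x \<Longrightarrow> x < l \<Longrightarrow> (f has_real_derivative f' x) (at x)"
  shows "H1_norm_sq l f = integral {0..l} (\<lambda>x. (f x)\<^sup>2) + integral {0..l} (\<lambda>x. (f' x)\<^sup>2)"
proof -
  have "integral {0..l} (\<lambda>x. (deriv f x)\<^sup>2) = integral {0..l} (\<lambda>x. (f' x)\<^sup>2)"
  proof (rule integral_spike[of "{0, l}"])
    show "(f' x)\<^sup>2 = (deriv f x)\<^sup>2" if "x \<in> {0..l} - {0, l}" for x
      using DERIV_imp_deriv[OF assms, of x] that by simp
  qed simp
  then show ?thesis
    by (simp add: H1_norm_sq_def L2_norm_sq_def)
qed

theorem theorem4:
  fixes \<alpha> \<beta> k c Tm lam sr :: real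
  assumes "\<alpha> > 0" "\<beta> > 0" "k > 0" "c > 0" "lam > 0"
  shows "\<exists>D>0. \<exists>b>0. \<forall>H Hl Hu s0 T0 That0 T s That.
    s0 > 0 \<and>
    compatible_with_control \<alpha> \<beta> k c Tm sr That0 s0 \<and>
    (\<forall>x\<in>{0..s0}. 0 \<le> T0 x - Tm \<and> T0 x - Tm \<le> H * (s0 - x)) \<and>
    Hu \<ge> Hl \<and> Hl > H \<and>
    (\<forall>x\<in>{0..s0}. Tm + Hl * (s0 - x) \<le> That0 x \<and> That0 x \<le> Tm + Hu * (s0 - x)) \<and>
    lam < 4 * \<alpha> / s0\<^sup>2 * ((Hl - H) / Hu) \<and>
    sr > s0 + \<beta> * s0\<^sup>2 / (2 * \<alpha>) * Hu \<and>
    closed_loop_solution \<alpha> \<beta> k c Tm lam sr T0 s0 That0 T s That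
    \<longrightarrow> (\<forall>t\<ge>0. stability_norm Tm sr T s That t
              \<le> D * stability_norm Tm sr T s That 0 * exp (- b * t))"
proof -
  \<comment> \<open>The constants precede the initial data, and only the latter force sr > 0. For sr
    \<le> 0 no data are admissible, and 1 is a dummy value.\<close>
  define sr' where "sr' = (if 0 < sr then sr else 1)"
  have sr': "0 < sr'" by (simp add: sr'_def)
  obtain B where B: "0 < B" "\<And>x y. x \<in> {0..sr'} \<Longrightarrow> y \<in> {0..sr'} \<Longrightarrow>
      bs_kernel (lam / \<alpha>) x y \<le> B \<and> \<bar>bs_kernel_xx (lam / \<alpha>) x y\<bar> \<le> B"
    using bs_kernel_bounded[of sr' "lam / \<alpha>"] by blast
  define \<eta> where "\<eta> = \<alpha> / (4 * c * (1 + sr' * B))"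
  define m where "m = min (\<alpha> * (pi / (3 * sr'))\<^sup>2) c"
  \<comment> \<open>The sum of the three lower bounds required of \<open>K\<close>, each given by
    the parameters and the setpoint alone.\<close>
  define K where "K = 8 * B + (\<alpha> * sr' + 2 * c\<^sup>2 * sr' / \<alpha>) / (m * \<eta>\<^sup>2) + 4 * sr' / \<eta>\<^sup>2"
  define b where "b = min (min (2 * \<alpha> / sr'\<^sup>2) (\<alpha> / 2 / (1 + sr'\<^sup>2))) m"
  define D where "D = (sr'\<^sup>2 + 4 + 3 * \<beta>\<^sup>2 * sr' / \<alpha>\<^sup>2 + 2 / K * (3 * \<beta>\<^sup>2 / (c * \<eta>)\<^sup>2 + 12 * \<beta>\<^sup>2 / \<alpha>\<^sup>2))
    * (1 + K * (2 * sr' + 6 * (\<eta> * c)\<^sup>2 * (2 * sr' / \<alpha>\<^sup>2 + 1 / \<beta>\<^sup>2)))"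
  have pos: "0 < 1 + sr' * B"
    using sr' B(1) by (simp add: add_pos_pos)
  have \<eta>: "0 < \<eta>" "\<eta> * c * (1 + sr' * B) \<le> \<alpha> / 4"
  proof -
    define p where "p = 1 + sr' * B"
    have "0 < p" using pos by (simp add: p_def)
    then show "0 < \<eta>" "\<eta> * c * (1 + sr' * B) \<le> \<alpha> / 4"
      using assms unfolding \<eta>_def p_def[symmetric] by simp_all
  qed
  have m: "0 < m" "m \<le> \<alpha> * (pi / (3 * sr'))\<^sup>2" "m \<le> c"
    using assms sr' by (simp_all add: m_def)
  have nonneg: "0 \<le> (\<alpha> * sr' + 2 * c\<^sup>2 * sr' / \<alpha>) / (m * \<eta>\<^sup>2)" "0 \<le> 4 * sr' / \<eta>\<^sup>2"
    using assms sr' m(1) by simp_all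
  have K: "8 * B \<le> K" "\<alpha> * sr' + 2 * c\<^sup>2 * sr' / \<alpha> \<le> K * m * \<eta>\<^sup>2" "4 * sr' \<le> K * \<eta>\<^sup>2"
  proof -
    show "8 * B \<le> K" using nonneg by (simp add: K_def)
    have "(\<alpha> * sr' + 2 * c\<^sup>2 * sr' / \<alpha>) / (m * \<eta>\<^sup>2) \<le> K" "4 * sr' / \<eta>\<^sup>2 \<le> K"
      using nonneg B(1) by (simp_all add: K_def)
    then show "\<alpha> * sr' + 2 * c\<^sup>2 * sr' / \<alpha> \<le> K * m * \<eta>\<^sup>2" "4 * sr' \<le> K * \<eta>\<^sup>2"
      using m(1) \<eta>(1) by (simp_all add: pos_divide_le_eq mult.assoc)
  qed
  have b: "0 < b" "b * sr'\<^sup>2 \<le> 2 * \<alpha>" "b * (1 + sr'\<^sup>2) \<le> \<alpha> / 2" "b \<le> m"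
  proof -
    have pos': "0 < 1 + sr'\<^sup>2" by (simp add: add_pos_nonneg)
    show "0 < b" using assms sr' m(1) pos' by (simp add: b_def)
    have "b \<le> 2 * \<alpha> / sr'\<^sup>2" "b \<le> \<alpha> / 2 / (1 + sr'\<^sup>2)" by (simp_all add: b_def)
    then show "b * sr'\<^sup>2 \<le> 2 * \<alpha>" "b * (1 + sr'\<^sup>2) \<le> \<alpha> / 2"
      using sr' unfolding pos_le_divide_eq[OF pos'] by (simp_all only: pos_le_divide_eq zero_less_power)
    show "b \<le> m" by (simp add: b_def)
  qed
  have "0 < K" using K(1) B(1) by simp
  then have D: "0 < D"
    unfolding D_def using sr' by (intro mult_pos_pos add_pos_nonneg) (auto intro: add_nonneg_pos)
  have main: "stability_norm Tm sr T s That t \<le> D * stability_norm Tm sr T s That 0 * exp (- b * t)"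
    if s0: "s0 > 0"
      and T0: "\<forall>x\<in>{0..s0}. 0 \<le> T0 x - Tm \<and> T0 x - Tm \<le> H * (s0 - x)"
      and HuHl: "Hu \<ge> Hl" and HlH: "Hl > H"
      and That0: "\<forall>x\<in>{0..s0}. Tm + Hl * (s0 - x) \<le> That0 x \<and> That0 x \<le> Tm + Hu * (s0 - x)"
      and lam: "lam < 4 * \<alpha> / s0\<^sup>2 * ((Hl - H) / Hu)"
      and setpoint: "sr > s0 + \<beta> * s0\<^sup>2 / (2 * \<alpha>) * Hu"
      and sol: "closed_loop_solution \<alpha> \<beta> k c Tm lam sr T0 s0 That0 T s That"
      and t: "t \<ge> 0"
    for H Hl Hu s0 :: real and T0 That0 s :: "real \<Rightarrow> real" and T That :: "real \<Rightarrow> real \<Rightarrow> real" and t :: real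
  proof -
    \<comment> \<open>The plant bounds at x = 0 give H \<ge> 0, hence Hu \<ge> Hl > H \<ge>
      0.\<close>
    have "0 \<le> H * s0"
      using T0[rule_format, of 0] s0 by simp
    then have Hu: "0 < Hu"
      using s0 HlH HuHl by (simp add: zero_le_mult_iff)
    then have "0 < s0 + \<beta> * s0\<^sup>2 / (2 * \<alpha>) * Hu"
      using s0 assms by (simp add: add_pos_pos)
    then have sr: "sr' = sr"
      using setpoint by (simp add: sr'_def)
    from sol[unfolded closed_loop_solution_def] obtain Tx Txx Tt Thx Thxx Tht sdot where
      regT: "classical_regularity s T Tx Txx Tt" and regTh: "classical_regularity s That Thx Thxx Tht"
      and s_cont: "continuous_on {0..} s" and s_pos: "\<forall>t\<ge>0. s t > 0"
      and s_deriv: "\<forall>t>0. (s has_real_derivative sdot t) (at t)" and s_0: "s 0 = s0"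
      and init: "\<forall>x\<in>{0..s0}. T x 0 = T0 x \<and> That x 0 = That0 x"
      and eqs: "\<forall>t>0.
           (\<forall>x\<in>{0..s t}. Tt x t = \<alpha> * Txx x t) \<and>
           - k * Tx 0 t = control_law \<alpha> \<beta> k c Tm sr (\<lambda>x. That x t) (s t) \<and>
           T (s t) t = Tm \<and>
           sdot t = - \<beta> * Tx (s t) t \<and>
           (\<forall>x\<in>{0..s t}. Tht x t =
              \<alpha> * Thxx x t - observer_gain \<alpha> lam x (s t) * (sdot t / \<beta> + Thx (s t) t)) \<and>
           - k * Thx 0 t = control_law \<alpha> \<beta> k c Tm sr (\<lambda>x. That x t) (s t) \<and>
           That (s t) t = Tm"
      by (elim exE conjE) (rule that; assumption)
    have heatT: "Tt x t = \<alpha> * Txx x t"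
      and heatTh: "Tht x t = \<alpha> * Thxx x t - observer_gain \<alpha> lam x (s t) * (sdot t / \<beta> + Thx (s t) t)"
      if "0 < t" "x \<in> {0..s t}" for x t
      using eqs that by blast+
    have fluxT: "- k * Tx 0 t = control_law \<alpha> \<beta> k c Tm sr (\<lambda>x. That x t) (s t)"
      and bcT: "T (s t) t = Tm" and stefan: "sdot t = - \<beta> * Tx (s t) t"
      and fluxTh: "- k * Thx 0 t = control_law \<alpha> \<beta> k c Tm sr (\<lambda>x. That x t) (s t)"
      and bcTh: "That (s t) t = Tm"
      if "0 < t" for t
      using eqs that by blast+
    note rT = classical_regularityD[OF regT] and rTh = classical_regularityD[OF regTh]
    have const_C1: "C1_wet s (\<lambda>x t. Tm) (\<lambda>x t. 0) (\<lambda>x t. 0)"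
      by (rule C1_wet_space) (auto intro: continuous_intros)
    interpret closed_loop s sdot \<alpha> lam "\<lambda>x t. T x t - That x t" "\<lambda>x t. Tx x t - Thx x t"
      "\<lambda>x t. Txx x t - Thxx x t" "\<lambda>x t. Tt x t - Tht x t" "Hl - H" Hu \<beta> c sr B \<eta> m K
      "\<lambda>x t. T x t - Tm" Tx Txx Tt
    proof
      show "continuous_on {0..} s" by fact
      show "0 < s t" if "0 \<le> t" for t using s_pos that by blast
      show "(s has_real_derivative sdot t) (at t)" if "0 < t" for t using s_deriv that by blast
      \<comment> \<open>The speed inherits its continuity from the flux through the Stefan
        condition.\<close>
      have "continuous_on {0<..} (\<lambda>t. - \<beta> * Tx (s t) t)"
        by (intro continuous_intros continuous_on_compose_pair[OF rT(2)] continuous_on_subset[OF s_cont])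
          (auto simp: liquid_region_def less_imp_le s_pos)
      then show "continuous_on {0<..} sdot"
        by (rule continuous_on_eq) (use stefan in auto)
      show "0 < \<alpha>" "0 < lam" "0 < \<beta>" "0 < c" by fact+
      show "continuous_on (liquid_region s) (\<lambda>(x, t). T x t - That x t)"
        using rT(1) rTh(1) by (auto simp: split_beta intro: continuous_intros)
      show "C1_wet s (\<lambda>x t. T x t - That x t) (\<lambda>x t. Tx x t - Thx x t) (\<lambda>x t. Tt x t - Tht x t)"
        by (rule C1_wet_diff[OF rT(7) rTh(7)])
      show "continuous_on (wet_region s) (\<lambda>(x, t). Txx x t - Thxx x t)"
        using rT(4) rTh(4) by (auto simp: split_beta intro: continuous_intros)
      show "((\<lambda>y. Tx y t - Thx y t) has_real_derivative Txx x t - Thxx x t) (at x within {0..s t})"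
        if "(x, t) \<in> wet_region s" for x t
        using rT(6)[OF that] rTh(6)[OF that] by (rule DERIV_diff)
      show "Tt x t - Tht x t = \<alpha> * (Txx x t - Thxx x t)
          + \<alpha> * bs_kernel (lam / \<alpha>) x (s t) * (Tx (s t) t - Thx (s t) t)"
        if "(x, t) \<in> wet_region s" for x t
      proof -
        have xt: "0 < t" "0 \<le> x" "x \<le> s t" using that by (auto simp: mem_wet_region)
        have "sdot t / \<beta> = - Tx (s t) t"
          using stefan[OF xt(1)] assms by simp
        then show ?thesis
          using heatT[OF xt(1), of x] heatTh[OF xt(1), of x] xt
            observer_gain_eq[OF assms(1,5) xt(2,3)]
          by (simp add: algebra_simps)
      qed
      show "Tx 0 t - Thx 0 t = 0" if "0 < t" for t
        using trans[OF fluxT[OF that] fluxTh[OF that, symmetric]] assms(3) by simp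
      show "T (s t) t - That (s t) t = 0" if "0 < t" for t
        using bcT[OF that] bcTh[OF that] by simp
      \<comment> \<open>The lower bound pairs T0 \<ge> Tm with the upper envelope of the estimate,
        the upper bound pairs the constant H with its lower envelope.\<close>
      show "- Hu * (s 0 - x) \<le> T x 0 - That x 0 \<and> T x 0 - That x 0 \<le> - (Hl - H) * (s 0 - x)"
        if "0 \<le> x" "x \<le> s 0" for x
        using T0[rule_format, of x] That0[rule_format, of x] init[rule_format, of x] that s_0
        by (simp add: algebra_simps)
      show "0 \<le> Hl - H" using HlH by simp
      show "lam * (s 0)\<^sup>2 * Hu \<le> 4 * \<alpha> * (Hl - H)"
        using lam s0 Hu by (simp add: s_0 field_simps)
      show "continuous_on (liquid_region s) (\<lambda>(x, t). T x t - Tm)"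
        using rT(1) by (auto simp: split_beta intro: continuous_intros)
      show "C1_wet s (\<lambda>x t. T x t - Tm) Tx Tt"
        using C1_wet_diff[OF rT(7) const_C1] by simp
      show "continuous_on (wet_region s) (\<lambda>(x, t). Txx x t)" by (rule rT)
      show "((\<lambda>y. Tx y t) has_real_derivative Txx x t) (at x within {0..s t})"
        if "(x, t) \<in> wet_region s" for x t using that by (rule rT)
      show "Tt x t = \<alpha> * Txx x t" if "(x, t) \<in> wet_region s" for x t
        using heatT that by (auto simp: mem_wet_region)
      show "T (s t) t - Tm = 0" if "0 < t" for t
        using bcT[OF that] by simp
      show "Tx 0 t = c * (1 / \<alpha> * integral {0..s t} (\<lambda>x. T x t - Tm - (T x t - That x t))
          + 1 / \<beta> * (s t - sr))" if "0 < t" for t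
      proof -
        have "k * Tx 0 t = k * (c * (1 / \<alpha> * integral {0..s t} (\<lambda>x. That x t - Tm) + 1 / \<beta> * (s t - sr)))"
          using fluxT[OF that] unfolding control_law_def by (simp add: mult.left_commute)
        then show ?thesis
          using assms(3) by simp
      qed
      show "sdot t = - \<beta> * Tx (s t) t" if "0 < t" for t using stefan that .
      show "0 \<le> T x 0 - Tm" if "0 \<le> x" "x \<le> s 0" for x
        using T0 init that s_0 by simp
      \<comment> \<open>The estimated heat content is at most Hu s0^2 / 2, and the restriction on
        the setpoint says that this leaves the initial control nonnegative.\<close>
      show "1 / \<alpha> * integral {0..s 0} (\<lambda>x. T x 0 - Tm - (T x 0 - That x 0)) + 1 / \<beta> * (s 0 - sr) \<le> 0"
      proof -
        have cont: "continuous_on {0..s 0} (\<lambda>x. That x 0)"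
          by (rule continuous_on_compose_pair[OF rTh(1)]) (auto simp: liquid_region_def intro: continuous_intros)
        have "integral {0..s0} (\<lambda>x. That x 0 - Tm) \<le> integral {0..s0} (\<lambda>x. Hu * (s0 - x))"
          using That0 init cont[unfolded s_0]
          by (intro integral_le integrable_continuous_interval continuous_intros) (auto simp: algebra_simps)
        also have "((\<lambda>x. Hu * (s0 - x)) has_integral Hu * (s0 * s0 - s0\<^sup>2 / 2) - Hu * (s0 * 0 - 0\<^sup>2 / 2)) {0..s0}"
          using s0 by (intro real_fundamental_theorem_of_calculus)
            (auto intro!: derivative_eq_intros simp: algebra_simps)
        then have "integral {0..s0} (\<lambda>x. Hu * (s0 - x)) = Hu * s0\<^sup>2 / 2"
          by (simp add: integral_unique power2_eq_square field_simps)
        finally have "1 / \<alpha> * integral {0..s0} (\<lambda>x. That x 0 - Tm) \<le> 1 / \<alpha> * (Hu * s0\<^sup>2 / 2)"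
          using assms(1) by (intro mult_left_mono) auto
        moreover have "1 / \<alpha> * (Hu * s0\<^sup>2 / 2) + 1 / \<beta> * (s0 - sr) \<le> 0"
          using less_imp_le[OF setpoint] assms(1,2) by (simp add: field_simps)
        ultimately show ?thesis
          by (simp add: s_0)
      qed
      show "continuous_on (liquid_region s - {(0, 0)}) (\<lambda>(x, t). Tx x t)" by (rule rT)
      show "bounded ((\<lambda>(x, t). Tx x t) ` {(x, t) \<in> liquid_region s. t \<le> \<tau>})" for \<tau> by (rule rT)
      show "continuous_on (liquid_region s - {(0, 0)}) (\<lambda>(x, t). Tx x t - Thx x t)"
        using rT(2) rTh(2) by (auto simp: split_beta intro: continuous_intros)
      show "bounded ((\<lambda>(x, t). Tx x t - Thx x t) ` {(x, t) \<in> liquid_region s. t \<le> \<tau>})" for \<tau>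
        using bounded_minus_comp[OF rT(3)[of \<tau>] rTh(3)[of \<tau>]] by (simp add: split_beta)
      show "0 < B" by (rule B)
      show "bs_kernel (lam / \<alpha>) x y \<le> B \<and> \<bar>bs_kernel_xx (lam / \<alpha>) x y\<bar> \<le> B"
        if "x \<in> {0..sr}" "y \<in> {0..sr}" for x y using B(2) that unfolding sr by blast
      show "0 < \<eta>" "\<eta> * c * (1 + sr * B) \<le> \<alpha> / 4" using \<eta> unfolding sr by auto
      show "0 < m" "m \<le> \<alpha> * (pi / (3 * sr))\<^sup>2" "m \<le> c" using m unfolding sr by auto
      show "8 * B \<le> K" "\<alpha> * sr + 2 * c\<^sup>2 * sr / \<alpha> \<le> K * m * \<eta>\<^sup>2" "4 * sr \<le> K * \<eta>\<^sup>2"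
        using K unfolding sr by auto
    qed
    have norm_eq: "stability_norm Tm sr T s That t = \<Phi> t" if "0 \<le> t" for t
    proof -
      have "H1_norm_sq (s t) (\<lambda>x. T x t - That x t) = Le t + Ee t"
        unfolding Le_def Ee_def
        by (rule H1_norm_sq_eq) (intro DERIV_diff rT(5) rTh(5) that)
      moreover have "H1_norm_sq (s t) (\<lambda>x. T x t - Tm) = Lu t + Eu t"
        unfolding Lu_def Eu_def
        by (rule H1_norm_sq_eq) (use that in \<open>auto intro!: derivative_eq_intros rT(5)\<close>)
      ultimately show ?thesis
        by (simp add: stability_norm_def \<Phi>_def)
    qed
    show ?thesis
      using \<Phi>_decay[OF t b(1) b(2-4)[unfolded sr]] unfolding norm_eq[OF t] norm_eq[OF order_refl] D_def sr .
  qed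
  show ?thesis
    by (intro exI[of _ D] exI[of _ b] conjI D b(1)) (use main in blast)
qed

end
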